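(* Let $D$ be the unit ball in $\mathbb{R}^3$. Assume that $n>0$ and $\eta>0$ are constants, where $\sqrt n$ is not an integer or a reciprocal of an integer. Then there exist infinitely many complex-valued (i.e. non-real) interior transmission eigenvalues for $D$, provided that $\eta$ is sufficiently small (depending on $n$).
   Context: For a domain $D$ with unit outward normal $\nu$ and constants $n,\eta$, a number $k\in\mathbb{C}$ is an interior transmission eigenvalue (with conductive boundary condition) if there is a nontrivial pair $(w,v)\in L^2(D)\times L^2(D)$ with $w-v\in H^2(D)\cap H^1_0(D)$ such that $$\Delta w+k^2nw=0,\quad \Delta v+k^2v=0\ \text{ in }D,\qquad w-v=0,\quad \partial_\nu w-\partial_\nu v=\eta v\ \text{ on }\partial D.$$ *)

theory Defs
  imports "HOL-Analysis.Analysis"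
begin

definition partial_deriv :: "'a::euclidean_space \<Rightarrow> ('a \<Rightarrow> complex) \<Rightarrow> 'a \<Rightarrow> complex" where
  "partial_deriv b f x = frechet_derivative f (at x) b"

definition laplacian :: "('a::euclidean_space \<Rightarrow> complex) \<Rightarrow> 'a \<Rightarrow> complex" where
  "laplacian f x = (\<Sum>b\<in>Basis. partial_deriv b (partial_deriv b f) x)"

text \<open>Class C-infinity on the whole space: every iterated partial derivative is (Frechet)
  differentiable everywhere, hence continuous.\<close>

definition smooth :: "('a::euclidean_space \<Rightarrow> complex) \<Rightarrow> bool" where
  "smooth f \<longleftrightarrow> (\<forall>bs. set bs \<subseteq> Basis \<longrightarrow> (\<forall>x. foldr partial_deriv bs f differentiable (at x)))"

definition test_fun :: "'a::euclidean_space set \<Rightarrow> ('a \<Rightarrow> complex) \<Rightarrow> bool" where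
  "test_fun D \<phi> \<longleftrightarrow>
     smooth \<phi> \<and> compact (closure {x. \<phi> x \<noteq> 0}) \<and> closure {x. \<phi> x \<noteq> 0} \<subseteq> D"

text \<open>Functions are not identified when equal almost everywhere; all notions below respect
  almost-everywhere equality.\<close>

definition L2 :: "'a measure \<Rightarrow> ('a \<Rightarrow> complex) set" where
  "L2 M = {f \<in> borel_measurable M. integrable M (\<lambda>x. (norm (f x))\<^sup>2)}"

definition L2_tendsto :: "'a measure \<Rightarrow> (nat \<Rightarrow> 'a \<Rightarrow> complex) \<Rightarrow> ('a \<Rightarrow> complex) \<Rightarrow> bool" where
  "L2_tendsto M F f \<longleftrightarrow>
     (\<lambda>j. \<integral>\<^sup>+ x. ennreal ((norm (F j x - f x))\<^sup>2) \<partial>M) \<longlonglongrightarrow> 0"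

definition has_weak_deriv ::
  "'a::euclidean_space set \<Rightarrow> 'a \<Rightarrow> ('a \<Rightarrow> complex) \<Rightarrow> ('a \<Rightarrow> complex) \<Rightarrow> bool" where
  "has_weak_deriv D b f g \<longleftrightarrow>
     f \<in> L2 (lebesgue_on D) \<and> g \<in> L2 (lebesgue_on D) \<and>
     (\<forall>\<phi>. test_fun D \<phi> \<longrightarrow>
        (LINT x|lebesgue_on D. f x * partial_deriv b \<phi> x) =
        - (LINT x|lebesgue_on D. g x * \<phi> x))"

definition has_weak_laplacian ::
  "'a::euclidean_space set \<Rightarrow> ('a \<Rightarrow> complex) \<Rightarrow> ('a \<Rightarrow> complex) \<Rightarrow> bool" where
  "has_weak_laplacian D f g \<longleftrightarrow>
     f \<in> L2 (lebesgue_on D) \<and> g \<in> L2 (lebesgue_on D) \<and>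
     (\<forall>\<phi>. test_fun D \<phi> \<longrightarrow>
        (LINT x|lebesgue_on D. f x * laplacian \<phi> x) = (LINT x|lebesgue_on D. g x * \<phi> x))"

definition H1 :: "'a::euclidean_space set \<Rightarrow> ('a \<Rightarrow> complex) set" where
  "H1 D = {f \<in> L2 (lebesgue_on D). \<forall>b\<in>Basis. \<exists>g. has_weak_deriv D b f g}"

definition H2 :: "'a::euclidean_space set \<Rightarrow> ('a \<Rightarrow> complex) set" where
  "H2 D = {f \<in> L2 (lebesgue_on D). \<forall>b\<in>Basis. \<exists>g\<in>H1 D. has_weak_deriv D b f g}"

text \<open>Convergence in the norm of \<open>H1 D\<close> of a sequence of smooth functions.\<close>

definition H1_tendsto ::
  "'a::euclidean_space set \<Rightarrow> (nat \<Rightarrow> 'a \<Rightarrow> complex) \<Rightarrow> ('a \<Rightarrow> complex) \<Rightarrow> bool" where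
  "H1_tendsto D \<Phi> f \<longleftrightarrow>
     L2_tendsto (lebesgue_on D) \<Phi> f \<and>
     (\<forall>b\<in>Basis. \<exists>g. has_weak_deriv D b f g \<and>
        L2_tendsto (lebesgue_on D) (\<lambda>j. partial_deriv b (\<Phi> j)) g)"

definition H10 :: "'a::euclidean_space set \<Rightarrow> ('a \<Rightarrow> complex) set" where
  "H10 D = {f \<in> H1 D. \<exists>\<Phi>. (\<forall>j. test_fun D (\<Phi> j)) \<and> H1_tendsto D \<Phi> f}"

text \<open>In the rest, \<open>S\<close> is the surface measure of the boundary of \<open>D\<close> and \<open>\<nu>\<close> its unit outward
  normal. The trace on \<open>H1 D\<close> is the continuous extension of the restriction of functions that
  are smooth up to the boundary.\<close>

definition has_trace ::
  "'a::euclidean_space set \<Rightarrow> 'a measure \<Rightarrow> ('a \<Rightarrow> complex) \<Rightarrow> ('a \<Rightarrow> complex) \<Rightarrow> bool" where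
  "has_trace D S f g \<longleftrightarrow>
     f \<in> H1 D \<and> g \<in> L2 S \<and>
     (\<exists>\<Phi>. (\<forall>j. smooth (\<Phi> j)) \<and> H1_tendsto D \<Phi> f \<and> L2_tendsto S \<Phi> g)"

definition has_normal_deriv ::
  "'a::euclidean_space set \<Rightarrow> 'a measure \<Rightarrow> ('a \<Rightarrow> 'a) \<Rightarrow> ('a \<Rightarrow> complex) \<Rightarrow> ('a \<Rightarrow> complex) \<Rightarrow> bool"
where
  "has_normal_deriv D S \<nu> u h \<longleftrightarrow>
     u \<in> H2 D \<and> h \<in> L2 S \<and>
     (\<exists>G \<gamma>. (\<forall>b\<in>Basis. has_weak_deriv D b u (G b) \<and> has_trace D S (G b) (\<gamma> b)) \<and>
        (AE x in S. h x = (\<Sum>b\<in>Basis. of_real (\<nu> x \<bullet> b) * \<gamma> b x)))"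

text \<open>A function \<open>v\<close> that is merely square integrable with square integrable Laplacian has a
  trace only in the dual space of order minus one half. By Green's second formula its (bilinear)
  pairing with \<open>g\<close> is the integral of \<open>v \<Delta>\<psi> - \<psi> \<Delta>v\<close> over \<open>D\<close>, for any \<open>\<psi>\<close> in
  \<open>H2 D \<inter> H10 D\<close> with normal derivative \<open>g\<close>; these \<open>g\<close> fill the space of order one half.
  \<open>weak_trace_pairing D S \<nu> v g c\<close> means that this pairing has the value \<open>c\<close>.\<close>

definition weak_trace_pairing ::
  "'a::euclidean_space set \<Rightarrow> 'a measure \<Rightarrow> ('a \<Rightarrow> 'a) \<Rightarrow> ('a \<Rightarrow> complex) \<Rightarrow> ('a \<Rightarrow> complex) \<Rightarrow>
     complex \<Rightarrow> bool" where
  "weak_trace_pairing D S \<nu> v g c \<longleftrightarrow>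
     (\<exists>\<psi> \<Delta>\<psi> \<Delta>v. \<psi> \<in> H2 D \<inter> H10 D \<and> has_normal_deriv D S \<nu> \<psi> g \<and>
        has_weak_laplacian D \<psi> \<Delta>\<psi> \<and> has_weak_laplacian D v \<Delta>v \<and>
        c = (LINT x|lebesgue_on D. v x * \<Delta>\<psi> x - \<psi> x * \<Delta>v x))"

text \<open>The condition \<open>w - v = 0\<close> on the boundary is membership of \<open>w - v\<close> in \<open>H10 D\<close>. The
  conductive condition is an equality of functionals, tested against all \<open>g\<close> of order one half.\<close>

definition interior_transmission_eigenvalue ::
  "'a::euclidean_space set \<Rightarrow> 'a measure \<Rightarrow> ('a \<Rightarrow> 'a) \<Rightarrow> real \<Rightarrow> real \<Rightarrow> complex \<Rightarrow> bool" where
  "interior_transmission_eigenvalue D S \<nu> n \<eta> k \<longleftrightarrow>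
     (\<exists>w v. w \<in> L2 (lebesgue_on D) \<and> v \<in> L2 (lebesgue_on D) \<and>
        \<not> (AE x in lebesgue_on D. w x = 0 \<and> v x = 0) \<and>
        (\<lambda>x. w x - v x) \<in> H2 D \<inter> H10 D \<and>
        has_weak_laplacian D w (\<lambda>x. - (k\<^sup>2 * of_real n * w x)) \<and>
        has_weak_laplacian D v (\<lambda>x. - (k\<^sup>2 * v x)) \<and>
        (\<exists>h. has_normal_deriv D S \<nu> (\<lambda>x. w x - v x) h \<and>
           (\<forall>g c. weak_trace_pairing D S \<nu> v g c \<longrightarrow>
              (LINT x|S. h x * g x) = of_real \<eta> * c)))"

text \<open>Surface measure of the unit sphere, carried by the ambient space: by polar coordinates the
  area of a subset is the dimension times the volume of the cone over it in the unit ball.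
  The map \<open>sgn\<close> is \<open>x / norm x\<close>; the origin, which it sends to itself, is a null set.\<close>

definition sphere_measure :: "'a::euclidean_space measure" where
  "sphere_measure =
     scale_measure (of_nat DIM('a)) (distr (restrict_space lborel (ball 0 1)) borel sgn)"

end

theory Submission
  imports Defs "HOL-Complex_Analysis.Complex_Analysis" "HOL-Real_Asymp.Real_Asymp"
begin

text \<open>For the radial pair \<open>w = B sin (k m r) / r\<close>, \<open>v = A sin (k r) / r\<close> with \<open>m = sqrt n\<close> the boundary
  conditions have a nontrivial solution iff
  \<open>F k + \<eta> / k sin k sin (m k) = 0\<close>, where \<open>F z = sin (m z) cos z - m cos (m z) sin z\<close>.

  If \<open>F\<close> had no zero in the upper half plane, it would be bounded below there relative to its
  exponential growth (almost periodicity and Hurwitz' theorem), so the quotient of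
  \<open>F (z - i h)\<close> and \<open>F (z + i h)\<close> would be bounded in the upper half plane and of modulus \<open>1\<close> on the
  real line, hence of modulus at most \<open>1\<close> (Phragmen-Lindelof): the modulus of \<open>F\<close> would not drop
  below its value at a real point \<open>x\<close> along the vertical line through \<open>x\<close>. This fails at \<open>x = \<pi>\<close> if
  \<open>m > 1\<close> is not an integer, and the case \<open>m < 1\<close> follows by scaling. Almost periods of \<open>F\<close> and
  Hurwitz' theorem then carry a single nonreal zero of \<open>F\<close> to infinitely many nonreal zeros of
  the perturbed function, for every \<open>\<eta>\<close>.\<close>

section \<open>Smooth functions\<close>

lemma smoothI_coinduct:
  assumes "P f" 
    and "\<And>f x. P f \<Longrightarrow> f differentiable (at x)"
    and "\<And>f b. P f \<Longrightarrow> b \<in> Basis \<Longrightarrow> P (partial_deriv b f)"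
  shows "smooth f"
proof -
  have "P (foldr partial_deriv bs f)" if "set bs \<subseteq> Basis" for bs
    using that by (induction bs) (auto intro: assms)
  then show ?thesis unfolding smooth_def using assms(2) by blast
qed

lemma smooth_differentiable: "smooth f \<Longrightarrow> f differentiable (at x)"
  unfolding smooth_def by (drule spec[of _ "[]"]) simp

lemma smooth_partial_deriv:
  assumes "smooth f" "b \<in> Basis"
  shows "smooth (partial_deriv b f)"
  unfolding smooth_def
proof (intro allI impI)
  fix bs :: "'a list" and x assume "set bs \<subseteq> Basis"
  then have "set (bs @ [b]) \<subseteq> Basis" using assms by auto
  then have "foldr partial_deriv (bs @ [b]) f differentiable (at x)"
    using assms(1) unfolding smooth_def by blast
  then show "foldr partial_deriv bs (partial_deriv b f) differentiable (at x)" by simp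
qed

lemma partial_deriv_eqI: "(f has_derivative f') (at x) \<Longrightarrow> partial_deriv b f x = f' b"
  unfolding partial_deriv_def by (simp add: frechet_derivative_at[symmetric])

lemma smooth_has_derivative: "smooth f \<Longrightarrow> (f has_derivative frechet_derivative f (at x)) (at x)"
  by (simp add: smooth_differentiable flip: frechet_derivative_works)

lemma smooth_has_derivative_sum:
  assumes "smooth f"
  shows "(f has_derivative (\<lambda>h. \<Sum>b\<in>Basis. (h \<bullet> b) *\<^sub>R partial_deriv b f x)) (at x)"
proof -
  have "frechet_derivative f (at x) h = (\<Sum>b\<in>Basis. (h \<bullet> b) *\<^sub>R partial_deriv b f x)" for h
  proof -
    have lin: "linear (frechet_derivative f (at x))"
      by (rule has_derivative_linear[OF smooth_has_derivative[OF assms]])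
    have "frechet_derivative f (at x) (\<Sum>b\<in>Basis. (h \<bullet> b) *\<^sub>R b) = (\<Sum>b\<in>Basis. (h \<bullet> b) *\<^sub>R partial_deriv b f x)"
      by (simp add: linear_sum[OF lin] linear_scale[OF lin] partial_deriv_def)
    then show ?thesis by (simp add: euclidean_representation)
  qed
  then have "frechet_derivative f (at x) = (\<lambda>h. \<Sum>b\<in>Basis. (h \<bullet> b) *\<^sub>R partial_deriv b f x)" by (rule ext)
  then show ?thesis using smooth_has_derivative[OF assms, of x] by (simp only:)
qed

lemma smooth_continuous_on: "smooth f \<Longrightarrow> continuous_on A f"
  by (intro continuous_at_imp_continuous_on ballI differentiable_imp_continuous_within smooth_differentiable)

lemma smooth_bounded_on_cball:
  fixes f :: "'a::euclidean_space \<Rightarrow> complex"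
  assumes "smooth f"
  obtains B where "B \<ge> 0" "\<And>x. norm x \<le> R \<Longrightarrow> norm (f x) \<le> B"
proof -
  have comp: "compact (f ` cball 0 R)"
    by (intro compact_continuous_image smooth_continuous_on assms compact_cball)
  then obtain B where "\<forall>y\<in>f ` cball 0 R. norm y \<le> B"
    using compact_imp_bounded[OF comp] unfolding bounded_iff by blast
  then have "norm (f x) \<le> max B 0" if "norm x \<le> R" for x
    using that by (simp add: le_max_iff_disj)
  then show ?thesis using that[of "max B 0"] by simp
qed

lemma smooth_lipschitz_on_cball:
  fixes f :: "'a::euclidean_space \<Rightarrow> complex"
  assumes "smooth f"
  obtains L where "L \<ge> 0" "\<And>x y. \<lbrakk>norm x \<le> R; norm y \<le> R\<rbrakk> \<Longrightarrow> norm (f x - f y) \<le> L * norm (x - y)"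
proof -
  have "\<forall>b\<in>Basis. \<exists>B\<ge>0. \<forall>x. norm x \<le> R \<longrightarrow> norm (partial_deriv b f x) \<le> B"
  proof
    fix b :: 'a assume "b \<in> Basis"
    then obtain B where "B \<ge> 0" "\<And>x. norm x \<le> R \<Longrightarrow> norm (partial_deriv b f x) \<le> B"
      using smooth_bounded_on_cball[OF smooth_partial_deriv[OF assms]] by blast
    then show "\<exists>B\<ge>0. \<forall>x. norm x \<le> R \<longrightarrow> norm (partial_deriv b f x) \<le> B" by blast
  qed
  from bchoice[OF this] obtain B where B: "\<And>b. b \<in> Basis \<Longrightarrow> B b \<ge> 0"
    "\<And>b x. \<lbrakk>b \<in> Basis; norm x \<le> R\<rbrakk> \<Longrightarrow> norm (partial_deriv b f x) \<le> B b" by blast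
  define L where "L = (\<Sum>b\<in>Basis. B b)"
  have "norm (f x - f y) \<le> L * norm (x - y)" if "norm x \<le> R" "norm y \<le> R" for x y
  proof (rule differentiable_bound[where S="cball 0 R"])
    show "(f has_derivative (\<lambda>h. \<Sum>b\<in>Basis. (h \<bullet> b) *\<^sub>R partial_deriv b f x)) (at x within cball 0 R)" for x
      by (rule has_derivative_at_withinI[OF smooth_has_derivative_sum[OF assms]])
    show "onorm (\<lambda>h. \<Sum>b\<in>Basis. (h \<bullet> b) *\<^sub>R partial_deriv b f x) \<le> L" if "x \<in> cball 0 R" for x
    proof (rule onorm_le)
      fix h :: 'a
      have "norm (\<Sum>b\<in>Basis. (h \<bullet> b) *\<^sub>R partial_deriv b f x) \<le> (\<Sum>b\<in>Basis. norm h * B b)"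
        using that B Basis_le_norm by (intro sum_norm_le) (auto intro!: mult_mono)
      then show "norm (\<Sum>b\<in>Basis. (h \<bullet> b) *\<^sub>R partial_deriv b f x) \<le> L * norm h"
        by (simp add: L_def sum_distrib_left mult.commute)
    qed
  qed (use that in auto)
  moreover have "L \<ge> 0" unfolding L_def by (intro sum_nonneg B)
  ultimately show ?thesis using that by blast
qed

definition smooth_on_reals :: "(real \<Rightarrow> complex) \<Rightarrow> bool" where
  "smooth_on_reals g \<longleftrightarrow> (\<exists>G. G (0::nat) = g \<and> (\<forall>i t. (G i has_vector_derivative G (Suc i) t) (at t)))"

inductive smooth_algebra :: "('a::euclidean_space \<Rightarrow> complex) \<Rightarrow> bool" where
  base: "smooth f \<Longrightarrow> smooth_algebra f"
| const: "smooth_algebra (\<lambda>_. c)"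
| inner: "smooth_algebra (\<lambda>x. of_real (x \<bullet> a))"
| radial: "\<forall>i t. ((G :: nat \<Rightarrow> real \<Rightarrow> complex) i has_vector_derivative G (Suc i) t) (at t) \<Longrightarrow> smooth_algebra (\<lambda>x. G i (x \<bullet> x))"
| add: "smooth_algebra f \<Longrightarrow> smooth_algebra g \<Longrightarrow> smooth_algebra (\<lambda>x. f x + g x)"
| mult: "smooth_algebra f \<Longrightarrow> smooth_algebra g \<Longrightarrow> smooth_algebra (\<lambda>x. f x * g x)"

lemma has_derivative_radial:
  assumes "(g has_vector_derivative g') (at (x \<bullet> x))"
  shows "((\<lambda>x::'a::euclidean_space. g (x \<bullet> x)) has_derivative (\<lambda>h. (2 * (x \<bullet> h)) *\<^sub>R g')) (at x)"
proof -
  have "((\<lambda>x::'a. x \<bullet> x) has_derivative (\<lambda>h. 2 * (x \<bullet> h))) (at x)"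
    by (auto intro!: derivative_eq_intros simp: inner_commute)
  from has_derivative_compose[OF this, of g "\<lambda>s. s *\<^sub>R g'"] assms
  show ?thesis by (simp add: has_vector_derivative_def)
qed

lemma partial_deriv_radial:
  assumes "(g has_vector_derivative g') (at (x \<bullet> x))"
  shows "partial_deriv b (\<lambda>x. g (x \<bullet> x)) x = of_real (2 * (x \<bullet> b)) * g'"
  using partial_deriv_eqI[OF has_derivative_radial[OF assms], of b] by (simp add: scaleR_conv_of_real)

lemma partial_deriv_add:
  assumes "f differentiable (at x)" "g differentiable (at x)"
  shows "partial_deriv b (\<lambda>x. f x + g x) x = partial_deriv b f x + partial_deriv b g x"
  using partial_deriv_eqI[OF has_derivative_add[OF assms[unfolded frechet_derivative_works]], of b]
  by (simp add: partial_deriv_def)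

lemma partial_deriv_mult:
  assumes "f differentiable (at x)" "g differentiable (at x)"
  shows "partial_deriv b (\<lambda>x. f x * g x) x = partial_deriv b f x * g x + f x * partial_deriv b g x"
  using partial_deriv_eqI[OF has_derivative_mult[OF assms[unfolded frechet_derivative_works]], of b]
  by (simp add: partial_deriv_def)

lemma partial_deriv_const [simp]: "partial_deriv b (\<lambda>_. c) = (\<lambda>_. 0)"
  by (rule ext) (simp add: partial_deriv_def)

lemma has_derivative_of_real_inner:
  "((\<lambda>x::'a::euclidean_space. of_real (x \<bullet> a) :: complex) has_derivative (\<lambda>h. of_real (h \<bullet> a))) (at x)"
  by (auto intro!: derivative_eq_intros)

lemma partial_deriv_inner: "partial_deriv b (\<lambda>x. of_real (x \<bullet> a)) x = of_real (b \<bullet> a)"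
  by (rule partial_deriv_eqI[OF has_derivative_of_real_inner])

lemma smooth_algebra_differentiable: "smooth_algebra f \<Longrightarrow> f differentiable (at x)"
proof (induction rule: smooth_algebra.induct)
  case (radial G i)
  then show ?case using has_derivative_radial unfolding differentiable_def by blast
next
  case (inner a)
  then show ?case using has_derivative_of_real_inner unfolding differentiable_def by blast
qed (auto intro: smooth_differentiable differentiable_add differentiable_mult)

lemma smooth_algebra_partial_deriv:
  assumes "smooth_algebra f" "b \<in> Basis"
  shows "smooth_algebra (partial_deriv b f)"
  using assms(1)
proof (induction rule: smooth_algebra.induct)
  case (base f)
  then show ?case using assms smooth_partial_deriv smooth_algebra.base by blast
next
  case (const c)
  then show ?case by (simp add: smooth_algebra.const)
next
  case (inner a)
  then show ?case unfolding partial_deriv_inner[abs_def] by (rule smooth_algebra.const)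
next
  case (radial G i)
  have "partial_deriv b (\<lambda>x. G i (x \<bullet> x)) = (\<lambda>x. (2 * of_real (x \<bullet> b)) * G (Suc i) (x \<bullet> x))"
    by (simp add: fun_eq_iff partial_deriv_radial[OF radial[rule_format]])
  then show ?case using radial
    by (simp only:) (intro smooth_algebra.intros)
next
  case (add f g)
  have "partial_deriv b (\<lambda>x. f x + g x) = (\<lambda>x. partial_deriv b f x + partial_deriv b g x)"
    using add by (intro ext partial_deriv_add smooth_algebra_differentiable)
  then show ?case using add by (simp add: smooth_algebra.add)
next
  case (mult f g)
  have "partial_deriv b (\<lambda>x. f x * g x) = (\<lambda>x. partial_deriv b f x * g x + f x * partial_deriv b g x)"
    using mult by (intro ext partial_deriv_mult smooth_algebra_differentiable)
  then show ?case using mult by (simp add: smooth_algebra.add smooth_algebra.mult)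
qed

lemma smooth_algebra_imp_smooth: "smooth_algebra f \<Longrightarrow> smooth f"
  by (rule smoothI_coinduct[where P=smooth_algebra])
     (auto intro: smooth_algebra_differentiable smooth_algebra_partial_deriv)

lemma smooth_const: "smooth (\<lambda>_. c)"
  by (intro smooth_algebra_imp_smooth smooth_algebra.const)

lemma smooth_inner: "smooth (\<lambda>x. of_real (x \<bullet> a))"
  by (intro smooth_algebra_imp_smooth smooth_algebra.inner)

lemma smooth_add: "smooth f \<Longrightarrow> smooth g \<Longrightarrow> smooth (\<lambda>x. f x + g x)"
  by (rule smooth_algebra_imp_smooth) (intro smooth_algebra.add smooth_algebra.base)

lemma smooth_mult: "smooth f \<Longrightarrow> smooth g \<Longrightarrow> smooth (\<lambda>x. f x * g x)"
  by (rule smooth_algebra_imp_smooth) (intro smooth_algebra.mult smooth_algebra.base)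

lemma smooth_diff: "smooth f \<Longrightarrow> smooth g \<Longrightarrow> smooth (\<lambda>x. f x - g x)"
  using smooth_add[of f "\<lambda>x. -1 * g x"] smooth_mult[OF smooth_const, of g "-1"] by simp

lemma smooth_radial: "smooth_on_reals g \<Longrightarrow> smooth (\<lambda>x. g (x \<bullet> x))"
  unfolding smooth_on_reals_def using smooth_algebra.radial smooth_algebra_imp_smooth by blast

lemma smooth_on_reals_affine:
  assumes "smooth_on_reals g"
  shows "smooth_on_reals (\<lambda>t. g (a * t + c))"
proof -
  obtain G where G: "G (0::nat) = g" "\<And>i t. (G i has_vector_derivative G (Suc i) t) (at t)"
    using assms unfolding smooth_on_reals_def by blast
  have "((\<lambda>t. a ^ i *\<^sub>R G i (a * t + c)) has_vector_derivative a ^ Suc i *\<^sub>R G (Suc i) (a * t + c)) (at t)" for i t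
  proof -
    have "((\<lambda>t. a * t + c) has_vector_derivative a) (at t)"
      by (auto intro!: derivative_eq_intros)
    from vector_diff_chain_at[OF this G(2)]
    have "((\<lambda>t. G i (a * t + c)) has_vector_derivative a *\<^sub>R G (Suc i) (a * t + c)) (at t)"
      by (simp add: o_def)
    from has_vector_derivative_scaleR[OF DERIV_const this, of "a ^ i"]
    show ?thesis by (simp add: mult.commute)
  qed
  then show ?thesis unfolding smooth_on_reals_def
    by (intro exI[of _ "\<lambda>i t. a ^ i *\<^sub>R G i (a * t + c)"]) (simp add: G(1))
qed

lemma smooth_on_reals_holomorphic:
  assumes "f holomorphic_on UNIV"
  shows "smooth_on_reals (\<lambda>t. f (of_real t))"
proof -
  have "((\<lambda>t. (deriv ^^ i) f (of_real t)) has_vector_derivative (deriv ^^ Suc i) f (of_real t)) (at t)" for i t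
  proof (rule has_vector_derivative_real_field)
    have "(deriv ^^ i) f holomorphic_on UNIV"
      by (rule holomorphic_higher_deriv[OF assms open_UNIV])
    then show "((deriv ^^ i) f has_field_derivative (deriv ^^ Suc i) f (of_real t)) (at (of_real t))"
      by (simp add: holomorphic_derivI)
  qed
  then show ?thesis unfolding smooth_on_reals_def
    by (intro exI[of _ "\<lambda>i t. (deriv ^^ i) f (of_real t)"]) simp
qed

definition flat_exp :: "real poly \<Rightarrow> real \<Rightarrow> real" where
  "flat_exp p t = (if t > 0 then poly p (1 / t) * exp (- 1 / t) else 0)"

lemma flat_exp_quotient_tendsto_0: "((\<lambda>t. flat_exp p t / t) \<longlongrightarrow> 0) (at 0)"
proof -
  have "((\<lambda>t. poly ([:0, 1:] * p) (1 / t) * exp (- 1 / t)) \<longlongrightarrow> 0) (at_right 0)"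
  proof -
    have "((\<lambda>y. poly q y * exp (- y)) \<longlongrightarrow> 0) at_top" for q :: "real poly"
    proof -
      have "((\<lambda>y. \<Sum>i\<le>degree q. coeff q i * (y ^ i / exp y)) \<longlongrightarrow> (\<Sum>i\<le>degree q. coeff q i * 0)) at_top"
        by (intro tendsto_intros tendsto_power_div_exp_0)
      then show ?thesis by (simp add: poly_altdef exp_minus divide_inverse sum_distrib_right mult.assoc)
    qed
    from filterlim_compose[OF this filterlim_inverse_at_top_right, of "[:0, 1:] * p"]
    show ?thesis by (simp add: divide_inverse)
  qed
  then have "((\<lambda>t. flat_exp p t / t) \<longlongrightarrow> 0) (at_right 0)"
    by (rule Lim_transform_eventually)
       (auto simp: eventually_at_filter flat_exp_def intro!: always_eventually)
  moreover have "((\<lambda>t. flat_exp p t / t) \<longlongrightarrow> 0) (at_left 0)"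
    by (rule Lim_transform_eventually[OF tendsto_const])
       (auto simp: eventually_at_filter flat_exp_def intro!: always_eventually)
  ultimately show ?thesis by (simp add: filterlim_split_at)
qed

lemma has_real_derivative_flat_exp:
  "(flat_exp p has_real_derivative flat_exp ([:0, 0, 1:] * (p - pderiv p)) t) (at t)"
proof -
  consider "t > 0" | "t = 0" | "t < 0" by linarith
  then show ?thesis
  proof cases
    case 1
    have "((\<lambda>t. poly p (1 / t) * exp (- 1 / t)) has_real_derivative
        poly ([:0, 0, 1:] * (p - pderiv p)) (1 / t) * exp (- 1 / t)) (at t)"
      using 1 by (auto intro!: derivative_eq_intros DERIV_chain2[OF poly_DERIV] simp: field_simps power2_eq_square)
    then have "(flat_exp p has_real_derivative
        poly ([:0, 0, 1:] * (p - pderiv p)) (1 / t) * exp (- 1 / t)) (at t)"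
      by (rule has_field_derivative_transform_within_open[where S="{0<..}"]) (use 1 in \<open>auto simp: flat_exp_def\<close>)
    then show ?thesis using 1 by (simp add: flat_exp_def)
  next
    case 2
    then show ?thesis using flat_exp_quotient_tendsto_0[of p]
      by (simp add: has_field_derivative_iff flat_exp_def)
  next
    case 3
    have "((\<lambda>_. 0) has_real_derivative 0) (at t)" by simp
    then have "(flat_exp p has_real_derivative 0) (at t)"
      by (rule has_field_derivative_transform_within_open[where S="{..<0}"]) (use 3 in \<open>auto simp: flat_exp_def\<close>)
    then show ?thesis using 3 by (simp add: flat_exp_def)
  qed
qed

lemma smooth_on_reals_flat_exp: "smooth_on_reals (\<lambda>t. of_real (flat_exp p t))"
  unfolding smooth_on_reals_def
  by (intro exI[of _ "\<lambda>i t. of_real (flat_exp (((\<lambda>q. [:0, 0, 1:] * (q - pderiv q)) ^^ i) p) t)"] conjI allI)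
     (simp_all del: mult_pCons_left
        add: has_vector_derivative_of_real has_real_derivative_flat_exp flip: has_real_derivative_iff_has_vector_derivative)

section \<open>The divergence theorem on the unit ball\<close>

lemma has_derivative_directional_sequence:
  fixes f :: "'a::real_normed_vector \<Rightarrow> 'b::real_normed_vector"
  assumes "(f has_derivative D) (at x)" "norm b = 1"
  shows "(\<lambda>n. real (Suc n) *\<^sub>R (f (x + inverse (real (Suc n)) *\<^sub>R b) - f x)) \<longlonglongrightarrow> D b"
proof -
  let ?h = "\<lambda>n. inverse (real (Suc n)) *\<^sub>R b"
  have D: "linear D" using assms(1) by (rule has_derivative_linear)
  have "filterlim ?h (at 0) sequentially"
  proof (rule filterlim_atI)
    have "?h \<longlonglongrightarrow> 0 *\<^sub>R b" by (intro tendsto_intros LIMSEQ_inverse_real_of_nat)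
    then show "?h \<longlonglongrightarrow> 0" by simp
    show "\<forall>\<^sub>F n in sequentially. ?h n \<noteq> 0" using assms(2) by force
  qed
  moreover have "((\<lambda>h. norm (f (x + h) - f x - D h) / norm h) \<longlongrightarrow> 0) (at 0)"
    using assms(1) by (simp add: has_derivative_at)
  ultimately have "(\<lambda>n. norm (f (x + ?h n) - f x - D (?h n)) / norm (?h n)) \<longlonglongrightarrow> 0"
    by (rule filterlim_compose[rotated])
  moreover have "norm (f (x + ?h n) - f x - D (?h n)) / norm (?h n) = norm (real (Suc n) *\<^sub>R (f (x + ?h n) - f x) - D b)" for n
  proof -
    have "real (Suc n) *\<^sub>R (f (x + ?h n) - f x) - D b = real (Suc n) *\<^sub>R (f (x + ?h n) - f x - D (?h n))"
      by (simp add: linear_scale[OF D] scaleR_diff_right del: of_nat_Suc)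
    then show ?thesis using assms(2) by (simp add: divide_inverse del: of_nat_Suc)
  qed
  ultimately have "(\<lambda>n. norm (real (Suc n) *\<^sub>R (f (x + ?h n) - f x) - D b)) \<longlonglongrightarrow> 0" by (simp only:)
  then show ?thesis by (simp only: tendsto_norm_zero_iff LIM_zero_iff)
qed

lemma lborel_integral_translate:
  fixes f :: "'a::euclidean_space \<Rightarrow> complex"
  assumes [measurable]: "f \<in> borel_measurable borel"
  shows "(\<integral>x. f (x + c) \<partial>lborel) = (\<integral>x. f x \<partial>lborel)"
  by (subst (2) lborel_distr_plus[of c, symmetric], subst integral_distr) (auto simp: add.commute)

text \<open>Translation invariance makes the integral of every difference quotient vanish.\<close>

lemma integral_directional_derivative_eq_0:
  fixes f :: "'a::euclidean_space \<Rightarrow> complex"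
  assumes b: "norm b = 1" and L: "L \<ge> 0"
    and [measurable]: "f \<in> borel_measurable borel"
    and supp: "\<And>x. norm x \<ge> R \<Longrightarrow> f x = 0"
    and lip: "\<And>x y. \<lbrakk>norm x \<le> R + 2; norm y \<le> R + 2\<rbrakk> \<Longrightarrow> norm (f x - f y) \<le> L * norm (x - y)"
    and deriv: "AE x in lborel. (f has_derivative D x) (at x)"
    and [measurable]: "(\<lambda>x. D x b) \<in> borel_measurable borel"
  shows "(\<integral>x. D x b \<partial>lborel) = 0"
proof -
  define q where "q = (\<lambda>n x. real (Suc n) *\<^sub>R (f (x + inverse (real (Suc n)) *\<^sub>R b) - f x))"
  have [measurable]: "q n \<in> borel_measurable borel" for n unfolding q_def by measurable
  have int_f: "integrable lborel f"
  proof (rule integrableI_bounded_set)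
    show "emeasure lborel (cball (0::'a) \<bar>R\<bar>) < \<infinity>" by (intro emeasure_bounded_finite bounded_cball)
    show "AE x in lborel. x \<in> cball (0::'a) \<bar>R\<bar> \<longrightarrow> norm (f x) \<le> L * (\<bar>R\<bar> + \<bar>R\<bar>)"
    proof (intro always_eventually allI impI)
      fix x :: 'a assume x: "x \<in> cball 0 \<bar>R\<bar>"
      show "norm (f x) \<le> L * (\<bar>R\<bar> + \<bar>R\<bar>)"
      proof (cases "norm x < R")
        case True
        then have R: "R > 0" using norm_ge_zero[of x] by linarith
        have "norm (f x - f (R *\<^sub>R b)) \<le> L * norm (x - R *\<^sub>R b)"
          using True R b by (intro lip) auto
        also have "\<dots> \<le> L * (\<bar>R\<bar> + \<bar>R\<bar>)"
          using norm_triangle_ineq4[of x "R *\<^sub>R b"] b True R L by (intro mult_left_mono) auto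
        finally show ?thesis using supp[of "R *\<^sub>R b"] b R by simp
      next
        case False
        then show ?thesis using supp[of x] L by simp
      qed
    qed
    show "AE x in lborel. x \<notin> cball (0::'a) \<bar>R\<bar> \<longrightarrow> f x = 0"
      using supp by (auto intro!: always_eventually)
  qed auto
  have int_ft: "integrable lborel (\<lambda>x. f (x + c))" for c
    using int_f by (subst (asm) lborel_distr_plus[of c, symmetric], subst (asm) integrable_distr_eq) (auto simp: add.commute)
  have q0: "(\<integral>x. q n x \<partial>lborel) = 0" for n
    unfolding q_def integral_scaleR_right
    by (subst Bochner_Integration.integral_diff[OF int_ft int_f]) (simp add: lborel_integral_translate)
  have "(\<lambda>n. \<integral>x. q n x \<partial>lborel) \<longlonglongrightarrow> (\<integral>x. D x b \<partial>lborel)"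
  proof (rule integral_dominated_convergence[where w="\<lambda>x. indicator (cball 0 (\<bar>R\<bar> + 1)) x *\<^sub>R L"])
    show "integrable lborel (\<lambda>x. indicator (cball (0::'a) (\<bar>R\<bar> + 1)) x *\<^sub>R L)"
      by (intro integrableI_bounded_set_indicator emeasure_bounded_finite bounded_cball) auto
    show "AE x in lborel. (\<lambda>n. q n x) \<longlonglongrightarrow> D x b"
      using deriv by eventually_elim (unfold q_def, rule has_derivative_directional_sequence[OF _ b])
    show "AE x in lborel. norm (q n x) \<le> indicator (cball 0 (\<bar>R\<bar> + 1)) x *\<^sub>R L" for n
    proof (intro always_eventually allI)
      fix x :: 'a
      define h where "h = inverse (real (Suc n)) *\<^sub>R b"
      have h: "norm h = inverse (real (Suc n))" "norm h \<le> 1"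
        using b by (simp_all add: h_def divide_simps)
      have le: "norm (x + h) \<le> norm x + norm h" "norm x \<le> norm (x + h) + norm h"
        using norm_triangle_ineq[of x h] norm_triangle_ineq4[of "x + h" h] by auto
      show "norm (q n x) \<le> indicator (cball 0 (\<bar>R\<bar> + 1)) x *\<^sub>R L"
      proof (cases "norm x \<le> R + 1")
        case True
        have "norm (f (x + h) - f x) \<le> L * norm (x + h - x)"
          using True le h by (intro lip) auto
        then have "norm (q n x) \<le> real (Suc n) * (L * norm h)"
          unfolding q_def h_def[symmetric] by (simp add: mult_left_mono del: of_nat_Suc)
        also have "\<dots> = L" unfolding h(1) by simp
        finally show ?thesis using True by simp
      next
        case False
        then have "f x = 0" "f (x + h) = 0" using le h by (auto intro!: supp)
        then show ?thesis using L unfolding q_def h_def[symmetric] by (simp add: indicator_def)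
      qed
    qed
  qed auto
  then show ?thesis unfolding q0 using LIMSEQ_unique tendsto_const by metis
qed

lemma smooth_borel_measurable: "smooth f \<Longrightarrow> f \<in> borel_measurable borel"
  by (intro borel_measurable_continuous_onI smooth_continuous_on)

lemma smooth_partial_deriv_measurable:
  "smooth f \<Longrightarrow> b \<in> Basis \<Longrightarrow> partial_deriv b f \<in> borel_measurable borel"
  by (intro smooth_borel_measurable smooth_partial_deriv)

lemma ball_set_integrable:
  fixes f :: "'a::euclidean_space \<Rightarrow> complex"
  assumes "f \<in> borel_measurable borel" "\<And>x. norm x < r \<Longrightarrow> norm (f x) \<le> B"
  shows "set_integrable lborel (ball 0 r) f"
  unfolding set_integrable_def
  using assms emeasure_bounded_finite[OF bounded_ball[of "0::'a" r]]
  by (intro integrableI_bounded_set_indicator[where B=B]) auto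

lemma smooth_ball_set_integrable:
  assumes "smooth f"
  shows "set_integrable lborel (ball 0 r) f"
proof -
  obtain B where "\<And>x. norm x \<le> r \<Longrightarrow> norm (f x) \<le> B"
    using smooth_bounded_on_cball[OF assms, of r] by blast
  then show ?thesis using smooth_borel_measurable[OF assms] by (intro ball_set_integrable[of f r B]) auto
qed

lemma ball_weighted_divergence:
  fixes F :: "'a::euclidean_space \<Rightarrow> complex"
  assumes F: "smooth F" and b: "b \<in> Basis" and r: "r > 0"
  shows "(LINT x:ball 0 r|lborel. of_real (r\<^sup>2 - x \<bullet> x) * partial_deriv b F x) =
         (LINT x:ball 0 r|lborel. of_real (2 * (x \<bullet> b)) * F x)"
proof -
  have nb: "norm b = 1" using b by simp
  have [measurable]: "F \<in> borel_measurable borel" "partial_deriv b F \<in> borel_measurable borel"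
    using F b by (auto intro: smooth_borel_measurable smooth_partial_deriv_measurable)
  define w where "w = (\<lambda>x::'a. max 0 (r\<^sup>2 - x \<bullet> x))"
  have [measurable]: "w \<in> borel_measurable borel" unfolding w_def by measurable
  define f where "f = (\<lambda>x. of_real (w x) * F x)"
  define D where "D = (\<lambda>x h. indicator (ball 0 r) x *\<^sub>R
      (of_real (r\<^sup>2 - x \<bullet> x) * frechet_derivative F (at x) h - of_real (2 * (x \<bullet> h)) * F x))"
  obtain B where B: "B \<ge> 0" "\<And>x. norm x \<le> r + 2 \<Longrightarrow> norm (F x) \<le> B"
    using smooth_bounded_on_cball[OF F, of "r + 2"] by blast
  obtain L where L: "L \<ge> 0" "\<And>x y. \<lbrakk>norm x \<le> r + 2; norm y \<le> r + 2\<rbrakk> \<Longrightarrow> norm (F x - F y) \<le> L * norm (x - y)"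
    using smooth_lipschitz_on_cball[OF F, of "r + 2"] by blast
  have w: "0 \<le> w x" "w x \<le> r\<^sup>2" for x by (auto simp: w_def)
  have w_lip: "\<bar>w x - w y\<bar> \<le> 2 * (r + 2) * norm (x - y)" if "norm x \<le> r + 2" "norm y \<le> r + 2" for x y
  proof -
    have "\<bar>w x - w y\<bar> \<le> \<bar>x \<bullet> x - y \<bullet> y\<bar>" by (auto simp: w_def)
    also have "x \<bullet> x - y \<bullet> y = (x - y) \<bullet> (x + y)" by (simp add: algebra_simps inner_commute)
    also have "\<bar>\<dots>\<bar> \<le> norm (x - y) * norm (x + y)" by (rule Cauchy_Schwarz_ineq2)
    also have "\<dots> \<le> norm (x - y) * (2 * (r + 2))"
      using norm_triangle_ineq[of x y] that by (intro mult_left_mono) auto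
    finally show ?thesis by (simp add: mult.commute)
  qed
  have "(\<integral>x. D x b \<partial>lborel) = 0"
  proof (rule integral_directional_derivative_eq_0[where f=f and R=r and L="r\<^sup>2 * L + 2 * (r + 2) * B"])
    show "norm b = 1" by (rule nb)
    show "r\<^sup>2 * L + 2 * (r + 2) * B \<ge> 0" using B L r by simp
    show "f \<in> borel_measurable borel" unfolding f_def by measurable
    show "f x = 0" if "norm x \<ge> r" for x
    proof -
      have "r\<^sup>2 \<le> x \<bullet> x" using that r by (simp add: power_mono flip: power2_norm_eq_inner)
      then show ?thesis by (simp add: f_def w_def)
    qed
    show "norm (f x - f y) \<le> (r\<^sup>2 * L + 2 * (r + 2) * B) * norm (x - y)"
      if "norm x \<le> r + 2" "norm y \<le> r + 2" for x y
    proof -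
      have "f x - f y = of_real (w x) * (F x - F y) + of_real (w x - w y) * F y"
        by (simp add: f_def algebra_simps)
      also have "norm \<dots> \<le> w x * norm (F x - F y) + \<bar>w x - w y\<bar> * norm (F y)"
        using w by (intro order_trans[OF norm_triangle_ineq]) (simp add: norm_mult flip: of_real_diff)
      also have "\<dots> \<le> r\<^sup>2 * (L * norm (x - y)) + (2 * (r + 2) * norm (x - y)) * B"
        using w w_lip[OF that] L(2)[OF that] B(1) B(2)[OF that(2)] by (intro add_mono mult_mono) auto
      finally show ?thesis by (simp add: algebra_simps)
    qed
    show "(\<lambda>x. D x b) \<in> borel_measurable borel"
      unfolding D_def partial_deriv_def[symmetric]
      by (intro borel_measurable_scaleR borel_measurable_indicator borel_measurable_diff borel_measurable_times) auto
    have null: "sphere (0::'a) r \<in> null_sets lborel"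
      using negligible_sphere[of "0::'a" r] by (simp add: negligible_iff_null_sets null_sets_completion_iff)
    show "AE x in lborel. (f has_derivative D x) (at x)"
    proof (rule AE_mp[OF AE_not_in[OF null]], intro always_eventually allI impI)
      fix x :: 'a assume "x \<notin> sphere 0 r"
      then consider "norm x < r" | "norm x > r" by fastforce
      then show "(f has_derivative D x) (at x)"
      proof cases
        case 1
        have "((\<lambda>x. of_real (r\<^sup>2 - x \<bullet> x) * F x) has_derivative D x) (at x)"
          unfolding D_def using 1
          by (auto intro!: derivative_eq_intros smooth_has_derivative[OF F] simp: inner_commute algebra_simps)
        then show ?thesis
        proof (rule has_derivative_transform_within_open)
          show "open (ball (0::'a) r)" "x \<in> ball 0 r" using 1 by auto
          fix y :: 'a assume "y \<in> ball 0 r"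
          then have "y \<bullet> y \<le> r\<^sup>2" using r by (simp add: power_mono flip: power2_norm_eq_inner)
          then show "of_real (r\<^sup>2 - y \<bullet> y) * F y = f y" by (simp add: f_def w_def)
        qed
      next
        case 2
        have "((\<lambda>_. 0) has_derivative D x) (at x)" unfolding D_def using 2 by simp
        then show ?thesis
        proof (rule has_derivative_transform_within_open)
          show "open (- cball (0::'a) r)" "x \<in> - cball 0 r" using 2 by auto
          fix y :: 'a assume "y \<in> - cball 0 r"
          then have "y \<bullet> y \<ge> r\<^sup>2" using r by (simp add: power_mono flip: power2_norm_eq_inner)
          then show "0 = f y" by (simp add: f_def w_def)
        qed
      qed
    qed
  qed
  moreover have "(\<integral>x. D x b \<partial>lborel) = (LINT x:ball 0 r|lborel. of_real (r\<^sup>2 - x \<bullet> x) * partial_deriv b F x) -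
         (LINT x:ball 0 r|lborel. of_real (2 * (x \<bullet> b)) * F x)"
  proof -
    have 1: "set_integrable lborel (ball 0 r) (\<lambda>x. of_real (r\<^sup>2 - x \<bullet> x) * partial_deriv b F x)"
    proof -
      have "smooth_on_reals (\<lambda>t. of_real (r\<^sup>2 - t))"
        using smooth_on_reals_holomorphic[of "\<lambda>z. of_real (r\<^sup>2) - z"] by (simp add: holomorphic_on_diff)
      from smooth_mult[OF smooth_radial[OF this] smooth_partial_deriv[OF F b]]
      show ?thesis by (rule smooth_ball_set_integrable)
    qed
    have 2: "set_integrable lborel (ball 0 r) (\<lambda>x. of_real (2 * (x \<bullet> b)) * F x)"
    proof -
      have "smooth (\<lambda>x::'a. 2 * of_real (x \<bullet> b))" by (intro smooth_mult smooth_const smooth_inner)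
      then have "smooth (\<lambda>x::'a. of_real (2 * (x \<bullet> b)))" by simp
      from smooth_mult[OF this F] show ?thesis by (rule smooth_ball_set_integrable)
    qed
    show ?thesis
      using set_integral_diff(2)[OF 1 2]
      by (simp add: set_lebesgue_integral_def D_def partial_deriv_def)
  qed
  ultimately show ?thesis by simp
qed

lemma set_integral_ball_scale:
  fixes f :: "'a::euclidean_space \<Rightarrow> complex"
  assumes [measurable]: "f \<in> borel_measurable borel" and r: "r > 0"
  shows "(LINT x:ball 0 r|lborel. f (sgn x)) = of_real (r ^ DIM('a)) * (LINT x:ball 0 1|lborel. f (sgn x))"
proof -
  have meas: "(\<lambda>x::'a. indicator (ball 0 r) x *\<^sub>R f (sgn x)) \<in> borel_measurable borel"
    by (intro borel_measurable_scaleR borel_measurable_indicator measurable_compose[OF borel_measurable_sgn]) auto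
  have "(LINT x:ball 0 r|lborel. f (sgn x)) =
    (\<integral>x. indicator (ball 0 r) x *\<^sub>R f (sgn x) \<partial>density (distr lborel borel (\<lambda>x. 0 + r *\<^sub>R x)) (\<lambda>_. \<bar>r\<bar>^DIM('a)))"
    unfolding set_lebesgue_integral_def using lborel_affine[of r "0::'a"] r by simp
  also have "\<dots> = (\<integral>x. (\<bar>r\<bar>^DIM('a)) *\<^sub>R (indicator (ball 0 r) x *\<^sub>R f (sgn x)) \<partial>distr lborel borel (\<lambda>x. 0 + r *\<^sub>R x))"
    using meas by (subst integral_density) auto
  also have "\<dots> = (\<integral>x. (\<bar>r\<bar>^DIM('a)) *\<^sub>R (indicator (ball 0 r) (0 + r *\<^sub>R x) *\<^sub>R f (sgn (0 + r *\<^sub>R x))) \<partial>lborel)"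
    using borel_measurable_scaleR[OF borel_measurable_const meas] by (subst integral_distr) auto
  also have "\<dots> = (\<integral>x. (r^DIM('a)) *\<^sub>R (indicator (ball 0 1) x *\<^sub>R f (sgn x)) \<partial>lborel)"
    using r by (intro Bochner_Integration.integral_cong) (auto simp: indicator_def sgn_scaleR)
  finally show ?thesis by (simp add: set_lebesgue_integral_def scaleR_conv_of_real)
qed

lemma sphere_measure_eq_density:
  "sphere_measure = density (distr (restrict_space lborel (ball 0 1)) borel (sgn :: 'a::euclidean_space \<Rightarrow> 'a)) (\<lambda>_. of_nat DIM('a))"
  by (rule measure_eqI) (auto simp: sphere_measure_def emeasure_density nn_integral_cmult)

lemma sets_sphere_measure [measurable_cong, simp]: "sets sphere_measure = sets borel"
  by (simp add: sphere_measure_def)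

lemma space_sphere_measure [simp]: "space sphere_measure = UNIV"
  by (simp add: sphere_measure_def space_scale_measure)

lemma sgn_measurable_ball: "sgn \<in> restrict_space lborel (ball (0::'a::euclidean_space) 1) \<rightarrow>\<^sub>M borel"
  by (rule measurable_restrict_space1) simp

lemma integral_sphere_measure:
  fixes f :: "'a::euclidean_space \<Rightarrow> complex"
  assumes f: "f \<in> borel_measurable borel"
  shows "(\<integral>x. f x \<partial>sphere_measure) = of_nat DIM('a) * (LINT x:ball 0 1|lborel. f (sgn x))"
proof -
  have "(\<integral>x. f x \<partial>sphere_measure) = 
    (\<integral>x. f x \<partial>density (distr (restrict_space lborel (ball 0 1)) borel sgn) (\<lambda>_. ennreal (real DIM('a))))"
    by (simp add: sphere_measure_eq_density ennreal_of_nat_eq_real_of_nat)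
  also have "\<dots> = (\<integral>x. real DIM('a) *\<^sub>R f (sgn x) \<partial>restrict_space lborel (ball 0 1))"
    using f by (subst integral_density, simp_all) (subst integral_distr[OF sgn_measurable_ball], auto)
  also have "\<dots> = of_nat DIM('a) * (\<integral>x. f (sgn x) \<partial>restrict_space lborel (ball 0 1))"
    by (simp add: scaleR_conv_of_real)
  also have "(\<integral>x. f (sgn x) \<partial>restrict_space lborel (ball 0 1)) = (LINT x:ball 0 1|lborel. f (sgn x))"
    by (subst integral_restrict_space) (auto simp: set_lebesgue_integral_def)
  finally show ?thesis .
qed

lemma emeasure_sphere_measure_finite: "emeasure (sphere_measure :: 'a::euclidean_space measure) UNIV < \<infinity>"
proof -
  have "emeasure (sphere_measure :: 'a measure) UNIV = of_nat DIM('a) * emeasure lborel (ball (0::'a) 1)"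
    unfolding sphere_measure_def
    by (simp add: emeasure_distr[OF sgn_measurable_ball] emeasure_restrict_space space_restrict_space)
  then show ?thesis using emeasure_bounded_finite[OF bounded_ball[of "0::'a" 1]]
    by (simp add: ennreal_mult_less_top ennreal_of_nat_eq_real_of_nat)
qed

lemma AE_sphere_measure: "AE x in (sphere_measure :: 'a::euclidean_space measure). norm x = 1"
proof -
  have "AE x in lborel. x \<noteq> (0::'a)" by (rule AE_lborel_singleton)
  then have "AE x in restrict_space lborel (ball (0::'a) 1). norm (sgn x) = 1"
    by (subst AE_restrict_space_iff) (auto simp: norm_sgn)
  then show ?thesis
    unfolding sphere_measure_eq_density
    by (subst AE_density) (auto simp: AE_distr_iff[OF sgn_measurable_ball])
qed

lemma shell_ratio_tendsto:
  fixes r :: "nat \<Rightarrow> real"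
  assumes "r \<longlonglongrightarrow> 1" "\<And>j. 0 < r j" "\<And>j. r j < 1"
  shows "(\<lambda>j. (1 - r j ^ d) / (1 - (r j)\<^sup>2)) \<longlonglongrightarrow> real d / 2"
proof -
  have "(\<lambda>j. (\<Sum>i<d. r j ^ i) / (1 + r j)) \<longlonglongrightarrow> (\<Sum>i<d. 1 ^ i) / (1 + 1)"
    using assms(1) by (intro tendsto_intros) auto
  moreover have "(\<Sum>i<d. r j ^ i) / (1 + r j) = (1 - r j ^ d) / (1 - (r j)\<^sup>2)" for j
  proof -
    have "1 - r j ^ d = (1 - r j) * (\<Sum>i<d. r j ^ i)" by (rule one_diff_power_eq)
    moreover have "1 - (r j)\<^sup>2 = (1 - r j) * (1 + r j)" by (simp add: power2_eq_square algebra_simps)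
    ultimately show ?thesis using assms(2,3)[of j] by simp
  qed
  ultimately show ?thesis by simp
qed

lemma continuous_near_sphere:
  fixes f :: "'a::euclidean_space \<Rightarrow> complex"
  assumes "continuous_on UNIV f" "e > 0"
  obtains d where "0 < d" "d < 1" "\<And>x. \<lbrakk>1 - d \<le> norm x; norm x \<le> 1\<rbrakk> \<Longrightarrow> norm (f x - f (sgn x)) \<le> e"
proof -
  have "uniformly_continuous_on (cball (0::'a) 1) f"
    using assms(1) by (intro compact_uniformly_continuous compact_cball) (auto intro: continuous_on_subset)
  then obtain d where d: "d > 0" "\<And>x y. \<lbrakk>x \<in> cball 0 1; y \<in> cball 0 1; dist y x < d\<rbrakk> \<Longrightarrow> dist (f y) (f x) < e"
    using assms(2) unfolding uniformly_continuous_on_def by meson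
  show ?thesis
  proof (rule that[of "min d 1 / 2"])
    fix x :: 'a assume x: "1 - min d 1 / 2 \<le> norm x" "norm x \<le> 1"
    then have "x \<noteq> 0" using d(1) by auto
    have "norm x *\<^sub>R sgn x = x" using \<open>x \<noteq> 0\<close> by (simp add: sgn_div_norm)
    then have "dist x (sgn x) = norm ((norm x - 1) *\<^sub>R sgn x)"
      by (simp add: dist_norm scaleR_left_diff_distrib)
    also have "\<dots> < d" using \<open>x \<noteq> 0\<close> x d(1) by (simp add: norm_sgn)
    finally show "norm (f x - f (sgn x)) \<le> e"
      using d(2)[of "sgn x" x] x \<open>x \<noteq> 0\<close> by (simp add: dist_norm norm_sgn)
  qed (use d in auto)
qed

lemma shell_integral_tendsto:
  fixes f :: "'a::euclidean_space \<Rightarrow> complex" and r :: "nat \<Rightarrow> real"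
  assumes f: "continuous_on UNIV f" and r: "r \<longlonglongrightarrow> 1" "\<And>j. 0 < r j" "\<And>j. r j < 1"
  shows "(\<lambda>j. ((LINT x:ball 0 1|lborel. f x) - (LINT x:ball 0 (r j)|lborel. f x)) / of_real (1 - (r j)\<^sup>2))
    \<longlonglongrightarrow> of_real (real DIM('a) / 2) * (LINT x:ball 0 1|lborel. f (sgn x))"
proof -
  define V where "V = measure lborel (ball (0::'a) 1)"
  define I where "I = (LINT x:ball 0 1|lborel. f (sgn x))"
  define E where "E = (\<lambda>j. (LINT x:ball 0 1|lborel. f x - f (sgn x)) - (LINT x:ball 0 (r j)|lborel. f x - f (sgn x)))"
  have fm [measurable]: "f \<in> borel_measurable borel" using f by (rule borel_measurable_continuous_onI)
  have fs: "(\<lambda>x. f (sgn x)) \<in> borel_measurable borel" by (rule measurable_compose[OF borel_measurable_sgn fm])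
  have "compact (f ` cball 0 1)" using f by (intro compact_continuous_image compact_cball) (auto intro: continuous_on_subset)
  then have "bounded (f ` cball 0 1)" by (rule compact_imp_bounded)
  then obtain B where B: "\<And>x. norm x \<le> 1 \<Longrightarrow> norm (f x) \<le> B" unfolding bounded_iff by fastforce
  have Bs: "norm (f (sgn x)) \<le> B" for x by (intro B) (simp add: norm_sgn)
  have int: "set_integrable lborel (ball 0 s) f" "set_integrable lborel (ball 0 s) (\<lambda>x. f (sgn x))" if "s \<le> 1" for s
    using that fs B Bs by (auto intro!: ball_set_integrable[where B=B])
  have split: "((LINT x:ball 0 1|lborel. f x) - (LINT x:ball 0 (r j)|lborel. f x)) = (1 - of_real (r j ^ DIM('a))) * I + E j" for j
  proof -
    have "E j = (LINT x:ball 0 1|lborel. f x) - I - ((LINT x:ball 0 (r j)|lborel. f x) - of_real (r j ^ DIM('a)) * I)"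
      using int[of 1] int[of "r j"] less_imp_le[OF r(3)[of j]]
      by (simp add: E_def I_def set_integral_diff set_integral_ball_scale[OF fm r(2)])
    then show ?thesis by (simp add: algebra_simps)
  qed
  have E_le: "norm (E j) \<le> e * (V * (1 - r j ^ DIM('a)))"
    if e: "\<And>x. \<lbrakk>r j \<le> norm x; norm x \<le> 1\<rbrakk> \<Longrightarrow> norm (f x - f (sgn x)) \<le> e" for j e
  proof -
    let ?g = "\<lambda>x. (indicator (ball 0 1) x - indicator (ball 0 (r j)) x :: real) *\<^sub>R (f x - f (sgn x))"
    have i1: "set_integrable lborel (ball 0 s) (\<lambda>x. f x - f (sgn x))" if "s \<le> 1" for s
      using int[OF that] by (rule set_integral_diff)
    have fin: "emeasure lborel (ball (0::'a) s) < \<infinity>" for s by (rule emeasure_bounded_finite[OF bounded_ball])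
    have "E j = (\<integral>x. ?g x \<partial>lborel)"
      using i1[of 1] i1[of "r j"] r(3)[of j] unfolding E_def set_lebesgue_integral_def set_integrable_def
      by (simp add: scaleR_left_diff_distrib)
    also have "norm \<dots> \<le> (\<integral>x. norm (?g x) \<partial>lborel)" by (rule integral_norm_bound)
    also have "\<dots> \<le> (\<integral>x. (indicator (ball 0 1) x - indicator (ball (0::'a) (r j)) x) * e \<partial>lborel)"
    proof (rule integral_mono)
      show "integrable lborel (\<lambda>x. norm (?g x))"
        using i1[of 1] i1[of "r j"] r(3)[of j] unfolding set_integrable_def
        by (intro integrable_norm) (simp add: scaleR_left_diff_distrib)
      show "integrable lborel (\<lambda>x. (indicator (ball 0 1) x - indicator (ball (0::'a) (r j)) x) * e)"
        using fin by (intro integrable_mult_left Bochner_Integration.integrable_diff integrable_real_indicator) auto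
      show "norm (?g x) \<le> (indicator (ball 0 1) x - indicator (ball 0 (r j)) x) * e" for x
        using e[of x] r(3)[of j] by (auto simp: indicator_def)
    qed
    also have "\<dots> = (measure lborel (ball (0::'a) 1) - measure lborel (ball (0::'a) (r j))) * e"
      using fin by (simp add: integral_diff)
    also have "measure lborel (ball (0::'a) (r j)) = r j ^ DIM('a) * V"
      using content_ball_conv_unit_ball[of "r j" "0::'a"] less_imp_le[OF r(2)] by (simp add: V_def)
    finally show ?thesis by (simp add: V_def algebra_simps)
  qed
  have "(\<lambda>j. E j / of_real (1 - (r j)\<^sup>2)) \<longlonglongrightarrow> 0"
  proof (rule tendstoI)
    fix e :: real assume e: "e > 0"
    define K where "K = V * (real DIM('a) / 2)"
    have K: "K \<ge> 0" by (simp add: K_def V_def)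
    have "(\<lambda>j. V * ((1 - r j ^ DIM('a)) / (1 - (r j)\<^sup>2))) \<longlonglongrightarrow> K"
      unfolding K_def using r by (intro tendsto_intros shell_ratio_tendsto) auto
    then have 1: "eventually (\<lambda>j. V * ((1 - r j ^ DIM('a)) / (1 - (r j)\<^sup>2)) < K + 1) sequentially"
      by (rule order_tendstoD) simp
    obtain d where d: "0 < d" "d < 1" "\<And>x. \<lbrakk>1 - d \<le> norm x; norm x \<le> 1\<rbrakk> \<Longrightarrow> norm (f x - f (sgn x)) \<le> e / (K + 1)"
      using continuous_near_sphere[OF f, of "e / (K + 1)"] e K by auto
    have "eventually (\<lambda>j. r j > 1 - d) sequentially" using r(1) d by (intro order_tendstoD) auto
    with 1 show "eventually (\<lambda>j. dist (E j / of_real (1 - (r j)\<^sup>2)) 0 < e) sequentially"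
    proof eventually_elim
      case (elim j)
      have pos: "1 - (r j)\<^sup>2 > 0" using r(2,3)[of j] by (simp add: power_less_one_iff)
      have "norm (E j) \<le> e / (K + 1) * (V * (1 - r j ^ DIM('a)))" using elim d by (intro E_le) auto
      then have "norm (E j) / (1 - (r j)\<^sup>2) \<le> e / (K + 1) * (V * (1 - r j ^ DIM('a))) / (1 - (r j)\<^sup>2)"
        using pos by (intro divide_right_mono) auto
      also have "\<dots> = e / (K + 1) * (V * ((1 - r j ^ DIM('a)) / (1 - (r j)\<^sup>2)))" by simp
      also have "\<dots> < e / (K + 1) * (K + 1)" using elim e K by (intro mult_strict_left_mono) auto
      also have "\<dots> = e" using K by simp
      finally show ?case using pos by (simp add: norm_divide del: of_real_diff)
    qed
  qed
  moreover have "(\<lambda>j. of_real ((1 - r j ^ DIM('a)) / (1 - (r j)\<^sup>2)) * I) \<longlonglongrightarrow> of_real (real DIM('a) / 2) * I"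
    using r by (intro tendsto_intros shell_ratio_tendsto) auto
  ultimately have "(\<lambda>j. of_real ((1 - r j ^ DIM('a)) / (1 - (r j)\<^sup>2)) * I + E j / of_real (1 - (r j)\<^sup>2)) \<longlonglongrightarrow> of_real (real DIM('a) / 2) * I + 0"
    by (intro tendsto_add)
  then show ?thesis unfolding split I_def[symmetric] by (simp add: add_divide_distrib)
qed

lemma divergence_ball:
  fixes F :: "'a::euclidean_space \<Rightarrow> complex"
  assumes F: "smooth F" and b: "b \<in> Basis"
  shows "(LINT x:ball 0 1|lborel. partial_deriv b F x) = (\<integral>x. of_real (x \<bullet> b) * F x \<partial>sphere_measure)"
proof -
  define r where "r = (\<lambda>j. 1 - 1 / (real j + 2))"
  have r: "r \<longlonglongrightarrow> 1" "\<And>j. 0 < r j" "\<And>j. r j < 1"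
  proof -
    show "r \<longlonglongrightarrow> 1" unfolding r_def by real_asymp
  qed (auto simp: r_def)
  have pos: "1 - (r j)\<^sup>2 > 0" for j using r(2,3)[of j] by (simp add: power_less_one_iff)
  define G where "G = partial_deriv b F"
  have G: "smooth G" unfolding G_def by (rule smooth_partial_deriv[OF F b])
  have [measurable]: "G \<in> borel_measurable borel" by (rule smooth_borel_measurable[OF G])
  obtain B where B: "B \<ge> 0" "\<And>x. norm x \<le> 1 \<Longrightarrow> norm (G x) \<le> B"
    using smooth_bounded_on_cball[OF G, of 1] by blast
  define f where "f = (\<lambda>x. of_real (x \<bullet> b) * F x)"
  have sf: "smooth f" unfolding f_def by (intro smooth_mult smooth_inner F)
  define k where "k = (\<lambda>j (x::'a). (indicator (ball 0 1) x * (1 - x \<bullet> x) - indicator (ball 0 (r j)) x * ((r j)\<^sup>2 - x \<bullet> x)) / (1 - (r j)\<^sup>2))"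
  have k_meas [measurable]: "k j \<in> borel_measurable borel" for j
    unfolding k_def by (intro borel_measurable_divide borel_measurable_diff borel_measurable_times borel_measurable_indicator) auto
  have w1: "set_integrable lborel (ball 0 s) (\<lambda>x. of_real (c - x \<bullet> x) * G x)" for s c
  proof -
    have "smooth_on_reals (\<lambda>t. of_real (c - t))"
      using smooth_on_reals_holomorphic[of "\<lambda>z. of_real c - z"] by (simp add: holomorphic_on_diff)
    from smooth_mult[OF smooth_radial[OF this] G]
    show ?thesis by (rule smooth_ball_set_integrable)
  qed
  have eq: "(\<integral>x. k j x *\<^sub>R G x \<partial>lborel) = 2 * (((LINT x:ball 0 1|lborel. f x) - (LINT x:ball 0 (r j)|lborel. f x)) / of_real (1 - (r j)\<^sup>2))" for j
  proof -
    have "(\<integral>x. k j x *\<^sub>R G x \<partial>lborel) = (\<integral>x. (indicator (ball 0 1) x *\<^sub>R (of_real (1 - x \<bullet> x) * G x)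
       - indicator (ball 0 (r j)) x *\<^sub>R (of_real ((r j)\<^sup>2 - x \<bullet> x) * G x)) / of_real (1 - (r j)\<^sup>2) \<partial>lborel)"
      by (intro Bochner_Integration.integral_cong)
         (auto simp: k_def scaleR_conv_of_real indicator_def left_diff_distrib diff_divide_distrib)
    also have "\<dots> = ((LINT x:ball 0 1|lborel. of_real (1\<^sup>2 - x \<bullet> x) * G x) -
       (LINT x:ball 0 (r j)|lborel. of_real ((r j)\<^sup>2 - x \<bullet> x) * G x)) / of_real (1 - (r j)\<^sup>2)"
      unfolding set_lebesgue_integral_def integral_divide_zero
      using w1[of 1 1] w1[of "r j" "(r j)\<^sup>2"] unfolding set_integrable_def
      by (subst Bochner_Integration.integral_diff) auto
    also have "(LINT x:ball 0 1|lborel. of_real (1\<^sup>2 - x \<bullet> x) * G x) = (LINT x:ball 0 1|lborel. 2 * f x)"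
      unfolding G_def by (subst ball_weighted_divergence[OF F b]) (simp_all add: f_def mult.assoc)
    also have "(LINT x:ball 0 (r j)|lborel. of_real ((r j)\<^sup>2 - x \<bullet> x) * G x) = (LINT x:ball 0 (r j)|lborel. 2 * f x)"
      unfolding G_def by (subst ball_weighted_divergence[OF F b r(2)]) (simp_all add: f_def mult.assoc)
    finally show ?thesis by (simp add: right_diff_distrib)
  qed
  have "(\<lambda>j. \<integral>x. k j x *\<^sub>R G x \<partial>lborel) \<longlonglongrightarrow> (\<integral>x. indicator (ball 0 1) x *\<^sub>R G x \<partial>lborel)"
  proof (rule integral_dominated_convergence[where w="\<lambda>x. indicator (ball 0 1) x *\<^sub>R B"])
    show "integrable lborel (\<lambda>x. indicator (ball (0::'a) 1) x *\<^sub>R B)"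
      using emeasure_bounded_finite[OF bounded_ball[of "0::'a" 1]] by (intro integrableI_bounded_set_indicator) auto
    show "(\<lambda>x. indicator (ball 0 1) x *\<^sub>R G x) \<in> borel_measurable lborel"
      by (intro borel_measurable_scaleR borel_measurable_indicator) auto
    have kb: "0 \<le> k j x \<and> k j x \<le> indicator (ball 0 1) x" for j x
    proof -
      have sq: "x \<bullet> x = (norm x)\<^sup>2" by (simp add: power2_norm_eq_inner)
      consider "norm x < r j" | "r j \<le> norm x" "norm x < 1" | "norm x \<ge> 1" by linarith
      then show ?thesis
      proof cases
        case 1
        then show ?thesis using pos[of j] r(3)[of j] by (simp add: k_def indicator_def)
      next
        case 2
        then have "(r j)\<^sup>2 \<le> x \<bullet> x" "x \<bullet> x < 1"
          using r(2)[of j] unfolding sq by (auto simp: power_mono power_less_one_iff)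
        then show ?thesis using pos[of j] 2 by (simp add: k_def indicator_def divide_simps)
      next
        case 3
        then show ?thesis using r(3)[of j] by (simp add: k_def indicator_def)
      qed
    qed
    show "AE x in lborel. norm (k j x *\<^sub>R G x) \<le> indicator (ball 0 1) x *\<^sub>R B" for j
    proof (intro always_eventually allI)
      fix x :: 'a
      show "norm (k j x *\<^sub>R G x) \<le> indicator (ball 0 1) x *\<^sub>R B"
      proof (cases "norm x < 1")
        case True
        then show ?thesis using kb[of j x] mult_mono[of "k j x" 1 "norm (G x)" B] B(1) B(2)[of x] by simp
      next
        case False
        then have "k j x = 0" using kb[of j x] by simp
        then show ?thesis using False by simp
      qed
    qed
    show "AE x in lborel. (\<lambda>j. k j x *\<^sub>R G x) \<longlonglongrightarrow> indicator (ball 0 1) x *\<^sub>R G x"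
    proof (intro always_eventually allI)
      fix x :: 'a
      show "(\<lambda>j. k j x *\<^sub>R G x) \<longlonglongrightarrow> indicator (ball 0 1) x *\<^sub>R G x"
      proof (cases "norm x < 1")
        case True
        have "eventually (\<lambda>j. r j > norm x) sequentially" using r(1) True by (rule order_tendstoD)
        then have "eventually (\<lambda>j. indicator (ball 0 1) x *\<^sub>R G x = k j x *\<^sub>R G x) sequentially"
        proof eventually_elim
          case (elim j)
          then show ?case using pos[of j] True by (simp add: k_def indicator_def)
        qed
        then show ?thesis by (rule Lim_transform_eventually[OF tendsto_const])
      next
        case False
        then have "k j x = 0" for j using kb[of j x] by simp
        then show ?thesis using False by simp
      qed
    qed
  qed measurable
  then have "(\<lambda>j. 2 * (((LINT x:ball 0 1|lborel. f x) - (LINT x:ball 0 (r j)|lborel. f x)) / of_real (1 - (r j)\<^sup>2)))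
     \<longlonglongrightarrow> (LINT x:ball 0 1|lborel. G x)" unfolding eq by (simp add: set_lebesgue_integral_def)
  moreover have "(\<lambda>j. 2 * (((LINT x:ball 0 1|lborel. f x) - (LINT x:ball 0 (r j)|lborel. f x)) / of_real (1 - (r j)\<^sup>2)))
     \<longlonglongrightarrow> 2 * (of_real (real DIM('a) / 2) * (LINT x:ball 0 1|lborel. f (sgn x)))"
    by (intro tendsto_intros shell_integral_tendsto r smooth_continuous_on sf)
  ultimately have "(LINT x:ball 0 1|lborel. G x) = 2 * (of_real (real DIM('a) / 2) * (LINT x:ball 0 1|lborel. f (sgn x)))"
    by (rule LIMSEQ_unique)
  also have "\<dots> = (\<integral>x. f x \<partial>sphere_measure)"
    by (simp add: integral_sphere_measure[OF smooth_borel_measurable[OF sf]])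
  finally show ?thesis by (simp only: G_def f_def)
qed

section \<open>Weak derivatives, traces and Green's formula\<close>

lemma L2_measurable: "f \<in> L2 M \<Longrightarrow> f \<in> borel_measurable M"
  by (simp add: L2_def)

lemma L2_mult_integrable:
  assumes f: "f \<in> L2 M" and g: "g \<in> L2 M"
  shows "integrable M (\<lambda>x. f x * g x)"
proof (rule Bochner_Integration.integrable_bound)
  show "integrable M (\<lambda>x. (norm (f x))\<^sup>2 + (norm (g x))\<^sup>2)"
    using f g by (simp add: L2_def)
  show "(\<lambda>x. f x * g x) \<in> borel_measurable M"
    using f g by (intro borel_measurable_times L2_measurable)
  show "AE x in M. norm (f x * g x) \<le> norm ((norm (f x))\<^sup>2 + (norm (g x))\<^sup>2)"
  proof (intro always_eventually allI)
    fix x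
    have "2 * (norm (f x) * norm (g x)) \<le> (norm (f x))\<^sup>2 + (norm (g x))\<^sup>2"
      using sum_squares_bound[of "norm (f x)" "norm (g x)"] by simp
    moreover have "norm (f x) * norm (g x) \<ge> 0" by simp
    ultimately have "norm (f x) * norm (g x) \<le> (norm (f x))\<^sup>2 + (norm (g x))\<^sup>2" by linarith
    then show "norm (f x * g x) \<le> norm ((norm (f x))\<^sup>2 + (norm (g x))\<^sup>2)"
      by (simp add: norm_mult)
  qed
qed

lemma L2_diff:
  assumes "f \<in> L2 M" "g \<in> L2 M"
  shows "(\<lambda>x. f x - g x) \<in> L2 M"
proof -
  have "integrable M (\<lambda>x. (norm (f x - g x))\<^sup>2)"
  proof (rule Bochner_Integration.integrable_bound)
    show "integrable M (\<lambda>x. 2 * (norm (f x))\<^sup>2 + 2 * (norm (g x))\<^sup>2)"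
      using assms by (simp add: L2_def)
    show "(\<lambda>x. (norm (f x - g x))\<^sup>2) \<in> borel_measurable M"
      using assms[THEN L2_measurable] by measurable
    show "AE x in M. norm ((norm (f x - g x))\<^sup>2) \<le> norm (2 * (norm (f x))\<^sup>2 + 2 * (norm (g x))\<^sup>2)"
    proof (intro always_eventually allI)
      fix x
      have "(norm (f x - g x))\<^sup>2 \<le> (norm (f x) + norm (g x))\<^sup>2"
        by (intro power_mono norm_triangle_ineq4) simp
      also have "\<dots> \<le> 2 * (norm (f x))\<^sup>2 + 2 * (norm (g x))\<^sup>2"
        using sum_squares_bound[of "norm (f x)" "norm (g x)"] by (simp add: power2_sum)
      finally show "norm ((norm (f x - g x))\<^sup>2) \<le> norm (2 * (norm (f x))\<^sup>2 + 2 * (norm (g x))\<^sup>2)" by simp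
    qed
  qed
  moreover have "(\<lambda>x. f x - g x) \<in> borel_measurable M"
    using assms[THEN L2_measurable] by measurable
  ultimately show ?thesis by (simp add: L2_def)
qed

lemma L2_tendsto_integral_mult:
  assumes F: "\<And>j. F j \<in> L2 M" and f: "f \<in> L2 M" and g: "g \<in> L2 M" and lim: "L2_tendsto M F f"
  shows "(\<lambda>j. \<integral>x. F j x * g x \<partial>M) \<longlonglongrightarrow> (\<integral>x. f x * g x \<partial>M)"
proof -
  define A where "A = (\<lambda>j. \<integral>x. (norm (F j x - f x))\<^sup>2 \<partial>M)"
  define G where "G = (\<integral>x. (norm (g x))\<^sup>2 \<partial>M)"
  have d: "(\<lambda>x. F j x - f x) \<in> L2 M" for j by (intro L2_diff F f)
  have G: "G \<ge> 0" by (simp add: G_def)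
  have "A \<longlonglongrightarrow> 0"
  proof -
    have "(\<integral>\<^sup>+ x. ennreal ((norm (F j x - f x))\<^sup>2) \<partial>M) = ennreal (A j)" for j
      unfolding A_def using d[of j] by (intro nn_integral_eq_integral) (auto simp: L2_def)
    then have "(\<lambda>j. ennreal (A j)) \<longlonglongrightarrow> ennreal 0" using lim by (simp add: L2_tendsto_def)
    then show ?thesis by (subst (asm) tendsto_ennreal_iff) (auto simp: A_def)
  qed
  have est: "norm ((\<integral>x. F j x * g x \<partial>M) - (\<integral>x. f x * g x \<partial>M)) \<le> A j / e + e * G" if e: "e > 0" for j e
  proof -
    have "(\<integral>x. F j x * g x \<partial>M) - (\<integral>x. f x * g x \<partial>M) = (\<integral>x. (F j x - f x) * g x \<partial>M)"
      by (simp add: left_diff_distrib L2_mult_integrable F f g)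
    also have "norm \<dots> \<le> (\<integral>x. norm ((F j x - f x) * g x) \<partial>M)" by (rule integral_norm_bound)
    also have "\<dots> \<le> (\<integral>x. (norm (F j x - f x))\<^sup>2 / e + e * (norm (g x))\<^sup>2 \<partial>M)"
    proof (rule integral_mono)
      show "integrable M (\<lambda>x. norm ((F j x - f x) * g x))" by (intro integrable_norm L2_mult_integrable d g)
      show "integrable M (\<lambda>x. (norm (F j x - f x))\<^sup>2 / e + e * (norm (g x))\<^sup>2)"
        using d[of j] g by (simp add: L2_def)
      fix x
      define a b where "a = norm (F j x - f x)" and "b = norm (g x)"
      have "0 \<le> (a - e * b)\<^sup>2" by simp
      then have "2 * (e * (a * b)) \<le> a\<^sup>2 + e\<^sup>2 * b\<^sup>2" by (simp add: power2_eq_square algebra_simps)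
      moreover have "e * (a * b) \<ge> 0" using e by (simp add: a_def b_def)
      ultimately have "e * (a * b) \<le> a\<^sup>2 + e\<^sup>2 * b\<^sup>2" by linarith
      then show "norm ((F j x - f x) * g x) \<le> (norm (F j x - f x))\<^sup>2 / e + e * (norm (g x))\<^sup>2"
        using e unfolding norm_mult a_def[symmetric] b_def[symmetric]
        by (simp add: field_simps power2_eq_square)
    qed
    also have "\<dots> = A j / e + e * G" using d[of j] g by (simp add: A_def G_def L2_def)
    finally show ?thesis .
  qed
  show ?thesis
  proof (rule LIM_zero_cancel, rule tendstoI)
    fix e :: real assume e: "e > 0"
    define s where "s = e / (2 * (G + 1))"
    have s: "s > 0" "s * G < e / 2" using e G by (auto simp: s_def field_simps)
    have "eventually (\<lambda>j. A j < s * (e / 2)) sequentially"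
      using \<open>A \<longlonglongrightarrow> 0\<close> s e by (intro order_tendstoD(2)) auto
    then show "\<forall>\<^sub>F j in sequentially. dist ((\<integral>x. F j x * g x \<partial>M) - (\<integral>x. f x * g x \<partial>M)) 0 < e"
    proof eventually_elim
      case (elim j)
      then have "A j / s < e / 2" using s by (simp add: field_simps)
      then have "A j / s + s * G < e" using s(2) by linarith
      then show ?case using est[OF s(1), of j] by (simp add: le_less_trans)
    qed
  qed
qed

lemma L2I_bounded:
  assumes "f \<in> borel_measurable M" "emeasure M (space M) < \<infinity>" "\<And>x. x \<in> space M \<Longrightarrow> norm (f x) \<le> B"
  shows "f \<in> L2 M"
proof -
  have "integrable M (\<lambda>x. (norm (f x))\<^sup>2)"
    using assms by (intro integrableI_bounded_set[where A="space M" and B="B\<^sup>2"]) (auto intro!: AE_I2 power_mono)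
  then show ?thesis using assms by (simp add: L2_def)
qed

lemma L2_tendstoI_bounded:
  assumes "\<And>j. F j \<in> borel_measurable M" "f \<in> borel_measurable M" "emeasure M (space M) < \<infinity>"
    and "\<And>j x. x \<in> space M \<Longrightarrow> norm (F j x) \<le> B" "\<And>x. x \<in> space M \<Longrightarrow> norm (f x) \<le> B"
    and "\<And>x. x \<in> space M \<Longrightarrow> (\<lambda>j. F j x) \<longlonglongrightarrow> f x"
  shows "L2_tendsto M F f"
proof -
  have "(\<lambda>j. \<integral>\<^sup>+ x. ennreal ((norm (F j x - f x))\<^sup>2) \<partial>M) \<longlonglongrightarrow> (\<integral>\<^sup>+ x. 0 \<partial>M)"
  proof (rule nn_integral_dominated_convergence[where w="\<lambda>_. ennreal ((2 * B)\<^sup>2)"])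
    show "AE x in M. ennreal ((norm (F j x - f x))\<^sup>2) \<le> ennreal ((2 * B)\<^sup>2)" for j
    proof (rule AE_I2)
      fix x assume x: "x \<in> space M"
      have "norm (F j x - f x) \<le> 2 * B"
        using norm_triangle_ineq4[of "F j x" "f x"] assms(4)[OF x, of j] assms(5)[OF x] by linarith
      then show "ennreal ((norm (F j x - f x))\<^sup>2) \<le> ennreal ((2 * B)\<^sup>2)"
        by (intro ennreal_leI power_mono) auto
    qed
    show "AE x in M. (\<lambda>j. ennreal ((norm (F j x - f x))\<^sup>2)) \<longlonglongrightarrow> 0"
    proof (rule AE_I2)
      fix x assume x: "x \<in> space M"
      have "(\<lambda>j. (norm (F j x - f x))\<^sup>2) \<longlonglongrightarrow> (norm (f x - f x))\<^sup>2"
        by (intro tendsto_intros assms(6) x)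
      then have "(\<lambda>j. ennreal ((norm (F j x - f x))\<^sup>2)) \<longlonglongrightarrow> ennreal 0"
        by (intro tendsto_ennrealI) simp
      then show "(\<lambda>j. ennreal ((norm (F j x - f x))\<^sup>2)) \<longlonglongrightarrow> 0" by simp
    qed
    show "(\<integral>\<^sup>+ x. ennreal ((2 * B)\<^sup>2) \<partial>M) < \<infinity>"
      using assms(3) by (simp add: ennreal_mult_less_top)
  qed (use assms(1,2) in measurable)
  then show ?thesis by (simp add: L2_tendsto_def)
qed

abbreviation ball_measure :: "'a::euclidean_space measure" where
  "ball_measure \<equiv> lebesgue_on (ball 0 1)"

lemma space_ball_measure: "space (ball_measure :: 'a::euclidean_space measure) = ball 0 1"
  by (simp add: space_restrict_space)

lemma ball_measure_finite: "emeasure (ball_measure :: 'a::euclidean_space measure) (space ball_measure) < \<infinity>"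
  using emeasure_bounded_finite[OF bounded_ball[of "0::'a" 1]]
  by (simp add: space_restrict_space emeasure_restrict_space)

lemma borel_measurable_ball_measure: "f \<in> borel_measurable borel \<Longrightarrow> f \<in> borel_measurable ball_measure"
  by (intro measurable_restrict_space1 measurable_completion) simp

lemma smooth_measurable_ball: "smooth f \<Longrightarrow> f \<in> borel_measurable ball_measure"
  by (intro borel_measurable_ball_measure smooth_borel_measurable)

lemma smooth_L2_ball:
  assumes "smooth f"
  shows "f \<in> L2 ball_measure"
proof -
  obtain B where "\<And>x. norm x \<le> 1 \<Longrightarrow> norm (f x) \<le> B" using smooth_bounded_on_cball[OF assms, of 1] by blast
  then show ?thesis
    by (intro L2I_bounded[where B=B] smooth_measurable_ball assms ball_measure_finite) (simp add: space_ball_measure)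
qed

lemma smooth_integrable_ball: "smooth f \<Longrightarrow> integrable ball_measure f"
  using L2_mult_integrable[OF smooth_L2_ball smooth_L2_ball[OF smooth_const[of 1]]] by simp

lemma smooth_L2_sphere:
  assumes "smooth f"
  shows "f \<in> L2 sphere_measure"
proof -
  obtain B where B: "B \<ge> 0" "\<And>x. norm x \<le> 1 \<Longrightarrow> norm (f x) \<le> B" using smooth_bounded_on_cball[OF assms, of 1] by blast
  have [measurable]: "f \<in> borel_measurable borel" by (rule smooth_borel_measurable[OF assms])
  have "integrable sphere_measure (\<lambda>x. (norm (f x))\<^sup>2)"
  proof (rule integrableI_bounded_set[where A=UNIV and B="B\<^sup>2"])
    show "AE x in sphere_measure. x \<in> UNIV \<longrightarrow> norm ((norm (f x))\<^sup>2) \<le> B\<^sup>2"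
      using AE_sphere_measure by eventually_elim (use B in \<open>auto intro!: power_mono\<close>)
  qed (use emeasure_sphere_measure_finite in auto)
  then show ?thesis by (simp add: L2_def)
qed

lemma integral_ball_measure:
  fixes f :: "'a::euclidean_space \<Rightarrow> complex"
  assumes "f \<in> borel_measurable borel"
  shows "(\<integral>x. f x \<partial>ball_measure) = (LINT x:ball 0 1|lborel. f x)"
proof -
  have "(\<lambda>x. indicator (ball 0 1) x *\<^sub>R f x) \<in> borel_measurable lborel"
    using assms by (intro borel_measurable_scaleR borel_measurable_indicator) auto
  then show ?thesis
    by (subst integral_restrict_space) (auto simp: set_lebesgue_integral_def integral_completion)
qed

lemma partial_deriv_mult_smooth:
  "smooth f \<Longrightarrow> smooth g \<Longrightarrow> partial_deriv b (\<lambda>x. f x * g x) = (\<lambda>x. partial_deriv b f x * g x + f x * partial_deriv b g x)"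
  by (intro ext partial_deriv_mult smooth_differentiable)

lemma integration_by_parts_ball:
  fixes f g :: "'a::euclidean_space \<Rightarrow> complex"
  assumes f: "smooth f" and g: "smooth g" and b: "b \<in> Basis"
  shows "(\<integral>x. f x * partial_deriv b g x \<partial>ball_measure) + (\<integral>x. partial_deriv b f x * g x \<partial>ball_measure)
    = (\<integral>x. f x * (of_real (x \<bullet> b) * g x) \<partial>sphere_measure)"
proof -
  have s: "smooth (\<lambda>x. f x * partial_deriv b g x)" "smooth (\<lambda>x. partial_deriv b f x * g x)"
    by (intro smooth_mult f g smooth_partial_deriv b)+
  have "(\<integral>x. f x * partial_deriv b g x \<partial>ball_measure) + (\<integral>x. partial_deriv b f x * g x \<partial>ball_measure)
     = (\<integral>x. partial_deriv b (\<lambda>x. f x * g x) x \<partial>ball_measure)"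
    unfolding partial_deriv_mult_smooth[OF f g]
    by (subst Bochner_Integration.integral_add[OF smooth_integrable_ball[OF s(2)] smooth_integrable_ball[OF s(1)]]) simp
  also have "\<dots> = (LINT x:ball 0 1|lborel. partial_deriv b (\<lambda>x. f x * g x) x)"
    by (intro integral_ball_measure smooth_partial_deriv_measurable smooth_mult f g b)
  also have "\<dots> = (\<integral>x. of_real (x \<bullet> b) * (f x * g x) \<partial>sphere_measure)"
    by (intro divergence_ball smooth_mult f g b)
  finally show ?thesis by (simp add: mult_ac)
qed

lemma test_fun_smooth: "test_fun D \<phi> \<Longrightarrow> smooth \<phi>"
  by (simp add: test_fun_def)

lemma test_fun_eq_0: "test_fun D \<phi> \<Longrightarrow> x \<notin> D \<Longrightarrow> \<phi> x = 0"
  unfolding test_fun_def using closure_subset[of "{x. \<phi> x \<noteq> 0}"] by auto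

lemma test_fun_partial_deriv:
  assumes "test_fun D \<phi>" "b \<in> Basis"
  shows "test_fun D (partial_deriv b \<phi>)"
proof -
  have "partial_deriv b \<phi> x = 0" if "x \<notin> closure {x. \<phi> x \<noteq> 0}" for x
  proof -
    have "((\<lambda>_. 0) has_derivative (\<lambda>_. 0)) (at x)" by simp
    then have "(\<phi> has_derivative (\<lambda>_. 0)) (at x)"
    proof (rule has_derivative_transform_within_open)
      show "open (- closure {x. \<phi> x \<noteq> 0})" "x \<in> - closure {x. \<phi> x \<noteq> 0}" using that by auto
      show "0 = \<phi> y" if "y \<in> - closure {x. \<phi> x \<noteq> 0}" for y
        using that closure_subset[of "{x. \<phi> x \<noteq> 0}"] by auto
    qed
    then show ?thesis by (rule partial_deriv_eqI)
  qed
  then have "{x. partial_deriv b \<phi> x \<noteq> 0} \<subseteq> closure {x. \<phi> x \<noteq> 0}" by blast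
  then have sub: "closure {x. partial_deriv b \<phi> x \<noteq> 0} \<subseteq> closure {x. \<phi> x \<noteq> 0}" by (simp add: closure_minimal)
  have "compact (closure {x. \<phi> x \<noteq> 0} \<inter> closure {x. partial_deriv b \<phi> x \<noteq> 0})"
    using assms(1) by (intro compact_Int_closed closed_closure) (simp add: test_fun_def)
  then have "compact (closure {x. partial_deriv b \<phi> x \<noteq> 0})"
    by (simp only: inf.absorb2[OF sub])
  then show ?thesis
    using sub assms smooth_partial_deriv[OF test_fun_smooth[OF assms(1)] assms(2)] by (auto simp: test_fun_def)
qed

lemma integration_by_parts_test_fun:
  fixes f \<phi> :: "'a::euclidean_space \<Rightarrow> complex"
  assumes f: "smooth f" and \<phi>: "test_fun (ball 0 1) \<phi>" and b: "b \<in> Basis"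
  shows "(\<integral>x. f x * partial_deriv b \<phi> x \<partial>ball_measure) = - (\<integral>x. partial_deriv b f x * \<phi> x \<partial>ball_measure)"
proof -
  have "(\<integral>x. f x * (of_real (x \<bullet> b) * \<phi> x) \<partial>sphere_measure) = (\<integral>x. 0 \<partial>(sphere_measure :: 'a measure))"
  proof (rule integral_cong_AE)
    show "AE x in sphere_measure. f x * (of_real (x \<bullet> b) * \<phi> x) = 0"
      using AE_sphere_measure by eventually_elim (use test_fun_eq_0[OF \<phi>] in auto)
    show "(\<lambda>x. f x * (of_real (x \<bullet> b) * \<phi> x)) \<in> borel_measurable sphere_measure"
      by (intro L2_measurable smooth_L2_sphere smooth_mult smooth_inner f test_fun_smooth[OF \<phi>])
  qed simp
  then show ?thesis using integration_by_parts_ball[OF f test_fun_smooth[OF \<phi>] b] by (simp add: add_eq_0_iff)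
qed

lemma smooth_sum: "finite A \<Longrightarrow> (\<And>b. b \<in> A \<Longrightarrow> smooth (g b)) \<Longrightarrow> smooth (\<lambda>x. \<Sum>b\<in>A. g b x)"
  by (induction A rule: finite_induct) (auto intro: smooth_add smooth_const)

lemma smooth_laplacian: "smooth f \<Longrightarrow> smooth (laplacian f)"
  unfolding laplacian_def[abs_def] by (intro smooth_sum finite_Basis smooth_partial_deriv)

lemma smooth_has_weak_deriv:
  "smooth f \<Longrightarrow> b \<in> Basis \<Longrightarrow> has_weak_deriv (ball 0 1) b f (partial_deriv b f)"
  unfolding has_weak_deriv_def
  by (auto intro: smooth_L2_ball smooth_partial_deriv integration_by_parts_test_fun)

lemma smooth_H1_ball: "smooth f \<Longrightarrow> f \<in> H1 (ball 0 1)"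
  unfolding H1_def by (auto intro: smooth_L2_ball smooth_has_weak_deriv)

lemma smooth_H2_ball: "smooth f \<Longrightarrow> f \<in> H2 (ball 0 1)"
  unfolding H2_def using smooth_L2_ball smooth_has_weak_deriv smooth_H1_ball smooth_partial_deriv by blast

lemma smooth_has_weak_laplacian:
  assumes f: "smooth f"
  shows "has_weak_laplacian (ball 0 1) f (laplacian f)"
  unfolding has_weak_laplacian_def
proof (intro conjI allI impI)
  show "f \<in> L2 ball_measure" "laplacian f \<in> L2 ball_measure"
    by (intro smooth_L2_ball smooth_laplacian f)+
  fix \<phi> :: "'a \<Rightarrow> complex" assume \<phi>: "test_fun (ball 0 1) \<phi>"
  have i: "integrable ball_measure (\<lambda>x. f x * partial_deriv b (partial_deriv b \<phi>) x)"
     "integrable ball_measure (\<lambda>x. partial_deriv b (partial_deriv b f) x * \<phi> x)" if "b \<in> Basis" for b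
    using that by (auto intro!: smooth_integrable_ball smooth_mult smooth_partial_deriv f test_fun_smooth[OF \<phi>])
  have "(\<integral>x. f x * laplacian \<phi> x \<partial>ball_measure) = (\<Sum>b\<in>Basis. \<integral>x. f x * partial_deriv b (partial_deriv b \<phi>) x \<partial>ball_measure)"
    unfolding laplacian_def sum_distrib_left by (rule Bochner_Integration.integral_sum) (rule i)
  also have "\<dots> = (\<Sum>b\<in>Basis. \<integral>x. partial_deriv b (partial_deriv b f) x * \<phi> x \<partial>ball_measure)"
    using f \<phi> by (intro sum.cong) (auto simp: integration_by_parts_test_fun test_fun_partial_deriv smooth_partial_deriv)
  also have "\<dots> = (\<integral>x. laplacian f x * \<phi> x \<partial>ball_measure)"
    unfolding laplacian_def sum_distrib_right by (rule Bochner_Integration.integral_sum[symmetric]) (rule i)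
  finally show "(\<integral>x. f x * laplacian \<phi> x \<partial>ball_measure) = (\<integral>x. laplacian f x * \<phi> x \<partial>ball_measure)" .
qed

lemma L2_tendsto_const: "L2_tendsto M (\<lambda>_. f) f"
  by (simp add: L2_tendsto_def)

lemma smooth_H1_tendsto_const: "smooth f \<Longrightarrow> H1_tendsto (ball 0 1) (\<lambda>_. f) f"
  unfolding H1_tendsto_def by (auto simp: L2_tendsto_const intro: smooth_has_weak_deriv)

lemma smooth_has_trace:
  assumes "smooth f"
  shows "has_trace (ball 0 1) sphere_measure f f"
  unfolding has_trace_def
  by (intro conjI exI[of _ "\<lambda>_. f"] allI assms smooth_H1_ball smooth_L2_sphere smooth_H1_tendsto_const L2_tendsto_const)

text \<open>The rate of the cutoff is chosen so that a factor vanishing on the sphere compensates the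
  growth of the gradient: with \<open>s = 1 - x \<bullet> x\<close> and \<open>t = J s - 1\<close>, the product of \<open>s\<close> with the
  gradient is of order \<open>(t + 1) exp (- 1 / t) / t\<^sup>2\<close>, which is bounded and tends to \<open>0\<close>.\<close>

definition cutoff :: "nat \<Rightarrow> 'a::euclidean_space \<Rightarrow> complex" where
  "cutoff j x = of_real (flat_exp 1 (real (Suc j) * (1 - x \<bullet> x) - 1))"

lemma cutoff_radial: "cutoff j = (\<lambda>x. of_real (flat_exp 1 (- real (Suc j) * (x \<bullet> x) + real j)))"
  by (rule ext) (simp add: cutoff_def algebra_simps)

lemma smooth_cutoff: "smooth (cutoff j)"
  unfolding cutoff_radial
  by (rule smooth_radial[of "\<lambda>t. of_real (flat_exp 1 (- real (Suc j) * t + real j))"])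
     (rule smooth_on_reals_affine[OF smooth_on_reals_flat_exp])

lemma partial_deriv_cutoff:
  "partial_deriv b (cutoff j) x =
    of_real (- 2 * (x \<bullet> b) * (real (Suc j) * flat_exp [:0, 0, 1:] (real (Suc j) * (1 - x \<bullet> x) - 1)))"
proof -
  have "((\<lambda>t. flat_exp 1 (- real (Suc j) * t + real j)) has_real_derivative
    flat_exp ([:0, 0, 1:] * (1 - pderiv 1)) (- real (Suc j) * (x \<bullet> x) + real j) * (- real (Suc j))) (at (x \<bullet> x))"
    by (rule DERIV_chain2[OF has_real_derivative_flat_exp]) (auto intro!: derivative_eq_intros)
  then have "((\<lambda>t. of_real (flat_exp 1 (- real (Suc j) * t + real j)) :: complex) has_vector_derivative
    of_real (flat_exp ([:0, 0, 1:] * (1 - pderiv 1)) (- real (Suc j) * (x \<bullet> x) + real j) * (- real (Suc j)))) (at (x \<bullet> x))"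
    by (intro has_vector_derivative_of_real) (simp only: has_real_derivative_iff_has_vector_derivative)
  from partial_deriv_radial[OF this, of b]
  show ?thesis unfolding cutoff_radial by (simp add: algebra_simps)
qed

lemma flat_exp_1_bounds: "0 \<le> flat_exp 1 t" "flat_exp 1 t \<le> 1"
  by (auto simp: flat_exp_def)

lemma norm_cutoff_le: "norm (cutoff j x) \<le> 1"
  using flat_exp_1_bounds[of "real (Suc j) * (1 - x \<bullet> x) - 1"] by (simp add: cutoff_def)

lemma flat_exp_weighted_bound: "\<bar>(t + 1) * flat_exp [:0, 0, 1:] t\<bar> \<le> 3"
proof (cases "t > 0")
  case True
  define y where "y = 1 / t"
  have y: "y > 0" using True by (simp add: y_def)
  have "(t + 1) * flat_exp [:0, 0, 1:] t = (y + y\<^sup>2) * exp (- y)"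
    using True by (simp add: flat_exp_def y_def field_simps power2_eq_square)
  moreover have "(y + y\<^sup>2) * exp (- y) \<le> 3"
  proof -
    have "y\<^sup>2 / 2 \<le> exp y" "y \<le> exp y"
      using exp_lower_Taylor_quadratic[of y] y exp_ge_add_one_self[of y] by linarith+
    then have "y + y\<^sup>2 \<le> 3 * exp y" by linarith
    then show ?thesis by (simp add: exp_minus field_simps)
  qed
  moreover have "(y + y\<^sup>2) * exp (- y) \<ge> 0" using y by simp
  ultimately show ?thesis by simp
qed (simp add: flat_exp_def)

lemma cutoff_tendsto:
  assumes "norm x < 1"
  shows "(\<lambda>j. cutoff j x) \<longlonglongrightarrow> 1"
    and "(\<lambda>j. (1 - x \<bullet> x) * (real (Suc j) * flat_exp [:0, 0, 1:] (real (Suc j) * (1 - x \<bullet> x) - 1))) \<longlonglongrightarrow> 0"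
proof -
  define s where "s = 1 - x \<bullet> x"
  have s: "s > 0" using assms by (simp add: s_def power2_norm_eq_inner[symmetric] power_less_one_iff)
  have ev: "eventually (\<lambda>j. real (Suc j) * s - 1 > 0) sequentially" using s by real_asymp
  have "(\<lambda>j. exp (- 1 / (real (Suc j) * s - 1))) \<longlonglongrightarrow> 1" using s by real_asymp
  moreover from ev have "eventually (\<lambda>j. exp (- 1 / (real (Suc j) * s - 1)) = flat_exp 1 (real (Suc j) * s - 1)) sequentially"
    by eventually_elim (simp add: flat_exp_def)
  ultimately have "(\<lambda>j. flat_exp 1 (real (Suc j) * s - 1)) \<longlonglongrightarrow> 1"
    by (rule Lim_transform_eventually)
  then show "(\<lambda>j. cutoff j x) \<longlonglongrightarrow> 1" unfolding cutoff_def s_def[symmetric]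
    using tendsto_of_real by fastforce
  have "(\<lambda>j. s * (real (Suc j) * ((1 / (real (Suc j) * s - 1))\<^sup>2 * exp (- 1 / (real (Suc j) * s - 1))))) \<longlonglongrightarrow> 0"
    using s by real_asymp
  moreover from ev have "eventually (\<lambda>j. s * (real (Suc j) * ((1 / (real (Suc j) * s - 1))\<^sup>2 * exp (- 1 / (real (Suc j) * s - 1)))) = s * (real (Suc j) * flat_exp [:0, 0, 1:] (real (Suc j) * s - 1))) sequentially"
    by eventually_elim (simp add: flat_exp_def power2_eq_square)
  ultimately show "(\<lambda>j. (1 - x \<bullet> x) * (real (Suc j) * flat_exp [:0, 0, 1:] (real (Suc j) * (1 - x \<bullet> x) - 1))) \<longlonglongrightarrow> 0"
    unfolding s_def[symmetric] by (rule Lim_transform_eventually)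
qed

lemma test_fun_cutoff:
  assumes "smooth f"
  shows "test_fun (ball 0 1) (\<lambda>x. f x * cutoff j x)"
proof -
  let ?S = "{x::'a. x \<bullet> x \<le> 1 - 1 / real (Suc j)}"
  have "closed ?S" by (intro closed_Collect_le continuous_intros)
  have "x \<in> ?S" if "cutoff j x \<noteq> 0" for x :: 'a
  proof -
    have "real (Suc j) * (1 - x \<bullet> x) - 1 > 0" using that by (auto simp: cutoff_def flat_exp_def split: if_splits)
    then show ?thesis by (simp add: field_simps)
  qed
  then have "{x. f x * cutoff j x \<noteq> 0} \<subseteq> ?S" by auto
  then have cl: "closure {x. f x * cutoff j x \<noteq> 0} \<subseteq> ?S" using \<open>closed ?S\<close> by (rule closure_minimal)
  have sub: "?S \<subseteq> ball 0 1"
  proof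
    fix x :: 'a assume "x \<in> ?S"
    moreover have "1 / real (Suc j) > 0" by simp
    ultimately have "(norm x)\<^sup>2 < 1" unfolding power2_norm_eq_inner mem_Collect_eq by linarith
    then show "x \<in> ball 0 1" by (simp add: power_less_one_iff)
  qed
  then have "bounded (closure {x. f x * cutoff j x \<noteq> 0})" using cl bounded_subset[OF bounded_ball] by blast
  then have "compact (closure {x. f x * cutoff j x \<noteq> 0})" by (simp add: compact_eq_bounded_closed)
  then show ?thesis unfolding test_fun_def using cl sub by (auto intro: smooth_mult assms smooth_cutoff)
qed

lemma cutoff_L2_tendsto:
  assumes "smooth f"
  shows "L2_tendsto ball_measure (\<lambda>j x. f x * cutoff j x) f"
proof -
  obtain B where B: "B \<ge> 0" "\<And>x. norm x \<le> 1 \<Longrightarrow> norm (f x) \<le> B" using smooth_bounded_on_cball[OF assms, of 1] by blast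
  show ?thesis
  proof (rule L2_tendstoI_bounded[where B=B])
    show "(\<lambda>x. f x * cutoff j x) \<in> borel_measurable ball_measure" for j
      by (intro smooth_measurable_ball smooth_mult assms smooth_cutoff)
    show "norm (f x * cutoff j x) \<le> B" if "x \<in> space ball_measure" for j x
      using B(2)[of x] that norm_cutoff_le[of j x] mult_mono[of "norm (f x)" B "norm (cutoff j x)" 1] B(1)
      by (simp add: norm_mult space_ball_measure)
    show "norm (f x) \<le> B" if "x \<in> space ball_measure" for x
      using B(2)[of x] that by (simp add: space_ball_measure)
    show "(\<lambda>j. f x * cutoff j x) \<longlonglongrightarrow> f x" if "x \<in> space ball_measure" for x
      using tendsto_mult[OF tendsto_const[of "f x"] cutoff_tendsto(1)[of x]] that by (simp add: space_ball_measure)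
  qed (intro smooth_measurable_ball assms ball_measure_finite)+
qed

lemma smooth_zero_on_sphere_bound:
  fixes f :: "'a::euclidean_space \<Rightarrow> complex"
  assumes "smooth f" "\<And>x. norm x = 1 \<Longrightarrow> f x = 0"
  obtains L where "L \<ge> 0" "\<And>x. norm x < 1 \<Longrightarrow> norm (f x) \<le> L * (1 - x \<bullet> x)"
proof -
  obtain L where L: "L \<ge> 0" "\<And>x y. \<lbrakk>norm x \<le> 1; norm y \<le> 1\<rbrakk> \<Longrightarrow> norm (f x - f y) \<le> L * norm (x - y)"
    using smooth_lipschitz_on_cball[OF assms(1), of 1] by blast
  have "norm (f x) \<le> L * (1 - x \<bullet> x)" if "norm x < 1" for x
  proof -
    obtain y where y: "norm y = 1" "norm (x - y) = 1 - norm x"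
    proof (cases "x = 0")
      case True
      then show ?thesis using that[of "SOME b. b \<in> Basis"] by simp
    next
      case False
      have "norm x *\<^sub>R sgn x = x" using False by (simp add: sgn_div_norm)
      then have "x - sgn x = (norm x - 1) *\<^sub>R sgn x" by (simp add: scaleR_left_diff_distrib)
      then have "norm (x - sgn x) = 1 - norm x" using False \<open>norm x < 1\<close> by (simp add: norm_sgn)
      then show ?thesis using that[of "sgn x"] False by (simp add: norm_sgn)
    qed
    have "norm (f x) \<le> L * (1 - norm x)" using L(2)[of x y] that y assms(2)[OF y(1)] by simp
    also have "\<dots> \<le> L * (1 - x \<bullet> x)"
    proof (rule mult_left_mono[OF _ L(1)])
      have "norm x * norm x \<le> norm x * 1" using that by (intro mult_left_mono) auto
      then show "1 - norm x \<le> 1 - x \<bullet> x" by (simp add: power2_norm_eq_inner[symmetric] power2_eq_square)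
    qed
    finally show ?thesis .
  qed
  then show ?thesis using that L(1) by blast
qed

lemma smooth_zero_on_sphere_H10:
  fixes f :: "'a::euclidean_space \<Rightarrow> complex"
  assumes f: "smooth f" and zero: "\<And>x. norm x = 1 \<Longrightarrow> f x = 0"
  shows "f \<in> H10 (ball 0 1)"
proof -
  obtain L where L: "L \<ge> 0" "\<And>x. norm x < 1 \<Longrightarrow> norm (f x) \<le> L * (1 - x \<bullet> x)"
    using smooth_zero_on_sphere_bound[OF f zero] by blast
  have "L2_tendsto ball_measure (\<lambda>j. partial_deriv b (\<lambda>x. f x * cutoff j x)) (partial_deriv b f)"
    if b: "b \<in> Basis" for b
  proof -
    have sp: "smooth (partial_deriv b f)" by (rule smooth_partial_deriv[OF f b])
    obtain B where B: "B \<ge> 0" "\<And>x. norm x \<le> 1 \<Longrightarrow> norm (partial_deriv b f x) \<le> B"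
      using smooth_bounded_on_cball[OF sp, of 1] by blast
    define R where "R = (\<lambda>j (x::'a). (1 - x \<bullet> x) * (real (Suc j) * flat_exp [:0, 0, 1:] (real (Suc j) * (1 - x \<bullet> x) - 1)))"
    have R: "\<bar>R j x\<bar> \<le> 3" for j x
      using flat_exp_weighted_bound[of "real (Suc j) * (1 - x \<bullet> x) - 1"] by (simp add: R_def mult_ac)
    have second: "norm (f x * partial_deriv b (cutoff j) x) \<le> L * (2 * \<bar>R j x\<bar>)" if x: "norm x < 1" for j x
    proof -
      have "\<bar>x \<bullet> b\<bar> \<le> 1" using Basis_le_norm[OF b, of x] x by simp
      have pos: "1 - x \<bullet> x \<ge> 0" using x by (simp add: power2_norm_eq_inner[symmetric] power_le_one)
      define a where "a = \<bar>real (Suc j) * flat_exp [:0, 0, 1:] (real (Suc j) * (1 - x \<bullet> x) - 1)\<bar>"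
      have "norm (f x * partial_deriv b (cutoff j) x) = norm (f x) * ((2 * \<bar>x \<bullet> b\<bar>) * a)"
        unfolding partial_deriv_cutoff norm_mult norm_of_real abs_mult[of "- 2 * (x \<bullet> b)"] a_def by (simp add: abs_mult)
      also have "\<dots> \<le> (L * (1 - x \<bullet> x)) * (2 * a)"
        using L(1) L(2)[OF x] pos \<open>\<bar>x \<bullet> b\<bar> \<le> 1\<close> by (intro mult_mono mult_right_mono) (auto simp: a_def)
      also have "\<dots> = L * (2 * \<bar>R j x\<bar>)" using pos by (simp add: R_def a_def abs_mult)
      finally show ?thesis .
    qed
    show ?thesis
    proof (rule L2_tendstoI_bounded[where B="B + L * 6"])
      show "partial_deriv b (\<lambda>x. f x * cutoff j x) \<in> borel_measurable ball_measure" for j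
        by (intro smooth_measurable_ball smooth_partial_deriv smooth_mult f smooth_cutoff b)
      show "partial_deriv b f \<in> borel_measurable ball_measure" by (rule smooth_measurable_ball[OF sp])
      show "norm (partial_deriv b f x) \<le> B + L * 6" if "x \<in> space ball_measure" for x
        using B(2)[of x] L(1) that by (simp add: space_ball_measure add_increasing2)
      show "norm (partial_deriv b (\<lambda>x. f x * cutoff j x) x) \<le> B + L * 6" if "x \<in> space ball_measure" for j x
      proof -
        have x: "norm x < 1" using that by (simp add: space_ball_measure)
        have "norm (partial_deriv b f x * cutoff j x) \<le> B * 1"
          unfolding norm_mult using B x norm_cutoff_le by (intro mult_mono) auto
        moreover have "L * (2 * \<bar>R j x\<bar>) \<le> L * 6" using R[of j x] L(1) by (intro mult_left_mono) auto
        ultimately show ?thesis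
          unfolding partial_deriv_mult_smooth[OF f smooth_cutoff]
          using second[OF x, of j] norm_triangle_ineq[of "partial_deriv b f x * cutoff j x" "f x * partial_deriv b (cutoff j) x"]
          by linarith
      qed
      show "(\<lambda>j. partial_deriv b (\<lambda>x. f x * cutoff j x) x) \<longlonglongrightarrow> partial_deriv b f x"
        if "x \<in> space ball_measure" for x
      proof -
        have x: "norm x < 1" using that by (simp add: space_ball_measure)
        have "(\<lambda>j. R j x) \<longlonglongrightarrow> 0" unfolding R_def by (rule cutoff_tendsto(2)[OF x])
        then have "(\<lambda>j. L * (2 * \<bar>R j x\<bar>)) \<longlonglongrightarrow> L * (2 * \<bar>0\<bar>)" by (intro tendsto_intros)
        then have lim0: "(\<lambda>j. L * (2 * \<bar>R j x\<bar>)) \<longlonglongrightarrow> 0" by simp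
        have "(\<lambda>j. f x * partial_deriv b (cutoff j) x) \<longlonglongrightarrow> 0"
          by (rule Lim_null_comparison[OF always_eventually lim0]) (use second[OF x] in auto)
        from tendsto_add[OF tendsto_mult[OF tendsto_const[of "partial_deriv b f x"] cutoff_tendsto(1)[OF x]] this]
        show ?thesis unfolding partial_deriv_mult_smooth[OF f smooth_cutoff] by simp
      qed
    qed (rule ball_measure_finite)
  qed
  then have "H1_tendsto (ball 0 1) (\<lambda>j x. f x * cutoff j x) f"
    unfolding H1_tendsto_def using cutoff_L2_tendsto[OF f] smooth_has_weak_deriv[OF f] by blast
  with smooth_H1_ball[OF f] test_fun_cutoff[OF f] show ?thesis
    unfolding H10_def mem_Collect_eq by (intro conjI exI[of _ "\<lambda>j x. f x * cutoff j x"] allI)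
qed

lemma smooth_has_normal_deriv:
  fixes f :: "'a::euclidean_space \<Rightarrow> complex"
  assumes f: "smooth f"
  shows "has_normal_deriv (ball 0 1) sphere_measure (\<lambda>x. x) f (\<lambda>x. \<Sum>b\<in>Basis. of_real (x \<bullet> b) * partial_deriv b f x)"
  unfolding has_normal_deriv_def
  by (intro conjI exI[of _ "\<lambda>b. partial_deriv b f"] ballI smooth_H2_ball f smooth_L2_sphere smooth_sum finite_Basis
        smooth_mult smooth_inner smooth_partial_deriv smooth_has_weak_deriv smooth_has_trace) auto

lemma smooth_limit_of_test_funs:
  fixes f :: "'a::euclidean_space \<Rightarrow> complex"
  assumes f: "smooth f" and u: "u \<in> L2 ball_measure"
  shows "(\<lambda>j. \<integral>x. u x * (f x * cutoff j x) \<partial>ball_measure) \<longlonglongrightarrow> (\<integral>x. u x * f x \<partial>ball_measure)"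
proof -
  have "(\<lambda>j. \<integral>x. (f x * cutoff j x) * u x \<partial>ball_measure) \<longlonglongrightarrow> (\<integral>x. f x * u x \<partial>ball_measure)"
    by (rule L2_tendsto_integral_mult)
       (intro smooth_L2_ball f smooth_mult smooth_cutoff u cutoff_L2_tendsto)+
  then show ?thesis by (simp add: mult.commute)
qed

lemma integral_eq_if_test_funs:
  fixes f :: "'a::euclidean_space \<Rightarrow> complex"
  assumes f: "smooth f" and u: "u \<in> L2 ball_measure" "u' \<in> L2 ball_measure"
    and eq: "\<And>\<phi>. test_fun (ball 0 1) \<phi> \<Longrightarrow> (\<integral>x. u x * \<phi> x \<partial>ball_measure) = (\<integral>x. u' x * \<phi> x \<partial>ball_measure)"
  shows "(\<integral>x. u x * f x \<partial>ball_measure) = (\<integral>x. u' x * f x \<partial>ball_measure)"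
proof (rule LIMSEQ_unique)
  show "(\<lambda>j. \<integral>x. u x * (f x * cutoff j x) \<partial>ball_measure) \<longlonglongrightarrow> (\<integral>x. u x * f x \<partial>ball_measure)"
    by (rule smooth_limit_of_test_funs[OF f u(1)])
  show "(\<lambda>j. \<integral>x. u x * (f x * cutoff j x) \<partial>ball_measure) \<longlonglongrightarrow> (\<integral>x. u' x * f x \<partial>ball_measure)"
    unfolding eq[OF test_fun_cutoff[OF f]] by (rule smooth_limit_of_test_funs[OF f u(2)])
qed

lemma H10_integration_by_parts:
  fixes v \<psi> :: "'a::euclidean_space \<Rightarrow> complex"
  assumes \<psi>: "\<psi> \<in> H10 (ball 0 1)" and G: "has_weak_deriv (ball 0 1) b \<psi> G"
    and v: "smooth v" and b: "b \<in> Basis"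
  shows "(\<integral>x. G x * v x \<partial>ball_measure) = - (\<integral>x. \<psi> x * partial_deriv b v x \<partial>ball_measure)"
proof -
  obtain \<Phi> where \<Phi>: "\<And>j. test_fun (ball 0 1) (\<Phi> j)" and lim: "H1_tendsto (ball 0 1) \<Phi> \<psi>"
    using \<psi> unfolding H10_def by blast
  obtain g where g: "has_weak_deriv (ball 0 1) b \<psi> g"
    "L2_tendsto ball_measure (\<lambda>j. partial_deriv b (\<Phi> j)) g"
    using lim b unfolding H1_tendsto_def by blast
  have L2: "\<psi> \<in> L2 ball_measure" "G \<in> L2 ball_measure" "g \<in> L2 ball_measure"
    using G g by (auto simp: has_weak_deriv_def)
  have s\<Phi>: "smooth (\<Phi> j)" for j by (rule test_fun_smooth[OF \<Phi>])
  have "(\<integral>x. G x * v x \<partial>ball_measure) = (\<integral>x. g x * v x \<partial>ball_measure)"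
    by (rule integral_eq_if_test_funs[OF v L2(2,3)]) (use G g(1) in \<open>force simp: has_weak_deriv_def\<close>)
  also have "\<dots> = - (\<integral>x. \<psi> x * partial_deriv b v x \<partial>ball_measure)"
  proof (rule LIMSEQ_unique)
    show "(\<lambda>j. \<integral>x. partial_deriv b (\<Phi> j) x * v x \<partial>ball_measure) \<longlonglongrightarrow> (\<integral>x. g x * v x \<partial>ball_measure)"
      by (rule L2_tendsto_integral_mult[OF _ L2(3) _ g(2)]) (intro smooth_L2_ball smooth_partial_deriv s\<Phi> v b)+
    have "(\<lambda>j. - (\<integral>x. \<Phi> j x * partial_deriv b v x \<partial>ball_measure)) \<longlonglongrightarrow> - (\<integral>x. \<psi> x * partial_deriv b v x \<partial>ball_measure)"
      using lim unfolding H1_tendsto_def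
      by (intro tendsto_minus L2_tendsto_integral_mult L2 smooth_L2_ball smooth_partial_deriv s\<Phi> v b) auto
    moreover have "(\<integral>x. partial_deriv b (\<Phi> j) x * v x \<partial>ball_measure) = - (\<integral>x. \<Phi> j x * partial_deriv b v x \<partial>ball_measure)" for j
      using integration_by_parts_test_fun[OF v \<Phi> b, of j] by (simp add: mult.commute)
    ultimately show "(\<lambda>j. \<integral>x. partial_deriv b (\<Phi> j) x * v x \<partial>ball_measure) \<longlonglongrightarrow> - (\<integral>x. \<psi> x * partial_deriv b v x \<partial>ball_measure)"
      by simp
  qed
  finally show ?thesis .
qed

lemma has_trace_divergence:
  fixes v G :: "'a::euclidean_space \<Rightarrow> complex"
  assumes "has_trace (ball 0 1) sphere_measure G \<gamma>" and v: "smooth v" and b: "b \<in> Basis"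
  obtains K where "has_weak_deriv (ball 0 1) b G K"
    "(\<integral>x. G x * partial_deriv b v x \<partial>ball_measure) + (\<integral>x. K x * v x \<partial>ball_measure)
      = (\<integral>x. \<gamma> x * (of_real (x \<bullet> b) * v x) \<partial>sphere_measure)"
proof -
  obtain \<Phi> where \<Phi>: "\<And>j. smooth (\<Phi> j)" "H1_tendsto (ball 0 1) \<Phi> G" "L2_tendsto sphere_measure \<Phi> \<gamma>"
    and \<gamma>: "\<gamma> \<in> L2 sphere_measure"
    using assms(1) unfolding has_trace_def by blast
  obtain K where K: "has_weak_deriv (ball 0 1) b G K"
    "L2_tendsto ball_measure (\<lambda>j. partial_deriv b (\<Phi> j)) K"
    using \<Phi>(2) b unfolding H1_tendsto_def by blast
  have L2: "G \<in> L2 ball_measure" "K \<in> L2 ball_measure" using K by (auto simp: has_weak_deriv_def)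
  have "(\<integral>x. G x * partial_deriv b v x \<partial>ball_measure) + (\<integral>x. K x * v x \<partial>ball_measure)
      = (\<integral>x. \<gamma> x * (of_real (x \<bullet> b) * v x) \<partial>sphere_measure)"
  proof (rule LIMSEQ_unique)
    show "(\<lambda>j. (\<integral>x. \<Phi> j x * partial_deriv b v x \<partial>ball_measure) + (\<integral>x. partial_deriv b (\<Phi> j) x * v x \<partial>ball_measure))
      \<longlonglongrightarrow> (\<integral>x. G x * partial_deriv b v x \<partial>ball_measure) + (\<integral>x. K x * v x \<partial>ball_measure)"
      using \<Phi>(2) K(2) unfolding H1_tendsto_def
      by (intro tendsto_add L2_tendsto_integral_mult L2 smooth_L2_ball smooth_partial_deriv \<Phi>(1) v b) auto
    show "(\<lambda>j. (\<integral>x. \<Phi> j x * partial_deriv b v x \<partial>ball_measure) + (\<integral>x. partial_deriv b (\<Phi> j) x * v x \<partial>ball_measure))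
      \<longlonglongrightarrow> (\<integral>x. \<gamma> x * (of_real (x \<bullet> b) * v x) \<partial>sphere_measure)"
      unfolding integration_by_parts_ball[OF \<Phi>(1) v b]
      by (intro L2_tendsto_integral_mult smooth_L2_sphere \<Phi>(1,3) \<gamma> smooth_mult smooth_inner v)
  qed
  then show ?thesis using that K(1) by blast
qed

lemma weak_trace_pairing_smooth:
  fixes v :: "'a::euclidean_space \<Rightarrow> complex"
  assumes v: "smooth v" and pairing: "weak_trace_pairing (ball 0 1) sphere_measure (\<lambda>x. x) v g c"
  shows "c = (\<integral>x. v x * g x \<partial>sphere_measure)"
proof -
  obtain \<psi> \<Delta>\<psi> \<Delta>v where \<psi>: "\<psi> \<in> H10 (ball 0 1)"
    and nd: "has_normal_deriv (ball 0 1) sphere_measure (\<lambda>x. x) \<psi> g"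
    and lap: "has_weak_laplacian (ball 0 1) \<psi> \<Delta>\<psi>" "has_weak_laplacian (ball 0 1) v \<Delta>v"
    and c: "c = (\<integral>x. v x * \<Delta>\<psi> x - \<psi> x * \<Delta>v x \<partial>ball_measure)"
    using pairing unfolding weak_trace_pairing_def by blast
  obtain G \<gamma> where G: "\<And>b. b \<in> Basis \<Longrightarrow> has_weak_deriv (ball 0 1) b \<psi> (G b)"
    and tr: "\<And>b. b \<in> Basis \<Longrightarrow> has_trace (ball 0 1) sphere_measure (G b) (\<gamma> b)"
    and g: "AE x in sphere_measure. g x = (\<Sum>b\<in>Basis. of_real (x \<bullet> b) * \<gamma> b x)"
    and gL2: "g \<in> L2 sphere_measure"
    using nd unfolding has_normal_deriv_def by blast
  have "\<forall>b\<in>Basis. \<exists>K. has_weak_deriv (ball 0 1) b (G b) K \<and>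
    (\<integral>x. G b x * partial_deriv b v x \<partial>ball_measure) + (\<integral>x. K x * v x \<partial>ball_measure)
      = (\<integral>x. \<gamma> b x * (of_real (x \<bullet> b) * v x) \<partial>sphere_measure)"
  proof
    fix b :: 'a assume b: "b \<in> Basis"
    from has_trace_divergence[OF tr[OF b] v b] obtain K where "has_weak_deriv (ball 0 1) b (G b) K"
      "(\<integral>x. G b x * partial_deriv b v x \<partial>ball_measure) + (\<integral>x. K x * v x \<partial>ball_measure)
        = (\<integral>x. \<gamma> b x * (of_real (x \<bullet> b) * v x) \<partial>sphere_measure)" .
    then show "\<exists>K. has_weak_deriv (ball 0 1) b (G b) K \<and>
      (\<integral>x. G b x * partial_deriv b v x \<partial>ball_measure) + (\<integral>x. K x * v x \<partial>ball_measure)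
        = (\<integral>x. \<gamma> b x * (of_real (x \<bullet> b) * v x) \<partial>sphere_measure)" by (intro exI[of _ K] conjI)
  qed
  from bchoice[OF this] obtain K where K: "\<And>b. b \<in> Basis \<Longrightarrow> has_weak_deriv (ball 0 1) b (G b) (K b)"
    and K_eq: "\<And>b. b \<in> Basis \<Longrightarrow> (\<integral>x. G b x * partial_deriv b v x \<partial>ball_measure) + (\<integral>x. K b x * v x \<partial>ball_measure)
      = (\<integral>x. \<gamma> b x * (of_real (x \<bullet> b) * v x) \<partial>sphere_measure)"
    by blast
  have L2: "\<psi> \<in> L2 ball_measure" "\<Delta>\<psi> \<in> L2 ball_measure" "\<Delta>v \<in> L2 ball_measure"
    using lap by (auto simp: has_weak_laplacian_def)
  have L2': "G b \<in> L2 ball_measure" "K b \<in> L2 ball_measure" "\<gamma> b \<in> L2 sphere_measure" if "b \<in> Basis" for b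
    using K[OF that] tr[OF that] by (auto simp: has_weak_deriv_def has_trace_def)
  have vL2: "v \<in> L2 ball_measure" by (rule smooth_L2_ball[OF v])
  define V where "V = laplacian v"
  have sV: "smooth V" unfolding V_def by (rule smooth_laplacian[OF v])
  have sd: "smooth (partial_deriv b v)" "smooth (partial_deriv b (partial_deriv b v))" if "b \<in> Basis" for b
    by (intro smooth_partial_deriv v that)+

  have 1: "(\<integral>x. \<psi> x * \<Delta>v x \<partial>ball_measure) = (\<integral>x. \<psi> x * V x \<partial>ball_measure)"
  proof -
    obtain \<Phi> where \<Phi>: "\<And>j. test_fun (ball 0 1) (\<Phi> j)" and lim: "L2_tendsto ball_measure \<Phi> \<psi>"
      using \<psi> unfolding H10_def H1_tendsto_def by blast
    have s\<Phi>: "\<Phi> j \<in> L2 ball_measure" for j by (rule smooth_L2_ball[OF test_fun_smooth[OF \<Phi>]])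
    have "(\<integral>x. \<Phi> j x * \<Delta>v x \<partial>ball_measure) = (\<integral>x. \<Phi> j x * V x \<partial>ball_measure)" for j
      using lap(2) smooth_has_weak_laplacian[OF v] \<Phi>[of j]
      by (simp add: has_weak_laplacian_def V_def mult.commute[of "\<Phi> j _"])
    moreover have "(\<lambda>j. \<integral>x. \<Phi> j x * \<Delta>v x \<partial>ball_measure) \<longlonglongrightarrow> (\<integral>x. \<psi> x * \<Delta>v x \<partial>ball_measure)"
      by (rule L2_tendsto_integral_mult[OF s\<Phi> L2(1,3) lim])
    moreover have "(\<lambda>j. \<integral>x. \<Phi> j x * V x \<partial>ball_measure) \<longlonglongrightarrow> (\<integral>x. \<psi> x * V x \<partial>ball_measure)"
      by (rule L2_tendsto_integral_mult[OF s\<Phi> L2(1) smooth_L2_ball[OF sV] lim])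
    ultimately show ?thesis using LIMSEQ_unique by auto
  qed
  have sumL2: "(\<lambda>x. \<Sum>b\<in>Basis. K b x) \<in> L2 ball_measure"
  proof -
    have "(\<lambda>x. \<Sum>b\<in>A. K b x) \<in> L2 ball_measure" if "finite A" "A \<subseteq> Basis" for A
      using that
    proof (induction A rule: finite_induct)
      case empty
      then show ?case using smooth_L2_ball[OF smooth_const[of 0]] by simp
    next
      case (insert b A)
      have zero: "(\<lambda>_. 0) \<in> L2 ball_measure" using smooth_L2_ball[OF smooth_const[of 0]] by simp
      have "(\<lambda>x. K b x - (0 - (\<Sum>b\<in>A. K b x))) \<in> L2 ball_measure"
        using insert L2' by (intro L2_diff zero) auto
      then show ?case using insert by simp
    qed
    then show ?thesis by simp
  qed
  have 2: "(\<integral>x. \<Delta>\<psi> x * v x \<partial>ball_measure) = (\<Sum>b\<in>Basis. \<integral>x. K b x * v x \<partial>ball_measure)"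
  proof -
    have "(\<integral>x. \<Delta>\<psi> x * v x \<partial>ball_measure) = (\<integral>x. (\<Sum>b\<in>Basis. K b x) * v x \<partial>ball_measure)"
    proof (rule integral_eq_if_test_funs[OF v L2(2) sumL2])
      fix \<phi> :: "'a \<Rightarrow> complex" assume \<phi>: "test_fun (ball 0 1) \<phi>"
      have s\<phi>: "\<phi> \<in> L2 ball_measure" "\<And>b. b \<in> Basis \<Longrightarrow> partial_deriv b (partial_deriv b \<phi>) \<in> L2 ball_measure"
        by (intro smooth_L2_ball smooth_partial_deriv test_fun_smooth[OF \<phi>])+
      have "(\<integral>x. \<Delta>\<psi> x * \<phi> x \<partial>ball_measure) = (\<integral>x. \<psi> x * laplacian \<phi> x \<partial>ball_measure)"
        using lap(1) \<phi> by (simp add: has_weak_laplacian_def)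
      also have "\<dots> = (\<Sum>b\<in>Basis. \<integral>x. \<psi> x * partial_deriv b (partial_deriv b \<phi>) x \<partial>ball_measure)"
        unfolding laplacian_def sum_distrib_left
        by (rule Bochner_Integration.integral_sum) (intro L2_mult_integrable L2 s\<phi>)
      also have "\<dots> = (\<Sum>b\<in>Basis. \<integral>x. K b x * \<phi> x \<partial>ball_measure)"
      proof (rule sum.cong[OF refl])
        fix b :: 'a assume b: "b \<in> Basis"
        have "(\<integral>x. \<psi> x * partial_deriv b (partial_deriv b \<phi>) x \<partial>ball_measure) = - (\<integral>x. G b x * partial_deriv b \<phi> x \<partial>ball_measure)"
          using G[OF b] test_fun_partial_deriv[OF \<phi> b] by (simp add: has_weak_deriv_def)
        also have "\<dots> = (\<integral>x. K b x * \<phi> x \<partial>ball_measure)"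
          using K[OF b] \<phi> by (simp add: has_weak_deriv_def)
        finally show "(\<integral>x. \<psi> x * partial_deriv b (partial_deriv b \<phi>) x \<partial>ball_measure) = (\<integral>x. K b x * \<phi> x \<partial>ball_measure)" .
      qed
      also have "\<dots> = (\<integral>x. (\<Sum>b\<in>Basis. K b x) * \<phi> x \<partial>ball_measure)"
        unfolding sum_distrib_right
        by (rule Bochner_Integration.integral_sum[symmetric]) (intro L2_mult_integrable L2' s\<phi>)
      finally show "(\<integral>x. \<Delta>\<psi> x * \<phi> x \<partial>ball_measure) = (\<integral>x. (\<Sum>b\<in>Basis. K b x) * \<phi> x \<partial>ball_measure)" .
    qed
    also have "\<dots> = (\<Sum>b\<in>Basis. \<integral>x. K b x * v x \<partial>ball_measure)"
      unfolding sum_distrib_right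
      by (rule Bochner_Integration.integral_sum) (intro L2_mult_integrable L2' vL2)
    finally show ?thesis .
  qed
  have 3: "(\<Sum>b\<in>Basis. \<integral>x. G b x * partial_deriv b v x \<partial>ball_measure) = - (\<integral>x. \<psi> x * V x \<partial>ball_measure)"
  proof -
    have "(\<Sum>b\<in>Basis. \<integral>x. G b x * partial_deriv b v x \<partial>ball_measure) =
       (\<Sum>b\<in>Basis. - (\<integral>x. \<psi> x * partial_deriv b (partial_deriv b v) x \<partial>ball_measure))"
      by (intro sum.cong refl H10_integration_by_parts[OF \<psi>] G sd)
    also have "\<dots> = - (\<integral>x. \<psi> x * V x \<partial>ball_measure)"
      unfolding V_def laplacian_def sum_distrib_left sum_negf
      by (subst Bochner_Integration.integral_sum) (auto intro!: L2_mult_integrable L2 smooth_L2_ball sd)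
    finally show ?thesis .
  qed
  have 4: "(\<integral>x. v x * g x \<partial>sphere_measure) = (\<Sum>b\<in>Basis. \<integral>x. \<gamma> b x * (of_real (x \<bullet> b) * v x) \<partial>sphere_measure)"
  proof -
    have i: "integrable sphere_measure (\<lambda>x. \<gamma> b x * (of_real (x \<bullet> b) * v x))" if "b \<in> Basis" for b
      by (intro L2_mult_integrable L2' that smooth_L2_sphere smooth_mult smooth_inner v)
    have "(\<integral>x. v x * g x \<partial>sphere_measure) = (\<integral>x. (\<Sum>b\<in>Basis. \<gamma> b x * (of_real (x \<bullet> b) * v x)) \<partial>sphere_measure)"
    proof (rule integral_cong_AE)
      show "(\<lambda>x. v x * g x) \<in> borel_measurable sphere_measure"
        by (intro borel_measurable_times L2_measurable gL2 smooth_L2_sphere v)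
      show "(\<lambda>x. \<Sum>b\<in>Basis. \<gamma> b x * (of_real (x \<bullet> b) * v x)) \<in> borel_measurable sphere_measure"
        by (intro borel_measurable_sum borel_measurable_integrable i)
      show "AE x in sphere_measure. v x * g x = (\<Sum>b\<in>Basis. \<gamma> b x * (of_real (x \<bullet> b) * v x))"
        using g by eventually_elim (simp add: sum_distrib_left mult_ac)
    qed
    then show ?thesis by (simp add: Bochner_Integration.integral_sum i)
  qed
  have "c = (\<integral>x. \<Delta>\<psi> x * v x \<partial>ball_measure) - (\<integral>x. \<psi> x * \<Delta>v x \<partial>ball_measure)"
    unfolding c using L2_mult_integrable[OF vL2 L2(2)] L2_mult_integrable[OF L2(1,3)]
    by (simp add: mult.commute[of "v _"])
  also have "\<dots> = (\<Sum>b\<in>Basis. \<integral>x. K b x * v x \<partial>ball_measure) + (\<Sum>b\<in>Basis. \<integral>x. G b x * partial_deriv b v x \<partial>ball_measure)"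
    unfolding 1 2 3 by simp
  also have "\<dots> = (\<Sum>b\<in>Basis. \<integral>x. \<gamma> b x * (of_real (x \<bullet> b) * v x) \<partial>sphere_measure)"
    unfolding sum.distrib[symmetric] by (intro sum.cong refl) (simp add: K_eq[symmetric] add.commute)
  finally show ?thesis using 4 by simp
qed

section \<open>Nonreal zeros of the characteristic function\<close>

lemma half_plane_max_modulus:
  fixes Q :: "complex \<Rightarrow> complex"
  assumes hol: "Q holomorphic_on {z. Im z > 0}"
    and cont: "continuous_on {z. Im z \<ge> 0} Q"
    and bounded: "\<And>z. Im z \<ge> 0 \<Longrightarrow> norm (Q z) \<le> M"
    and real_line: "\<And>z. Im z = 0 \<Longrightarrow> norm (Q z) \<le> 1"
    and z: "Im z > 0"
  shows "norm (Q z) \<le> 1"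
proof -
  have den: "norm (1 - \<i> * of_real e * w) \<ge> 1" "norm (1 - \<i> * of_real e * w) \<ge> e * norm w"
    "1 - \<i> * of_real e * w \<noteq> 0" if "e > 0" "Im w \<ge> 0" for e w
  proof -
    have "Re (1 - \<i> * of_real e * w) = 1 + e * Im w" by simp
    moreover have "e * Im w \<ge> 0" using that by simp
    ultimately show 1: "norm (1 - \<i> * of_real e * w) \<ge> 1"
      using complex_Re_le_cmod[of "1 - \<i> * of_real e * w"] by linarith
    then show "1 - \<i> * of_real e * w \<noteq> 0" by force
    have "(e * norm w)\<^sup>2 = (e * Re w)\<^sup>2 + (e * Im w)\<^sup>2"
      by (simp add: power_mult_distrib cmod_power2 algebra_simps)
    also have "\<dots> \<le> (e * Re w)\<^sup>2 + (1 + e * Im w)\<^sup>2"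
      using \<open>e * Im w \<ge> 0\<close> by (simp add: power_mono)
    also have "\<dots> = (norm (1 - \<i> * of_real e * w))\<^sup>2"
      by (simp add: cmod_power2)
    finally show "norm (1 - \<i> * of_real e * w) \<ge> e * norm w"
      by (rule power2_le_imp_le) simp
  qed
  have key: "norm (Q z) \<le> norm (1 - \<i> * of_real e * z)" if e: "e > 0" for e
  proof -
    define R where "R = max (norm z + 1) (\<bar>M\<bar> / e)"
    define S where "S = {w. Im w > 0} \<inter> ball 0 R"
    define g where "g = (\<lambda>w. Q w / (1 - \<i> * of_real e * w))"
    have openS: "open S" unfolding S_def by (intro open_Int open_halfspace_Im_gt open_ball)
    have clS: "closure S \<subseteq> {w. Im w \<ge> 0} \<inter> cball 0 R"
      unfolding S_def
      by (rule closure_minimal) (auto intro!: closed_Int closed_halfspace_Im_ge)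
    have "norm (g z) \<le> 1"
    proof (rule maximum_modulus_frontier[where f=g and S=S])
      show "g holomorphic_on interior S"
        unfolding g_def using den(3)[OF e] interior_subset[of S]
        by (intro holomorphic_intros holomorphic_on_subset[OF hol]) (auto simp: S_def)
      show "continuous_on (closure S) g"
        unfolding g_def using den(3)[OF e] clS
        by (intro continuous_intros continuous_on_subset[OF cont]) auto
      show "bounded S" unfolding S_def by (simp add: bounded_Int)
      show "z \<in> S" using z by (simp add: S_def R_def)
      fix w assume "w \<in> frontier S"
      then have w: "w \<in> closure S" "w \<notin> S" using openS by (auto simp: frontier_def interior_open)
      then have w': "Im w \<ge> 0" "norm w \<le> R" using clS by auto
      consider "Im w = 0" | "norm w = R" using w w' by (auto simp: S_def)
      then show "norm (g w) \<le> 1"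
      proof cases
        case 1
        then show ?thesis using real_line[OF 1] den(1)[OF e w'(1)]
          by (simp add: g_def norm_divide divide_le_eq)
      next
        case 2
        then have "M \<le> e * norm w" using e by (auto simp: R_def max_def field_simps split: if_splits)
        then show ?thesis using bounded[OF w'(1)] den(1,2)[OF e w'(1)]
          by (simp add: g_def norm_divide divide_le_eq)
      qed
    qed
    then show ?thesis using den(1)[OF e, of z] z by (simp add: g_def norm_divide divide_le_eq split: if_splits)
  qed
  have "((\<lambda>e. norm (1 - \<i> * of_real e * z)) \<longlongrightarrow> norm (1 - \<i> * of_real 0 * z)) (at_right 0)"
    by (intro tendsto_intros)
  moreover have "eventually (\<lambda>e. norm (Q z) \<le> norm (1 - \<i> * of_real e * z)) (at_right 0)"
    using key by (auto simp: eventually_at_filter)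
  ultimately show ?thesis
    using tendsto_lowerbound[where F="at_right (0::real)"] by force
qed

text \<open>The case \<open>a = b = 1\<close> is \<open>sin (m z) cos z - m cos (m z) sin z\<close>. Real translates stay in the
  family, with \<open>a\<close> and \<open>b\<close> on the unit circle.\<close>

definition twofreq :: "real \<Rightarrow> complex \<Rightarrow> complex \<Rightarrow> complex \<Rightarrow> complex" where
  "twofreq m a b z =
    (of_real (1 - m) * (a * exp (\<i> * of_real (m+1) * z) - cnj a * exp (- \<i> * of_real (m+1) * z)) +
     of_real (1 + m) * (b * exp (\<i> * of_real (m-1) * z) - cnj b * exp (- \<i> * of_real (m-1) * z)))
    / (4 * \<i>)"

lemma twofreq_1_1:
  "twofreq m 1 1 z = sin (of_real m * z) * cos z - of_real m * cos (of_real m * z) * sin z"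
proof -
  define p q I J where "p = exp (\<i> * (of_real m * z))" and "q = exp (\<i> * z)"
    and "I = exp (- (\<i> * (of_real m * z)))" and "J = exp (- (\<i> * z))"
  have e: "exp (\<i> * of_real (m+1) * z) = p * q" "exp (- \<i> * of_real (m+1) * z) = I * J"
     "exp (\<i> * of_real (m-1) * z) = p * J" "exp (- \<i> * of_real (m-1) * z) = I * q"
    unfolding p_def q_def I_def J_def exp_add[symmetric]
    by (rule arg_cong[where f=exp], simp add: algebra_simps)+
  have e2: "sin (of_real m * z) = (p - I) / (2 * \<i>)" "cos (of_real m * z) = (p + I) / 2"
    "sin z = (q - J) / (2 * \<i>)" "cos z = (q + J) / 2"
    unfolding p_def q_def I_def J_def by (simp_all add: sin_exp_eq cos_exp_eq)
  show ?thesis unfolding twofreq_def e e2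
    by (simp add: divide_simps) (simp add: algebra_simps)
qed

lemma twofreq_translate:
  "twofreq m a b (z + of_real x) =
   twofreq m (a * cis ((m+1) * x)) (b * cis ((m-1) * x)) z"
proof -
  have *: "exp (\<i> * of_real c * (z + of_real x)) = cis (c * x) * exp (\<i> * of_real c * z)"
    "exp (- \<i> * of_real c * (z + of_real x)) = cnj (cis (c * x)) * exp (- \<i> * of_real c * z)" for c
    by (simp_all add: cis_conv_exp exp_cnj exp_add[symmetric] algebra_simps)
  show ?thesis unfolding twofreq_def * complex_cnj_mult by (simp only: mult_ac)
qed

lemma twofreq_times_4i:
  "4 * \<i> * twofreq m a b z =
    of_real (1 - m) * (a * exp (\<i> * of_real (m+1) * z) - cnj a * exp (- \<i> * of_real (m+1) * z)) +
    of_real (1 + m) * (b * exp (\<i> * of_real (m-1) * z) - cnj b * exp (- \<i> * of_real (m-1) * z))"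
  unfolding twofreq_def by simp

lemma twofreq_diff_le:
  assumes "m > 0"
  shows "norm (twofreq m a b z - twofreq m a' b' z)
     \<le> (1 + m) * (norm (a - a') + norm (b - b')) * exp ((1 + m) * \<bar>Im z\<bar>)"
proof -
  define E where "E = exp ((1 + m) * \<bar>Im z\<bar>)"
  have E: "norm (exp (\<i> * of_real c * z)) \<le> E" "norm (exp (- \<i> * of_real c * z)) \<le> E" if "\<bar>c\<bar> \<le> 1 + m" for c
  proof -
    have "\<bar>c * Im z\<bar> \<le> (1 + m) * \<bar>Im z\<bar>" using that by (simp add: abs_mult mult_right_mono)
    from abs_le_D1[OF this] abs_le_D2[OF this]
    show "norm (exp (\<i> * of_real c * z)) \<le> E" "norm (exp (- \<i> * of_real c * z)) \<le> E"
      unfolding E_def norm_exp_eq_Re exp_le_cancel_iff by simp_all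
  qed
  have est: "norm (of_real k * (u * exp (\<i> * of_real c * z) - cnj u * exp (- \<i> * of_real c * z)))
     \<le> (1 + m) * (2 * norm u * E)" if "\<bar>k\<bar> \<le> 1 + m" "\<bar>c\<bar> \<le> 1 + m" for k c u
  proof -
    have "norm (u * exp (\<i> * of_real c * z) - cnj u * exp (- \<i> * of_real c * z)) \<le>
      norm u * norm (exp (\<i> * of_real c * z)) + norm u * norm (exp (- \<i> * of_real c * z))"
      by (rule order_trans[OF norm_triangle_ineq4]) (simp add: norm_mult)
    also have "\<dots> \<le> norm u * E + norm u * E"
      using E[OF that(2)] by (intro add_mono mult_left_mono) auto
    finally show ?thesis unfolding norm_mult norm_of_real using that assms
      by (intro mult_mono) (auto simp: E_def)
  qed
  have "4 * norm (twofreq m a b z - twofreq m a' b' z) = norm (4 * \<i> * (twofreq m a b z - twofreq m a' b' z))"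
    by (simp add: norm_mult)
  also have "4 * \<i> * (twofreq m a b z - twofreq m a' b' z) =
     of_real (1 - m) * ((a - a') * exp (\<i> * of_real (m+1) * z) - cnj (a - a') * exp (- \<i> * of_real (m+1) * z)) +
     of_real (1 + m) * ((b - b') * exp (\<i> * of_real (m-1) * z) - cnj (b - b') * exp (- \<i> * of_real (m-1) * z))"
    unfolding right_diff_distrib[of "4 * \<i>"] twofreq_times_4i complex_cnj_diff left_diff_distrib
    by (simp only: algebra_simps)
  also have "norm \<dots> \<le> (1 + m) * (2 * norm (a - a') * E) + (1 + m) * (2 * norm (b - b') * E)"
    by (intro order_trans[OF norm_triangle_ineq] add_mono est) (use assms in auto)
  also have "\<dots> \<le> 4 * ((1 + m) * (norm (a - a') + norm (b - b')) * E)"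
    using assms by (simp add: algebra_simps E_def)
  finally show ?thesis by (simp add: E_def)
qed

lemma twofreq_le:
  assumes "m > 0" "norm a = 1" "norm b = 1"
  shows "norm (twofreq m a b z) \<le> 2 * (1 + m) * exp ((1 + m) * \<bar>Im z\<bar>)"
proof -
  have "twofreq m 0 0 z = 0" by (simp add: twofreq_def)
  then show ?thesis using twofreq_diff_le[OF assms(1), of a b z 0 0] assms by (simp add: algebra_simps)
qed

lemma twofreq_ge:
  assumes "m > 0" "m \<noteq> 1"
  obtains Y d where "Y > 0" "d > 0"
    "\<And>a b z. \<lbrakk>norm a = 1; norm b = 1; Im z \<ge> Y\<rbrakk> \<Longrightarrow> norm (twofreq m a b z) \<ge> d * exp ((1 + m) * Im z)"
proof -
  define G where "G = (\<lambda>y. \<bar>1 - m\<bar> * (1 - exp (- 2 * (m+1) * y))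
     - 2 * (1 + m) * exp ((\<bar>m-1\<bar> - (m+1)) * y))"
  have lt: "\<bar>m-1\<bar> - (m+1) < 0" using assms by auto
  have "(G \<longlongrightarrow> \<bar>1 - m\<bar>) at_top"
  proof -
    have 1: "((\<lambda>y. exp (c * y)) \<longlongrightarrow> 0) at_top" if "c < 0" for c :: real
      using that by real_asymp
    have "(G \<longlongrightarrow> \<bar>1 - m\<bar> * (1 - 0) - 2 * (1 + m) * 0) at_top"
      unfolding G_def using assms lt by (intro tendsto_intros 1) auto
    then show ?thesis by simp
  qed
  moreover have "\<bar>1 - m\<bar> / 2 < \<bar>1 - m\<bar>" using assms by auto
  ultimately have "eventually (\<lambda>y. G y > \<bar>1 - m\<bar> / 2) at_top"
    by (rule order_tendstoD(1))
  then obtain Y0 where Y0: "\<And>y. y \<ge> Y0 \<Longrightarrow> G y > \<bar>1 - m\<bar> / 2"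
    by (auto simp: eventually_at_top_linorder)
  define Y where "Y = max 1 Y0"
  have "norm (twofreq m a b z) \<ge> (\<bar>1 - m\<bar> / 8) * exp ((1 + m) * Im z)"
    if ab: "norm a = 1" "norm b = 1" and z: "Im z \<ge> Y" for a b z
  proof -
    define y where "y = Im z"
    have y: "y \<ge> 1" "y \<ge> Y0" using z by (auto simp: Y_def y_def)
    have n: "norm (exp (\<i> * of_real c * z)) = exp (- c * y)" "norm (exp (- \<i> * of_real c * z)) = exp (c * y)" for c
      by (auto simp: norm_exp_eq_Re y_def)
    have A: "norm (a * exp (\<i> * of_real (m+1) * z) - cnj a * exp (- \<i> * of_real (m+1) * z))
       \<ge> exp ((m+1) * y) - exp (- (m+1) * y)"
      using norm_triangle_ineq2[of "cnj a * exp (- \<i> * of_real (m+1) * z)" "a * exp (\<i> * of_real (m+1) * z)"]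
      unfolding norm_mult n by (simp add: ab norm_minus_commute)
    have "norm (b * exp (\<i> * of_real (m-1) * z) - cnj b * exp (- \<i> * of_real (m-1) * z))
       \<le> exp (- (m-1) * y) + exp ((m-1) * y)"
      using norm_triangle_ineq4[of "b * exp (\<i> * of_real (m-1) * z)" "cnj b * exp (- \<i> * of_real (m-1) * z)"]
      unfolding norm_mult n by (simp add: ab)
    also have "\<dots> \<le> exp (\<bar>m-1\<bar> * y) + exp (\<bar>m-1\<bar> * y)"
      using y by (intro add_mono) (auto intro!: mult_right_mono)
    finally have B: "norm (b * exp (\<i> * of_real (m-1) * z) - cnj b * exp (- \<i> * of_real (m-1) * z))
       \<le> 2 * exp (\<bar>m-1\<bar> * y)" by simp
    have "4 * norm (twofreq m a b z) = norm (4 * \<i> * twofreq m a b z)" by (simp add: norm_mult)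
    moreover have "norm (4 * \<i> * twofreq m a b z) \<ge> 
      norm (of_real (1 - m) * (a * exp (\<i> * of_real (m+1) * z) - cnj a * exp (- \<i> * of_real (m+1) * z))) -
      norm (of_real (1 + m) * (b * exp (\<i> * of_real (m-1) * z) - cnj b * exp (- \<i> * of_real (m-1) * z)))"
      unfolding twofreq_times_4i by (rule norm_diff_ineq)
    ultimately have "4 * norm (twofreq m a b z) \<ge> \<bar>1 - m\<bar> * (exp ((m+1) * y) - exp (- (m+1) * y))
        - (1 + m) * (2 * exp (\<bar>m-1\<bar> * y))"
    proof -
      have "\<bar>1 + m\<bar> = 1 + m" using assms by simp
      then show ?thesis if "4 * norm (twofreq m a b z) = norm (4 * \<i> * twofreq m a b z)"
        "norm (4 * \<i> * twofreq m a b z) \<ge> norm (of_real (1 - m) * (a * exp (\<i> * of_real (m+1) * z) - cnj a * exp (- \<i> * of_real (m+1) * z))) -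
      norm (of_real (1 + m) * (b * exp (\<i> * of_real (m-1) * z) - cnj b * exp (- \<i> * of_real (m-1) * z)))"
        using mult_left_mono[OF A, of "\<bar>1 - m\<bar>"] mult_left_mono[OF B, of "1 + m"] that assms
        unfolding norm_mult[of "of_real (1 - m)"] norm_mult[of "of_real (1 + m)"] norm_of_real by linarith
    qed
    also have "\<bar>1 - m\<bar> * (exp ((m+1) * y) - exp (- (m+1) * y)) - (1 + m) * (2 * exp (\<bar>m-1\<bar> * y))
       = exp ((1+m) * y) * G y"
    proof -
      have 1: "exp (- (m+1) * y) = exp ((1+m) * y) * exp (- 2 * (m+1) * y)"
        unfolding exp_add[symmetric] by (rule arg_cong[where f=exp]) (simp add: algebra_simps)
      have 2: "exp (\<bar>m-1\<bar> * y) = exp ((1+m) * y) * exp ((\<bar>m-1\<bar> - (m+1)) * y)"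
        unfolding exp_add[symmetric] by (rule arg_cong[where f=exp]) (simp add: algebra_simps)
      show ?thesis unfolding G_def 1 2 by (simp only: algebra_simps)
    qed
    finally have "4 * norm (twofreq m a b z) \<ge> exp ((1+m) * y) * (\<bar>1 - m\<bar> / 2)"
      using Y0[OF y(2)] by (smt (verit) exp_gt_zero mult_less_cancel_left_pos)
    then show ?thesis by (simp add: y_def mult.commute)
  qed
  then show ?thesis using that[of Y "\<bar>1 - m\<bar> / 8"] assms by (auto simp: Y_def)
qed

lemma twofreq_holomorphic: "twofreq m a b holomorphic_on S"
  unfolding twofreq_def by (intro holomorphic_intros) auto

lemma twofreq_uniform_limit:
  assumes "m > 0" "compact K" "a \<longlonglongrightarrow> a0" "b \<longlonglongrightarrow> b0"
  shows "uniform_limit K (\<lambda>j. twofreq m (a j) (b j)) (twofreq m a0 b0) sequentially"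
proof -
  obtain B where B: "\<And>z. z \<in> K \<Longrightarrow> norm z \<le> B" using compact_imp_bounded[OF assms(2)] by (auto simp: bounded_iff)
  define C where "C = (1 + m) * exp ((1 + m) * B)"
  have C: "C > 0" using assms by (simp add: C_def)
  have lim: "(\<lambda>j. norm (a j - a0) + norm (b j - b0)) \<longlonglongrightarrow> 0"
    using assms by (auto intro!: tendsto_eq_intros simp: LIM_zero_iff tendsto_norm_zero_iff)
  show ?thesis
  proof (rule uniform_limitI)
    fix e :: real assume "e > 0"
    then have "eventually (\<lambda>j. norm (a j - a0) + norm (b j - b0) < e / C) sequentially"
      using order_tendstoD(2)[OF lim] C by simp
    then show "\<forall>\<^sub>F j in sequentially. \<forall>z\<in>K. dist (twofreq m (a j) (b j) z) (twofreq m a0 b0 z) < e"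
    proof eventually_elim
      case (elim j)
      show ?case
      proof
        fix z assume "z \<in> K"
        then have "\<bar>Im z\<bar> \<le> B" using B abs_Im_le_cmod order_trans by blast
        then have "exp ((1 + m) * \<bar>Im z\<bar>) \<le> exp ((1 + m) * B)" using assms by simp
        then have "(1 + m) * (norm (a j - a0) + norm (b j - b0)) * exp ((1 + m) * \<bar>Im z\<bar>)
          \<le> (1 + m) * (norm (a j - a0) + norm (b j - b0)) * exp ((1 + m) * B)"
          using assms by (intro mult_left_mono) auto
        also have "\<dots> = (norm (a j - a0) + norm (b j - b0)) * C" by (simp add: C_def)
        also have "\<dots> < e" using elim C by (simp add: field_simps)
        finally show "dist (twofreq m (a j) (b j) z) (twofreq m a0 b0 z) < e"
          unfolding dist_norm using twofreq_diff_le[OF assms(1), of "a j" "b j" z a0 b0] by linarith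
      qed
    qed
  qed
qed

lemma connected_upper: "connected {z. Im z > 0}"
  by (intro convex_connected convex_halfspace_Im_gt)

lemma twofreq_not_constant:
  assumes "m > 0" "m \<noteq> 1" "norm a = 1" "norm b = 1"
  shows "\<not> twofreq m a b constant_on {z. Im z > 0}"
proof
  assume "twofreq m a b constant_on {z. Im z > 0}"
  then obtain c where c: "\<And>z. Im z > 0 \<Longrightarrow> twofreq m a b z = c" by (auto simp: constant_on_def)
  obtain Y d where Y: "Y > 0" "d > 0"
    "\<And>a b z. \<lbrakk>norm a = 1; norm b = 1; Im z \<ge> Y\<rbrakk> \<Longrightarrow> norm (twofreq m a b z) \<ge> d * exp ((1 + m) * Im z)"
    using twofreq_ge[OF assms(1,2)] by blast
  have "filterlim (\<lambda>y. d * exp ((1 + m) * y)) at_top at_top"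
    using Y(2) assms(1) by real_asymp
  then have "eventually (\<lambda>y. d * exp ((1 + m) * y) > norm c) at_top"
    by (simp add: filterlim_at_top_dense)
  then have "eventually (\<lambda>y. d * exp ((1 + m) * y) > norm c \<and> y \<ge> Y) at_top"
    using eventually_ge_at_top by (rule eventually_conj)
  then obtain y where "d * exp ((1 + m) * y) > norm c" "y \<ge> Y"
    unfolding eventually_at_top_linorder by blast
  then show False using Y(3)[of a b "Complex 0 y"] c[of "Complex 0 y"] Y assms by auto
qed

lemma circle_seq_convergent:
  fixes a b :: "nat \<Rightarrow> complex"
  assumes "\<And>j. norm (a j) = 1" "\<And>j. norm (b j) = 1"
  obtains r a0 b0 where "strict_mono r" "(a \<circ> r) \<longlonglongrightarrow> a0" "(b \<circ> r) \<longlonglongrightarrow> b0" "norm a0 = 1" "norm b0 = 1"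
proof -
  have "compact (sphere (0::complex) 1 \<times> sphere (0::complex) 1)"
    by (intro compact_Times compact_sphere)
  then obtain l r where l: "l \<in> sphere (0::complex) 1 \<times> sphere (0::complex) 1"
    and r: "strict_mono (r::nat\<Rightarrow>nat)" "((\<lambda>j. (a j, b j)) \<circ> r) \<longlonglongrightarrow> l"
    using assms by (elim compact_imp_seq_compact[THEN seq_compactE, where f="\<lambda>j. (a j, b j)"]) auto
  show ?thesis
    using that[OF r(1), of "fst l" "snd l"] tendsto_fst[OF r(2)] tendsto_snd[OF r(2)] l
    by (auto simp: o_def mem_Times_iff)
qed

lemma twofreq_uniformly_nonzero:
  assumes m: "m > 0" "m \<noteq> 1" and h: "h > 0"
    and nz: "\<And>z. Im z > 0 \<Longrightarrow> twofreq m 1 1 z \<noteq> 0"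
  obtains d where "d > 0" "\<And>z. Im z \<ge> h \<Longrightarrow> norm (twofreq m 1 1 z) \<ge> d * exp ((1 + m) * Im z)"
proof -
  obtain Y d where Y: "Y > 0" "d > 0"
    "\<And>a b z. \<lbrakk>norm a = 1; norm b = 1; Im z \<ge> Y\<rbrakk> \<Longrightarrow> norm (twofreq m a b z) \<ge> d * exp ((1 + m) * Im z)"
    using twofreq_ge[OF m] by blast
  have "\<exists>e>0. \<forall>z. h \<le> Im z \<and> Im z \<le> Y \<longrightarrow> norm (twofreq m 1 1 z) \<ge> e"
  proof (rule ccontr)
    assume "\<not> ?thesis"
    then have "\<exists>z. h \<le> Im z \<and> Im z \<le> Y \<and> norm (twofreq m 1 1 z) < inverse (Suc j)" for j :: nat
      by (metis inverse_positive_iff_positive not_le of_nat_0_less_iff zero_less_Suc)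
    then obtain z where z: "\<And>j. h \<le> Im (z j)" "\<And>j. Im (z j) \<le> Y"
      "\<And>j. norm (twofreq m 1 1 (z j)) < inverse (Suc j)" by metis
    define a b where "a = (\<lambda>j. cis ((m+1) * Re (z j)))" and "b = (\<lambda>j. cis ((m-1) * Re (z j)))"
    have tr: "twofreq m (a j) (b j) w = twofreq m 1 1 (w + of_real (Re (z j)))" for j w
      unfolding twofreq_translate by (simp add: a_def b_def)
    obtain r0 a0 b0 where r0: "strict_mono r0" "(a \<circ> r0) \<longlonglongrightarrow> a0" "(b \<circ> r0) \<longlonglongrightarrow> b0" 
      and ab0: "norm a0 = 1" "norm b0 = 1"
      by (rule circle_seq_convergent[of a b]) (simp_all add: a_def b_def)
    have "\<forall>j. (Im \<circ> z \<circ> r0) j \<in> {h..Y}" using z by auto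
    then obtain y r1 where y: "y \<in> {h..Y}" and r1: "strict_mono r1" "((Im \<circ> z \<circ> r0) \<circ> r1) \<longlonglongrightarrow> y"
      by (rule seq_compactE[OF compact_imp_seq_compact[OF compact_Icc[of h Y]]])
    define r where "r = r0 \<circ> r1"
    have r: "strict_mono r" using r0(1) r1(1) by (simp add: r_def strict_mono_o)
    have ar: "(\<lambda>j. a (r j)) \<longlonglongrightarrow> a0" "(\<lambda>j. b (r j)) \<longlonglongrightarrow> b0" "(\<lambda>j. Im (z (r j))) \<longlonglongrightarrow> y"
      using LIMSEQ_subseq_LIMSEQ[OF r0(2) r1(1)] LIMSEQ_subseq_LIMSEQ[OF r0(3) r1(1)] r1(2)
      by (simp_all add: r_def o_def)
    have "twofreq m a0 b0 (\<i> * of_real y) \<noteq> 0"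
    proof (rule Hurwitz_no_zeros[of "{z. Im z > 0}" "\<lambda>j. twofreq m (a (r j)) (b (r j))" "twofreq m a0 b0"])
      show "open {z. Im z > 0}" by (rule open_halfspace_Im_gt)
      show "connected {z. Im z > 0}" by (rule connected_upper)
      show "\<not> twofreq m a0 b0 constant_on {z. Im z > 0}" by (rule twofreq_not_constant[OF m ab0])
      show "uniform_limit K (\<lambda>j. twofreq m (a (r j)) (b (r j))) (twofreq m a0 b0) sequentially" if "compact K" for K
        by (rule twofreq_uniform_limit[OF m(1) that ar(1,2)])
      show "twofreq m (a (r n)) (b (r n)) z \<noteq> 0" if "z \<in> {z. Im z > 0}" for n z
        using nz that by (simp add: tr)
    qed (use y h in \<open>auto intro: twofreq_holomorphic\<close>)
    moreover have "twofreq m a0 b0 (\<i> * of_real y) = 0"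
    proof -
      have "(\<lambda>j. twofreq m (a (r j)) (b (r j)) (\<i> * of_real (Im (z (r j))))) \<longlonglongrightarrow> twofreq m a0 b0 (\<i> * of_real y)"
        unfolding twofreq_def by (intro tendsto_intros ar) auto
      moreover have "twofreq m (a (r j)) (b (r j)) (\<i> * of_real (Im (z (r j)))) = twofreq m 1 1 (z (r j))" for j
        unfolding tr by (rule arg_cong[where f="twofreq m 1 1"]) (simp add: complex_eq_iff)
      moreover have "(\<lambda>j. twofreq m 1 1 (z (r j))) \<longlonglongrightarrow> 0"
      proof (rule Lim_null_comparison)
        show "\<forall>\<^sub>F j in sequentially. norm (twofreq m 1 1 (z (r j))) \<le> inverse (Suc (r j))"
          using z(3) by (intro always_eventually allI less_imp_le)
        show "(\<lambda>j. inverse (real (Suc (r j)))) \<longlonglongrightarrow> 0"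
          using LIMSEQ_subseq_LIMSEQ[OF LIMSEQ_inverse_real_of_nat r] by (simp add: o_def)
      qed
      ultimately show ?thesis by (simp add: LIMSEQ_unique)
    qed
    ultimately show False by simp
  qed
  then obtain e where e: "e > 0" "\<And>z. \<lbrakk>h \<le> Im z; Im z \<le> Y\<rbrakk> \<Longrightarrow> norm (twofreq m 1 1 z) \<ge> e" by blast
  show ?thesis
  proof (rule that[of "min d (e / exp ((1 + m) * Y))"])
    show "min d (e / exp ((1 + m) * Y)) > 0" using Y(2) e(1) by simp
    fix z assume z: "Im z \<ge> h"
    show "norm (twofreq m 1 1 z) \<ge> min d (e / exp ((1 + m) * Y)) * exp ((1 + m) * Im z)"
    proof (cases "Im z \<le> Y")
      case True
      then have "exp ((1 + m) * Im z) \<le> exp ((1 + m) * Y)" using m by simp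
      then have "min d (e / exp ((1 + m) * Y)) * exp ((1 + m) * Im z) \<le> (e / exp ((1 + m) * Y)) * exp ((1 + m) * Y)"
        using e(1) Y(2) by (intro mult_mono) auto
      then show ?thesis using order_trans[OF _ e(2)[OF z True]] by simp
    next
      case False
      then have "min d (e / exp ((1 + m) * Y)) * exp ((1 + m) * Im z) \<le> d * exp ((1 + m) * Im z)"
        by (intro mult_right_mono) auto
      also have "\<dots> \<le> norm (twofreq m 1 1 z)" using False by (intro Y(3)) auto
      finally show ?thesis .
    qed
  qed
qed

lemma sin_Complex: "sin (Complex x y) = Complex (sin x * cosh y) (cos x * sinh y)"
  by (simp add: complex_eq_iff Re_sin Im_sin cosh_def sinh_def)

lemma cos_Complex: "cos (Complex x y) = Complex (cos x * cosh y) (- (sin x * sinh y))"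
  by (simp add: complex_eq_iff Re_cos Im_cos cosh_def sinh_def field_simps)

lemma twofreq_cnj: "twofreq m 1 1 (cnj z) = cnj (twofreq m 1 1 z)"
proof (cases z)
  case (Complex x y)
  have "of_real m * Complex x u = Complex (m * x) (m * u)" for u
    by (simp add: complex_eq_iff)
  moreover have "cnj (Complex x y) = Complex x (- y)"
    by (simp add: complex_eq_iff)
  ultimately show ?thesis
    unfolding Complex twofreq_1_1 by (simp only: sin_Complex cos_Complex) (simp add: complex_eq_iff)
qed

lemma twofreq_monotone:
  assumes m: "m > 0" "m \<noteq> 1" and "b > 0"
    and nz: "\<And>z. Im z > 0 \<Longrightarrow> twofreq m 1 1 z \<noteq> 0"
  shows "norm (twofreq m 1 1 (of_real x)) \<le> norm (twofreq m 1 1 (Complex x b))"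
proof -
  define h where "h = b / 2"
  have h: "h > 0" using assms by (simp add: h_def)
  obtain d where d: "d > 0" "\<And>z. Im z \<ge> h \<Longrightarrow> norm (twofreq m 1 1 z) \<ge> d * exp ((1 + m) * Im z)"
    using twofreq_uniformly_nonzero[OF m h nz] by blast
  define f where "f = twofreq m 1 1"
  define Q where "Q = (\<lambda>z. f (z - \<i> * of_real h) / f (z + \<i> * of_real h))"
  have f_cnj: "f (cnj z) = cnj (f z)" for z
    by (simp add: f_def twofreq_cnj)
  have fnz: "f (z + \<i> * of_real h) \<noteq> 0" if "Im z \<ge> 0" for z
    using nz[of "z + \<i> * of_real h"] that h by (simp add: f_def)
  have hol_f: "f holomorphic_on UNIV" by (simp add: f_def twofreq_holomorphic)
  have hol1: "(\<lambda>z. f (z - \<i> * of_real h)) holomorphic_on A" for A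
    using holomorphic_on_compose[of "\<lambda>z. z - \<i> * of_real h" A f] holomorphic_on_subset[OF hol_f]
    by (simp add: holomorphic_on_diff o_def)
  have hol2: "(\<lambda>z. f (z + \<i> * of_real h)) holomorphic_on A" for A
    using holomorphic_on_compose[of "\<lambda>z. z + \<i> * of_real h" A f] holomorphic_on_subset[OF hol_f]
    by (simp add: holomorphic_on_add o_def)
  have "norm (Q (Complex x h)) \<le> 1"
  proof (rule half_plane_max_modulus[where M="2 * (1 + m) / d" and Q=Q])
    have hol: "Q holomorphic_on {z. Im z \<ge> 0}" unfolding Q_def
      using fnz by (intro holomorphic_intros hol1 hol2) auto
    then show "Q holomorphic_on {z. Im z > 0}" by (rule holomorphic_on_subset) auto
    show "continuous_on {z. Im z \<ge> 0} Q" by (rule holomorphic_on_imp_continuous_on[OF hol])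
    show "0 < Im (Complex x h)" using h by simp
  next
    fix z assume z: "Im z = 0"
    then have "cnj (z + \<i> * of_real h) = z - \<i> * of_real h" by (simp add: complex_eq_iff)
    then have "norm (f (z - \<i> * of_real h)) = norm (f (z + \<i> * of_real h))"
      by (metis complex_mod_cnj f_cnj)
    then show "norm (Q z) \<le> 1" by (simp add: Q_def norm_divide)
  next
    fix z assume z: "Im z \<ge> 0"
    have "norm (f (z - \<i> * of_real h)) \<le> 2 * (1 + m) * exp ((1 + m) * \<bar>Im z - h\<bar>)"
      using twofreq_le[OF m(1), of 1 1 "z - \<i> * of_real h"] by (simp add: f_def)
    also have "\<dots> \<le> 2 * (1 + m) * exp ((1 + m) * (Im z + h))"
      using z h m by (intro mult_left_mono) auto
    also have "\<dots> = (2 * (1 + m) / d) * (d * exp ((1 + m) * Im (z + \<i> * of_real h)))"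
      using d by simp
    also have "\<dots> \<le> (2 * (1 + m) / d) * norm (f (z + \<i> * of_real h))"
      using d(1) d(2)[of "z + \<i> * of_real h"] m z by (intro mult_left_mono) (auto simp: f_def)
    finally show "norm (Q z) \<le> 2 * (1 + m) / d"
      using fnz[OF z] by (simp add: Q_def norm_divide divide_le_eq)
  qed
  moreover have "Complex x h - \<i> * of_real h = of_real x" "Complex x h + \<i> * of_real h = Complex x b"
    by (simp_all add: complex_eq_iff h_def)
  moreover have "f (Complex x b) \<noteq> 0" using nz[of "Complex x b"] assms by (simp add: f_def)
  ultimately show ?thesis by (simp add: Q_def norm_divide divide_le_eq f_def)
qed

text \<open>At the critical point \<open>\<pi>\<close> the function and its second derivative have the same sign, so
  its modulus decreases in the imaginary direction.\<close>

lemma twofreq_zero_upper_gt_1: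
  assumes m: "m > 1" "m \<notin> \<int>"
  shows "\<exists>z. Im z > 0 \<and> twofreq m 1 1 z = 0"
proof (rule ccontr)
  assume "\<not> ?thesis"
  then have nz: "\<And>z. Im z > 0 \<Longrightarrow> twofreq m 1 1 z \<noteq> 0" by blast
  define S C where "S = sin (m * pi)" and "C = cos (m * pi)"
  have S: "S \<noteq> 0" using m(2) by (auto simp: S_def sin_zero_iff_int2)
  define \<psi> where "\<psi> = (\<lambda>b. (S * (cosh (m*b) * cosh b - m * sinh b * sinh (m*b)))\<^sup>2 +
      (C * (sinh (m*b) * cosh b - m * sinh b * cosh (m*b)))\<^sup>2)"
  have norm_eq: "(norm (twofreq m 1 1 (Complex pi b)))\<^sup>2 = \<psi> b" for b
  proof -
    have e: "of_real m * Complex pi b = Complex (m * pi) (m * b)" by (simp add: complex_eq_iff)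
    have "twofreq m 1 1 (Complex pi b) =
      Complex (- (S * (cosh (m*b) * cosh b - m * sinh b * sinh (m*b))))
              (- (C * (sinh (m*b) * cosh b - m * sinh b * cosh (m*b))))"
      unfolding twofreq_1_1 e sin_Complex cos_Complex S_def[symmetric] C_def[symmetric]
      by (simp add: complex_eq_iff algebra_simps)
    then show ?thesis by (simp add: cmod_power2 \<psi>_def)
  qed
  have ge: "\<psi> b \<ge> S\<^sup>2" if "b > 0" for b
  proof -
    have "(norm (twofreq m 1 1 (of_real pi)))\<^sup>2 \<le> (norm (twofreq m 1 1 (Complex pi b)))\<^sup>2"
      using twofreq_monotone[OF _ _ that nz, of pi] m by (intro power_mono) auto
    moreover have "of_real pi = Complex pi 0" by (simp add: complex_eq_iff)
    moreover have "\<psi> 0 = S\<^sup>2" by (simp add: \<psi>_def)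
    ultimately show ?thesis by (simp only: norm_eq)
  qed
  have 1: "((\<lambda>b::real. (cosh b - 1) / b\<^sup>2) \<longlongrightarrow> 1 / 2) (at_right 0)"
     "((\<lambda>b. (cosh (m*b) - 1) / b\<^sup>2) \<longlongrightarrow> m\<^sup>2 / 2) (at_right 0)"
     "((\<lambda>b::real. sinh b / b) \<longlongrightarrow> 1) (at_right 0)"
     "((\<lambda>b. sinh (m*b) / b) \<longlongrightarrow> m) (at_right 0)"
    unfolding cosh_def sinh_def real_scaleR_def using m by (real_asymp simp: field_simps power2_eq_square)+
  define X where "X = (\<lambda>b. cosh (m*b) * cosh b - m * sinh b * sinh (m*b))"
  define U where "U = (\<lambda>b. (cosh (m*b) - 1) / b\<^sup>2 * cosh b + (cosh b - 1) / b\<^sup>2 - m * (sinh b / b) * (sinh (m*b) / b))"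
  define V where "V = (\<lambda>b. sinh (m*b) / b * cosh b - m * (sinh b / b) * cosh (m*b))"
  have "(U \<longlongrightarrow> m\<^sup>2 / 2 * cosh 0 + 1 / 2 - m * 1 * m) (at_right 0)"
    unfolding U_def by (intro tendsto_intros 1)
  moreover have "m\<^sup>2 / 2 * cosh 0 + 1 / 2 - m * 1 * m = (1 - m\<^sup>2) / 2"
    by (simp add: power2_eq_square field_simps)
  ultimately have U: "(U \<longlongrightarrow> (1 - m\<^sup>2) / 2) (at_right 0)" by (simp only:)
  have "(V \<longlongrightarrow> m * cosh 0 - m * 1 * cosh (m*0)) (at_right 0)"
    unfolding V_def by (intro tendsto_intros 1)
  then have V: "(V \<longlongrightarrow> 0) (at_right 0)" by simp
  have "(X \<longlongrightarrow> cosh (m*0) * cosh 0 - m * sinh 0 * sinh (m*0)) (at_right 0)"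
    unfolding X_def by (intro tendsto_intros)
  then have X: "(X \<longlongrightarrow> 1) (at_right 0)" by simp
  have "((\<lambda>b. S\<^sup>2 * (U b * (1 + X b)) + (C * V b)\<^sup>2) \<longlongrightarrow> 
      S\<^sup>2 * ((1 - m\<^sup>2) / 2 * (1 + 1)) + (C * 0)\<^sup>2) (at_right 0)"
    by (intro tendsto_intros U V X)
  then have lim: "((\<lambda>b. S\<^sup>2 * (U b * (1 + X b)) + (C * V b)\<^sup>2) \<longlongrightarrow> S\<^sup>2 * (1 - m\<^sup>2)) (at_right 0)"
    by (simp add: right_diff_distrib diff_divide_distrib)
  have "S\<^sup>2 * (1 - m\<^sup>2) < 0"
    using S m by (intro mult_pos_neg) (simp_all add: one_less_power)
  moreover have "eventually (\<lambda>b. 0 \<le> S\<^sup>2 * (U b * (1 + X b)) + (C * V b)\<^sup>2) (at_right 0)"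
    unfolding eventually_at_filter
  proof (intro always_eventually allI impI)
    fix b :: real assume "b \<noteq> 0" "b \<in> {0<..}"
    then have b: "b > 0" by simp
    have "b\<^sup>2 * U b = (cosh (m*b) - 1) * cosh b + (cosh b - 1) - m * sinh b * sinh (m*b)"
      unfolding U_def using b by (simp add: divide_simps power2_eq_square)
    then have 2: "X b - 1 = b\<^sup>2 * U b" unfolding X_def by (simp add: left_diff_distrib)
    have 3: "sinh (m*b) * cosh b - m * sinh b * cosh (m*b) = b * V b"
      unfolding V_def using b by (simp add: divide_simps)
    have "0 \<le> \<psi> b - S\<^sup>2" using ge[OF b] by simp
    also have "\<psi> b - S\<^sup>2 = S\<^sup>2 * ((X b - 1) * (1 + X b)) + (C * (b * V b))\<^sup>2"
    proof -
      have "\<psi> b = (S * X b)\<^sup>2 + (C * (b * V b))\<^sup>2" by (simp only: \<psi>_def 3 X_def)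
      then show ?thesis by (simp add: power2_eq_square algebra_simps)
    qed
    also have "\<dots> = b\<^sup>2 * (S\<^sup>2 * (U b * (1 + X b)) + (C * V b)\<^sup>2)"
      unfolding 2 by (simp add: power_mult_distrib ring_distribs)
    finally show "0 \<le> S\<^sup>2 * (U b * (1 + X b)) + (C * V b)\<^sup>2"
      using b by (simp add: zero_le_mult_iff)
  qed
  ultimately show False
    using tendsto_lowerbound[OF lim, of 0] by simp
qed

lemma twofreq_zero_upper:
  assumes m: "m > 0" "m \<notin> \<int>" "1 / m \<notin> \<int>"
  obtains z where "Im z > 0" "twofreq m 1 1 z = 0"
proof (cases "m > 1")
  case True
  then show ?thesis using twofreq_zero_upper_gt_1 m that by blast
next
  case False
  moreover have "m \<noteq> 1" using m by auto
  ultimately have "1 / m > 1" using m by simp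
  then obtain z where z: "Im z > 0" "twofreq (1 / m) 1 1 z = 0"
    using twofreq_zero_upper_gt_1 m by blast
  define w where "w = z / of_real m"
  have "z = of_real m * w" "of_real (1 / m) * z = w" using m by (simp_all add: w_def)
  with z(2) have "sin w * cos (of_real m * w) - of_real (1 / m) * cos w * sin (of_real m * w) = 0"
    unfolding twofreq_1_1 by simp
  then have "twofreq m 1 1 w = 0" using m unfolding twofreq_1_1 by (simp add: field_simps)
  moreover have "Im w > 0" using z m by (simp add: w_def)
  ultimately show ?thesis using that by blast
qed

lemma circle_near_periods:
  fixes p q e :: real and N :: nat
  assumes "e > 0"
  obtains t :: nat where "t \<ge> N" "norm (cis (p * t) - 1) < e" "norm (cis (q * t) - 1) < e"
proof -
  obtain r :: "nat \<Rightarrow> nat" and a0 b0 where r: "strict_mono r" "(\<lambda>j. cis (p * r j)) \<longlonglongrightarrow> a0" "(\<lambda>j. cis (q * r j)) \<longlonglongrightarrow> b0"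
    by (rule circle_seq_convergent[of "\<lambda>j. cis (p * real j)" "\<lambda>j. cis (q * real j)"]) (auto simp: o_def)
  have "Cauchy (\<lambda>j. cis (p * r j))" "Cauchy (\<lambda>j. cis (q * r j))"
    using r(2,3)[THEN LIMSEQ_imp_Cauchy] by simp_all
  then obtain M1 M2 where
    M1: "\<And>i j. \<lbrakk>i \<ge> M1; j \<ge> M1\<rbrakk> \<Longrightarrow> norm (cis (p * r i) - cis (p * r j)) < e" and
    M2: "\<And>i j. \<lbrakk>i \<ge> M2; j \<ge> M2\<rbrakk> \<Longrightarrow> norm (cis (q * r i) - cis (q * r j)) < e"
    using assms unfolding Cauchy_iff by meson
  define i j where "i = max M1 M2" and "j = i + N"
  have ij: "r i + N \<le> r j"
  proof -
    have "r i + k \<le> r (i + k)" for k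
    proof (induction k)
      case (Suc k)
      have "r (i + k) < r (i + Suc k)" using r(1) by (simp add: strict_mono_def)
      with Suc show ?case by simp
    qed simp
    then show ?thesis by (simp add: j_def)
  qed
  have eq: "norm (cis (c * (r j - r i)) - 1) = norm (cis (c * r j) - cis (c * r i))" for c :: real
  proof -
    have "cis (c * r j) - cis (c * r i) = cis (c * r i) * (cis (c * (r j - r i)) - 1)"
      using ij by (simp add: algebra_simps cis_mult of_nat_diff)
    then show ?thesis by (simp add: norm_mult)
  qed
  show ?thesis
  proof (rule that[of "r j - r i"])
    show "N \<le> r j - r i" using ij by simp
    show "norm (cis (p * real (r j - r i)) - 1) < e" using M1[of j i] eq[of p] by (simp add: i_def j_def)
    show "norm (cis (q * real (r j - r i)) - 1) < e" using M2[of j i] eq[of q] by (simp add: i_def j_def)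
  qed
qed

lemma norm_sin_le_exp: "norm (sin z) \<le> exp \<bar>Im z\<bar>" for z :: complex
proof -
  have "norm (sin z) = norm (exp (\<i> * z) - exp (- (\<i> * z))) / 2"
    by (simp add: sin_exp_eq norm_divide norm_mult)
  also have "norm (exp (\<i> * z) - exp (- (\<i> * z))) \<le> exp (- Im z) + exp (Im z)"
    by (rule order_trans[OF norm_triangle_ineq4]) (simp add: norm_exp_eq_Re)
  also have "\<dots> \<le> 2 * exp \<bar>Im z\<bar>" 
    by (cases "Im z \<ge> 0") auto
  finally show ?thesis by simp
qed

text \<open>The perturbation is of order \<open>1 / Re z\<close> in horizontal strips, so translating by large
  almost periods and applying Hurwitz' theorem yields zeros near translates of a single zero.\<close>

lemma infinite_nonreal_zeros:
  assumes m: "m > 0" "m \<notin> \<int>" "1 / m \<notin> \<int>"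
  shows "infinite {k::complex. Im k > 0 \<and> 
    sin (of_real m * k) * cos k - of_real m * cos (of_real m * k) * sin k
      + c / k * sin k * sin (of_real m * k) = 0}" (is "infinite ?Z")
proof
  assume fin: "finite ?Z"
  obtain z0 where z0: "Im z0 > 0" "twofreq m 1 1 z0 = 0" using twofreq_zero_upper[OF m] .
  have m1: "m \<noteq> 1" using m by auto
  obtain B where B: "\<And>z. z \<in> ?Z \<Longrightarrow> norm z \<le> B"
    using finite_imp_bounded[OF fin] unfolding bounded_iff by blast
  define S where "S = {z. Im z > 0} \<inter> ball z0 1"
  define N0 :: nat where "N0 = nat \<lceil>\<bar>B\<bar> + norm z0 + 2\<rceil>"
  have "\<exists>t::nat. t \<ge> N0 + j \<and> norm (cis ((m+1) * t) - 1) < inverse (Suc j) \<and> norm (cis ((m-1) * t) - 1) < inverse (Suc j)" for j :: nat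
    by (rule circle_near_periods[of "inverse (Suc j)" "N0 + j" "m+1" "m-1"]) auto
  then obtain t :: "nat \<Rightarrow> nat" where t: "\<And>j. t j \<ge> N0 + j"
    "\<And>j. norm (cis ((m+1) * t j) - 1) < inverse (Suc j)" "\<And>j. norm (cis ((m-1) * t j) - 1) < inverse (Suc j)"
    by metis
  have lim1: "(\<lambda>j. cis (d * t j)) \<longlonglongrightarrow> 1" if "\<And>j. norm (cis (d * t j) - 1) < inverse (Suc j)" for d :: real
  proof -
    have "(\<lambda>j. cis (d * t j) - 1) \<longlonglongrightarrow> 0"
      by (rule Lim_null_comparison[OF _ LIMSEQ_inverse_real_of_nat]) (use that in \<open>auto intro!: always_eventually less_imp_le\<close>)
    then show ?thesis by (simp add: LIM_zero_iff)
  qed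
  define T where "T = (\<lambda>j. twofreq m (cis ((m+1) * t j)) (cis ((m-1) * t j)))"
  define P where "P = (\<lambda>(j::nat) (z::complex). c / (z + t j) * sin (z + t j) * sin (of_real m * (z + t j)))"
  have T_eq: "T j z = twofreq m 1 1 (z + t j)" for j z
    using twofreq_translate[of m 1 1 z "t j"] by (simp add: T_def)
  have N0: "real N0 \<ge> \<bar>B\<bar> + norm z0 + 2" unfolding N0_def by linarith
  have big: "norm (z + t j) \<ge> \<bar>B\<bar> + 1 + j" if "z \<in> ball z0 1" for z j
  proof -
    have "norm (z - z0) < 1" using that by (simp add: dist_norm norm_minus_commute)
    then have "norm z \<le> norm z0 + 1" using norm_triangle_sub[of z z0] by simp
    moreover have "norm (of_nat (t j) :: complex) \<le> norm (z + t j) + norm z"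
      using norm_triangle_ineq4[of "z + t j" z] by simp
    moreover have "real (t j) \<ge> N0 + j" using t(1)[of j] by linarith
    ultimately show ?thesis using N0 by simp
  qed
  have "twofreq m 1 1 z0 \<noteq> 0"
  proof (rule Hurwitz_no_zeros[of S "\<lambda>j z. T j z + P j z" "twofreq m 1 1"])
    show "open S" unfolding S_def by (intro open_Int open_halfspace_Im_gt open_ball)
    show "connected S" unfolding S_def by (intro convex_connected convex_Int convex_halfspace_Im_gt convex_ball)
    show "z0 \<in> S" using z0 by (simp add: S_def)
    have nz: "z + t j \<noteq> 0" if "z \<in> S" for z j
    proof
      assume "z + t j = 0"
      then have "Im (z + t j) = 0" by simp
      then show False using that by (simp add: S_def)
    qed
    show "(\<lambda>z. T n z + P n z) holomorphic_on S" for n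
      unfolding T_def P_def using nz by (intro holomorphic_intros twofreq_holomorphic) auto
    show "twofreq m 1 1 holomorphic_on S" by (rule twofreq_holomorphic)
    show "\<not> twofreq m 1 1 constant_on S"
    proof
      assume "twofreq m 1 1 constant_on S"
      then obtain d where d: "\<And>z. z \<in> S \<Longrightarrow> twofreq m 1 1 z = d" by (auto simp: constant_on_def)
      have "twofreq m 1 1 z - d = 0" if "z \<in> {z. Im z > 0}" for z
      proof (rule analytic_continuation_open[of S "{z. Im z > 0}" "\<lambda>z. twofreq m 1 1 z - d" "\<lambda>_. 0"])
        show "open S" by fact
        show "S \<noteq> {}" using \<open>z0 \<in> S\<close> by auto
      qed (use that d connected_upper in \<open>auto simp: S_def open_halfspace_Im_gt intro!: holomorphic_intros twofreq_holomorphic\<close>)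
      then have "twofreq m 1 1 constant_on {z. Im z > 0}" by (auto simp: constant_on_def)
      then show False using twofreq_not_constant[OF m(1) m1, of 1 1] by simp
    qed
    show "T n z + P n z \<noteq> 0" if "z \<in> S" for n z
    proof
      assume "T n z + P n z = 0"
      moreover have "Im (z + t n) > 0" using that by (simp add: S_def)
      ultimately have "z + t n \<in> ?Z" by (simp add: T_eq P_def twofreq_1_1)
      then have "norm (z + t n) \<le> B" by (rule B)
      moreover have "norm (z + t n) \<ge> \<bar>B\<bar> + 1 + n" using big that by (simp add: S_def)
      ultimately show False by linarith
    qed
    show "uniform_limit K (\<lambda>j z. T j z + P j z) (twofreq m 1 1) sequentially" if K: "compact K" "K \<subseteq> S" for K
    proof -
      obtain R where R: "\<And>z. z \<in> K \<Longrightarrow> norm z \<le> R" using compact_imp_bounded[OF K(1)] by (auto simp: bounded_iff)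
      define D where "D = norm c * exp R * exp (m * R)"
      have bound: "norm (P j z) \<le> D / j" if "z \<in> K" "j > 0" for j z
      proof -
        have im: "\<bar>Im z\<bar> \<le> R" using R[OF that(1)] abs_Im_le_cmod[of z] by simp
        have 1: "norm (sin (z + t j)) \<le> exp R"
          by (rule order_trans[OF norm_sin_le_exp]) (use im in simp)
        have "\<bar>Im (of_real m * (z + t j))\<bar> \<le> m * R" using im m by (simp add: abs_mult)
        then have 2: "norm (sin (of_real m * (z + t j))) \<le> exp (m * R)"
          by (intro order_trans[OF norm_sin_le_exp]) simp
        have "norm (z + t j) \<ge> \<bar>B\<bar> + 1 + j" using big that K(2) by (auto simp: S_def)
        then have "norm (z + t j) \<ge> j" by linarith
        then have 3: "norm (c / (z + t j)) \<le> norm c / j"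
          using that by (simp add: norm_divide frac_le)
        show ?thesis
          unfolding P_def D_def norm_mult using mult_mono[OF mult_mono[OF 3 1] 2] by simp
      qed
      have "uniform_limit K P (\<lambda>_. 0) sequentially"
      proof (rule uniform_limitI)
        fix e :: real assume "e > 0"
        have "(\<lambda>j. D / real j) \<longlonglongrightarrow> 0" by (rule lim_const_over_n)
        then have "eventually (\<lambda>j. D / real j < e) sequentially" using \<open>e > 0\<close> by (rule order_tendstoD(2))
        then show "\<forall>\<^sub>F j in sequentially. \<forall>z\<in>K. dist (P j z) 0 < e"
          using eventually_gt_at_top[of 0]
        proof eventually_elim
          case (elim j)
          show ?case
          proof
            fix z assume "z \<in> K"
            then show "dist (P j z) 0 < e" using bound[of z j] elim by simp
          qed
        qed
      qed
      from uniform_limit_add[OF twofreq_uniform_limit[OF m(1) K(1) lim1[OF t(2)] lim1[OF t(3)]] this]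
      show ?thesis by (simp add: T_def)
    qed
  qed
  then show False using z0 by simp
qed

section \<open>Radial eigenfunctions\<close>

text \<open>The entire function with \<open>z * sinc_sqrt (z\<^sup>2) = sin z\<close>; the radial solution of the Helmholtz
  equation with wave number \<open>k\<close> is \<open>sinc_sqrt (k\<^sup>2 \<bar>x\<bar>\<^sup>2) = sin (k \<bar>x\<bar>) / (k \<bar>x\<bar>)\<close>.\<close>

definition sinc_coeff :: "nat \<Rightarrow> complex" where
  "sinc_coeff i = (- 1) ^ i / fact (2 * i + 1)"

definition sinc_sqrt :: "complex \<Rightarrow> complex" where
  "sinc_sqrt z = (\<Sum>i. sinc_coeff i * z ^ i)"

lemma summable_sinc_coeff: "summable (\<lambda>i. sinc_coeff i * z ^ i)"
proof (rule summable_comparison_test')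
  show "summable (\<lambda>i. inverse (fact i) * norm z ^ i)" by (rule summable_exp)
  fix i :: nat
  have "(fact i :: real) \<le> fact (2 * i + 1)" by (intro fact_mono) simp
  then have "1 / fact (2 * i + 1) \<le> inverse (fact i :: real)" by (simp add: divide_simps)
  from mult_right_mono[OF this, of "norm z ^ i"]
  show "norm (sinc_coeff i * z ^ i) \<le> inverse (fact i) * norm z ^ i"
    by (simp add: sinc_coeff_def norm_mult norm_divide norm_power del: fact_Suc)
qed

lemma sinc_sqrt_has_field_derivative:
  "(sinc_sqrt has_field_derivative (\<Sum>i. diffs sinc_coeff i * z ^ i)) (at z)"
  unfolding sinc_sqrt_def[abs_def]
  by (rule termdiffs_strong_converges_everywhere[OF summable_sinc_coeff])

lemma sinc_sqrt_holomorphic: "sinc_sqrt holomorphic_on A"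
  by (meson sinc_sqrt_has_field_derivative field_differentiable_at_within field_differentiable_def holomorphic_on_def)

lemma deriv_sinc_sqrt_holomorphic: "deriv sinc_sqrt holomorphic_on UNIV"
  by (intro holomorphic_deriv sinc_sqrt_holomorphic open_UNIV)

lemma DERIV_sinc_sqrt: "(sinc_sqrt has_field_derivative deriv sinc_sqrt z) (at z)"
  by (rule holomorphic_derivI[OF sinc_sqrt_holomorphic open_UNIV UNIV_I])

lemma DERIV_deriv_sinc_sqrt: "(deriv sinc_sqrt has_field_derivative deriv (deriv sinc_sqrt) z) (at z)"
  by (rule holomorphic_derivI[OF deriv_sinc_sqrt_holomorphic open_UNIV UNIV_I])

lemma sinc_sqrt_sin: "z * sinc_sqrt (z\<^sup>2) = sin z"
proof -
  have "(\<lambda>n. sin_coeff n *\<^sub>R z ^ n) sums sin z" by (rule sin_converges)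
  then have "(\<lambda>i. sin_coeff (2 * i + 1) *\<^sub>R z ^ (2 * i + 1)) sums sin z"
    by (subst sums_mono_reindex[of "\<lambda>i. 2 * i + 1" "\<lambda>n. sin_coeff n *\<^sub>R z ^ n"])
       (auto simp: strict_mono_def sin_coeff_def elim!: oddE)
  moreover have "sin_coeff (2 * i + 1) *\<^sub>R z ^ (2 * i + 1) = z * (sinc_coeff i * (z\<^sup>2) ^ i)" for i
    by (simp add: sin_coeff_def sinc_coeff_def scaleR_conv_of_real power_mult[symmetric] mult_ac del: fact_Suc)
  ultimately have "(\<lambda>i. z * (sinc_coeff i * (z\<^sup>2) ^ i)) sums sin z" by simp
  moreover have "(\<lambda>i. z * (sinc_coeff i * (z\<^sup>2) ^ i)) sums (z * sinc_sqrt (z\<^sup>2))"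
    unfolding sinc_sqrt_def by (intro sums_mult summable_sums summable_sinc_coeff)
  ultimately show ?thesis by (rule sums_unique2[symmetric])
qed

lemma sinc_sqrt_cos: "sinc_sqrt (z\<^sup>2) + 2 * z\<^sup>2 * deriv sinc_sqrt (z\<^sup>2) = cos z"
proof -
  have "((\<lambda>z. z * sinc_sqrt (z\<^sup>2)) has_field_derivative (sinc_sqrt (z\<^sup>2) + 2 * z\<^sup>2 * deriv sinc_sqrt (z\<^sup>2))) (at z)"
    by (auto intro!: derivative_eq_intros DERIV_chain2[OF DERIV_sinc_sqrt] simp: power2_eq_square)
  moreover have "((\<lambda>z. z * sinc_sqrt (z\<^sup>2)) has_field_derivative cos z) (at z)"
    unfolding sinc_sqrt_sin by (rule DERIV_sin)
  ultimately show ?thesis by (rule DERIV_unique)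
qed

lemma sinc_sqrt_0: "sinc_sqrt 0 = 1"
  unfolding sinc_sqrt_def by (subst powser_zero) (simp add: sinc_coeff_def)

lemma sinc_sqrt_ode: "4 * w * deriv (deriv sinc_sqrt) w + 6 * deriv sinc_sqrt w = - sinc_sqrt w"
proof (cases "w = 0")
  case True
  have "deriv sinc_sqrt 0 = (\<Sum>i. diffs sinc_coeff i * 0 ^ i)"
    by (rule DERIV_imp_deriv[OF sinc_sqrt_has_field_derivative])
  also have "\<dots> = - 1 / 6" by (subst powser_zero) (simp add: diffs_def sinc_coeff_def fact_numeral)
  finally show ?thesis using True by (simp add: sinc_sqrt_0)
next
  case False
  define z where "z = csqrt w"
  have z: "z\<^sup>2 = w" "z \<noteq> 0" using False by (auto simp: z_def)
  have "((\<lambda>z. sinc_sqrt (z\<^sup>2) + 2 * z\<^sup>2 * deriv sinc_sqrt (z\<^sup>2)) has_field_derivative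
     (6 * z * deriv sinc_sqrt (z\<^sup>2) + 4 * z * z\<^sup>2 * deriv (deriv sinc_sqrt) (z\<^sup>2))) (at z)"
    by (auto intro!: derivative_eq_intros DERIV_chain2[OF DERIV_sinc_sqrt] DERIV_chain2[OF DERIV_deriv_sinc_sqrt]
        simp: power2_eq_square algebra_simps)
  moreover have "((\<lambda>z. sinc_sqrt (z\<^sup>2) + 2 * z\<^sup>2 * deriv sinc_sqrt (z\<^sup>2)) has_field_derivative - sin z) (at z)"
    unfolding sinc_sqrt_cos by (rule DERIV_cos)
  ultimately have "6 * z * deriv sinc_sqrt (z\<^sup>2) + 4 * z * z\<^sup>2 * deriv (deriv sinc_sqrt) (z\<^sup>2) = - sin z"
    by (rule DERIV_unique)
  then have "z * (4 * w * deriv (deriv sinc_sqrt) w + 6 * deriv sinc_sqrt w) = z * (- sinc_sqrt w)"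
    unfolding sinc_sqrt_sin[symmetric] z(1) by (simp add: algebra_simps)
  then show ?thesis using z(2) mult_left_cancel by blast
qed

definition helmholtz :: "complex \<Rightarrow> complex \<Rightarrow> 'a::euclidean_space \<Rightarrow> complex" where
  "helmholtz a c x = a * sinc_sqrt (c * of_real (x \<bullet> x))"

lemma smooth_helmholtz: "smooth (helmholtz a c)"
proof -
  have "(\<lambda>z. a * sinc_sqrt (c * z)) holomorphic_on UNIV"
    using holomorphic_on_compose[of "\<lambda>z. c * z" UNIV sinc_sqrt]
    by (intro holomorphic_on_mult holomorphic_on_const)
       (auto simp: o_def holomorphic_on_linear intro: sinc_sqrt_holomorphic)
  from smooth_radial[OF smooth_on_reals_holomorphic[OF this]]
  show ?thesis unfolding helmholtz_def[abs_def] .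
qed

lemma partial_deriv_helmholtz:
  "partial_deriv b (helmholtz a c) x = of_real (2 * (x \<bullet> b)) * (a * c * deriv sinc_sqrt (c * of_real (x \<bullet> x)))"
  unfolding helmholtz_def[abs_def]
proof (rule partial_deriv_radial[where g="\<lambda>t. a * sinc_sqrt (c * of_real t)"], rule has_vector_derivative_real_field)
  show "((\<lambda>z. a * sinc_sqrt (c * z)) has_field_derivative a * c * deriv sinc_sqrt (c * of_real (x \<bullet> x))) (at (of_real (x \<bullet> x)))"
    by (auto intro!: derivative_eq_intros DERIV_chain2[OF DERIV_sinc_sqrt])
qed

lemma partial_deriv2_helmholtz:
  assumes b: "b \<in> Basis"
  shows "partial_deriv b (partial_deriv b (helmholtz a c)) x =
     2 * (a * c * deriv sinc_sqrt (c * of_real (x \<bullet> x))) +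
     of_real (2 * (x \<bullet> b)) * (of_real (2 * (x \<bullet> b)) * (a * c * c * deriv (deriv sinc_sqrt) (c * of_real (x \<bullet> x))))"
proof -
  define g where "g = (\<lambda>t. a * c * deriv sinc_sqrt (c * of_real t))"
  have g: "(g has_vector_derivative a * c * c * deriv (deriv sinc_sqrt) (c * of_real t)) (at t)" for t
    unfolding g_def
  proof (rule has_vector_derivative_real_field)
    show "((\<lambda>z. a * c * deriv sinc_sqrt (c * z)) has_field_derivative
        a * c * c * deriv (deriv sinc_sqrt) (c * of_real t)) (at (of_real t))"
      by (auto intro!: derivative_eq_intros DERIV_chain2[OF DERIV_deriv_sinc_sqrt])
  qed
  have l: "((\<lambda>x::'a. of_real (2 * (x \<bullet> b)) :: complex) has_derivative (\<lambda>h. of_real (2 * (h \<bullet> b)))) (at x)"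
    by (auto intro!: derivative_eq_intros)
  have r: "((\<lambda>x::'a. g (x \<bullet> x)) has_derivative (\<lambda>h. (2 * (x \<bullet> h)) *\<^sub>R (a * c * c * deriv (deriv sinc_sqrt) (c * of_real (x \<bullet> x))))) (at x)"
    by (rule has_derivative_radial[OF g])
  have eq: "partial_deriv b (helmholtz a c) = (\<lambda>x. of_real (2 * (x \<bullet> b)) * g (x \<bullet> x))"
    by (rule ext) (simp add: partial_deriv_helmholtz g_def)
  show ?thesis
    unfolding eq using partial_deriv_eqI[OF has_derivative_mult[OF l r], of b] b
    by (simp add: g_def scaleR_conv_of_real inner_Basis)
qed

lemma laplacian_helmholtz:
  assumes "DIM('a::euclidean_space) = 3"
  shows "laplacian (helmholtz a c) (x::'a) = - (c * helmholtz a c x)"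
proof -
  define w where "w = c * of_real (x \<bullet> x)"
  define d1 d2 where "d1 = deriv sinc_sqrt w" and "d2 = deriv (deriv sinc_sqrt) w"
  have sq: "(\<Sum>b\<in>Basis. of_real (x \<bullet> b) * of_real (x \<bullet> b) :: complex) = of_real (x \<bullet> x)"
    by (subst euclidean_inner[of x x]) simp
  have "laplacian (helmholtz a c) x = (\<Sum>b\<in>Basis. 2 * (a * c * d1) + 4 * (a * c * c * d2) * (of_real (x \<bullet> b) * of_real (x \<bullet> b)))"
    unfolding laplacian_def w_def d1_def d2_def
    by (intro sum.cong refl) (simp add: partial_deriv2_helmholtz algebra_simps)
  also have "\<dots> = 6 * (a * c * d1) + 4 * (a * c * c * d2) * of_real (x \<bullet> x)"
    using assms by (simp add: sum.distrib sum_distrib_left[symmetric] sq)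
  also have "\<dots> = a * c * (4 * w * d2 + 6 * d1)" by (simp add: w_def algebra_simps)
  also have "\<dots> = a * c * (- sinc_sqrt w)" unfolding d1_def d2_def by (simp only: sinc_sqrt_ode)
  finally show ?thesis by (simp add: helmholtz_def w_def)
qed

lemma helmholtz_has_weak_laplacian:
  assumes "DIM('a::euclidean_space) = 3"
  shows "has_weak_laplacian (ball (0::'a) 1) (helmholtz a c) (\<lambda>x. - (c * helmholtz a c x))"
proof -
  have "laplacian (helmholtz a c) = (\<lambda>x::'a. - (c * helmholtz a c x))"
    by (rule ext) (rule laplacian_helmholtz[OF assms])
  then show ?thesis using smooth_has_weak_laplacian[OF smooth_helmholtz[of a c]] by metis
qed

lemma helmholtz_normal_derivative:
  assumes "norm x = 1"
  shows "(\<Sum>b\<in>Basis. of_real (x \<bullet> b) * partial_deriv b (helmholtz a c) x) = a * (2 * c * deriv sinc_sqrt c)"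
proof -
  have x: "x \<bullet> x = 1" using assms by (simp add: power2_norm_eq_inner[symmetric])
  have "(\<Sum>b\<in>Basis. of_real (x \<bullet> b) * of_real (x \<bullet> b) :: complex) = of_real (x \<bullet> x)"
    by (subst euclidean_inner[of x x]) simp
  then have "(\<Sum>b\<in>Basis. of_real (x \<bullet> b) * of_real (x \<bullet> b) :: complex) = 1" by (simp add: x)
  moreover have "(\<Sum>b\<in>Basis. of_real (x \<bullet> b) * partial_deriv b (helmholtz a c) x) =
    (\<Sum>b\<in>Basis. (of_real (x \<bullet> b) * of_real (x \<bullet> b)) * (a * (2 * c * deriv sinc_sqrt c)))"
    by (intro sum.cong refl) (simp add: partial_deriv_helmholtz x)
  ultimately show ?thesis by (simp add: sum_distrib_right[symmetric])
qed

lemma smooth_not_AE_0: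
  fixes f :: "'a::euclidean_space \<Rightarrow> complex"
  assumes f: "smooth f" and "f 0 \<noteq> 0"
  shows "\<not> (AE x in lebesgue_on (ball 0 1). f x = 0)"
proof
  assume "AE x in lebesgue_on (ball 0 1). f x = 0"
  then have "AE x in lebesgue. x \<in> ball 0 1 \<longrightarrow> f x = 0"
    by (subst (asm) AE_restrict_space_iff) auto
  then obtain N where N: "N \<in> null_sets lebesgue" "{x. \<not> (x \<in> ball 0 1 \<longrightarrow> f x = 0)} \<subseteq> N"
    by (auto simp: eventually_ae_filter)
  define U where "U = ball 0 1 \<inter> {x. f x \<noteq> 0}"
  have "open U" unfolding U_def
    by (intro open_Int open_ball open_Collect_neq continuous_intros smooth_continuous_on f)
  moreover have "0 \<in> U" using assms by (simp add: U_def)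
  moreover have "negligible U"
    using N by (intro negligible_subset[of N U]) (auto simp: negligible_iff_null_sets U_def)
  ultimately show False using open_not_negligible by blast
qed

lemma partial_deriv_diff_smooth:
  "smooth f \<Longrightarrow> smooth g \<Longrightarrow> partial_deriv b (\<lambda>x. f x - g x) x = partial_deriv b f x - partial_deriv b g x"
  using partial_deriv_eqI[OF has_derivative_diff[OF smooth_has_derivative[of f x] smooth_has_derivative[of g x]], of b]
  by (simp add: partial_deriv_def)

lemma nonreal_zero_is_transmission_eigenvalue:
  fixes k :: complex and n \<eta> :: real
  assumes dim: "DIM('a::euclidean_space) = 3" and n: "n > 0" and k: "Im k > 0"
    and zero: "sin (of_real (sqrt n) * k) * cos k - of_real (sqrt n) * cos (of_real (sqrt n) * k) * sin k
      + of_real \<eta> / k * sin k * sin (of_real (sqrt n) * k) = 0"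
  shows "interior_transmission_eigenvalue (ball (0::'a) 1) sphere_measure (\<lambda>x. x) n \<eta> k"
proof -
  define m z where "m = complex_of_real (sqrt n)" and "z = m * k"
  have m: "m \<noteq> 0" "m\<^sup>2 = of_real n" using n by (auto simp: m_def simp flip: of_real_power)
  have "Im z > 0" using n k by (simp add: z_def m_def)
  then have z0: "z \<noteq> 0" and k0: "k \<noteq> 0" using k by auto
  have sin0: "sin w \<noteq> 0" if "Im w > 0" for w :: complex
    using that by (auto simp: sin_eq_0)
  have z2: "z\<^sup>2 = k\<^sup>2 * of_real n" by (simp add: z_def power_mult_distrib m mult.commute)
  define A B where "A = sinc_sqrt (z\<^sup>2)" and "B = sinc_sqrt (k\<^sup>2)"
  have A: "z * A = sin z" "A + 2 * z\<^sup>2 * deriv sinc_sqrt (z\<^sup>2) = cos z"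
    unfolding A_def by (rule sinc_sqrt_sin, rule sinc_sqrt_cos)
  have B: "k * B = sin k" "B + 2 * k\<^sup>2 * deriv sinc_sqrt (k\<^sup>2) = cos k"
    unfolding B_def by (rule sinc_sqrt_sin, rule sinc_sqrt_cos)
  have "A \<noteq> 0" using A(1) sin0[OF \<open>Im z > 0\<close>] by auto
  have "k * (m * (A * cos k - B * cos z + of_real \<eta> * A * B)) =
     sin z * cos k - m * cos z * sin k + of_real \<eta> / k * sin k * sin z"
    unfolding A(1)[symmetric] B(1)[symmetric] unfolding z_def using k0 by (simp add: algebra_simps)
  also have "\<dots> = 0" using zero by (simp add: z_def m_def)
  finally have "A * cos k - B * cos z + of_real \<eta> * A * B = 0" using k0 m by simp
  then have jump: "B * (2 * z\<^sup>2 * deriv sinc_sqrt (z\<^sup>2)) - A * (2 * k\<^sup>2 * deriv sinc_sqrt (k\<^sup>2)) = of_real \<eta> * (A * B)"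
    unfolding A(2)[symmetric] B(2)[symmetric] by (simp add: algebra_simps)
  define w v :: "'a \<Rightarrow> complex" where "w = helmholtz B (z\<^sup>2)" and "v = helmholtz A (k\<^sup>2)"
  have sw: "smooth w" and sv: "smooth v" by (simp_all add: w_def v_def smooth_helmholtz)
  have su: "smooth (\<lambda>x. w x - v x)" by (rule smooth_diff[OF sw sv])
  have on_sphere: "w x = A * B" "v x = A * B" if "norm x = 1" for x
  proof -
    have "x \<bullet> x = 1" using that by (simp add: power2_norm_eq_inner[symmetric])
    then show "w x = A * B" "v x = A * B" by (simp_all add: w_def v_def helmholtz_def A_def B_def)
  qed
  define h where "h = (\<lambda>x::'a. \<Sum>b\<in>Basis. of_real (x \<bullet> b) * partial_deriv b (\<lambda>x. w x - v x) x)"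
  have h: "h x = of_real \<eta> * v x" if "norm x = 1" for x
  proof -
    have "h x = (\<Sum>b\<in>Basis. of_real (x \<bullet> b) * partial_deriv b w x) - (\<Sum>b\<in>Basis. of_real (x \<bullet> b) * partial_deriv b v x)"
      unfolding h_def partial_deriv_diff_smooth[OF sw sv] by (simp add: right_diff_distrib sum_subtractf)
    also have "\<dots> = of_real \<eta> * (A * B)"
      unfolding w_def v_def helmholtz_normal_derivative[OF that] by (rule jump)
    finally show ?thesis by (simp add: on_sphere[OF that])
  qed
  have nd: "has_normal_deriv (ball 0 1) sphere_measure (\<lambda>x. x) (\<lambda>x. w x - v x) h"
    unfolding h_def by (rule smooth_has_normal_deriv[OF su])
  show ?thesis
    unfolding interior_transmission_eigenvalue_def
  proof (rule exI[of _ w], rule exI[of _ v], intro conjI exI[of _ h] allI impI nd smooth_L2_ball sw sv IntI)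
    have "v 0 \<noteq> 0" using \<open>A \<noteq> 0\<close> by (simp add: v_def helmholtz_def sinc_sqrt_0)
    from smooth_not_AE_0[OF sv this]
    show "\<not> (AE x in lebesgue_on (ball 0 1). w x = 0 \<and> v x = 0)"
      by (auto elim: contrapos_nn)
    show "(\<lambda>x. w x - v x) \<in> H2 (ball 0 1)" by (rule smooth_H2_ball[OF su])
    show "(\<lambda>x. w x - v x) \<in> H10 (ball 0 1)"
      by (rule smooth_zero_on_sphere_H10[OF su]) (simp add: on_sphere)
    show "has_weak_laplacian (ball 0 1) w (\<lambda>x. - (k\<^sup>2 * of_real n * w x))"
      using helmholtz_has_weak_laplacian[OF dim, of B "z\<^sup>2"] by (simp add: w_def z2)
    show "has_weak_laplacian (ball 0 1) v (\<lambda>x. - (k\<^sup>2 * v x))"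
      using helmholtz_has_weak_laplacian[OF dim, of A "k\<^sup>2"] by (simp add: v_def)
    fix g c assume pairing: "weak_trace_pairing (ball 0 1) sphere_measure (\<lambda>x. x) v g c"
    then have g: "g \<in> L2 sphere_measure"
      unfolding weak_trace_pairing_def has_normal_deriv_def by blast
    have c: "c = (\<integral>x. v x * g x \<partial>sphere_measure)" by (rule weak_trace_pairing_smooth[OF sv pairing])
    have hL2: "h \<in> L2 sphere_measure" using nd by (simp add: has_normal_deriv_def)
    have "(\<integral>x. h x * g x \<partial>sphere_measure) = (\<integral>x. of_real \<eta> * (v x * g x) \<partial>sphere_measure)"
    proof (rule integral_cong_AE)
      show "(\<lambda>x. h x * g x) \<in> borel_measurable sphere_measure"
        by (intro borel_measurable_times L2_measurable hL2 g)
      show "(\<lambda>x. of_real \<eta> * (v x * g x)) \<in> borel_measurable sphere_measure"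
        by (intro borel_measurable_times borel_measurable_const L2_measurable smooth_L2_sphere sv g)
      show "AE x in sphere_measure. h x * g x = of_real \<eta> * (v x * g x)"
        using AE_sphere_measure by eventually_elim (simp add: h)
    qed
    then show "(\<integral>x. h x * g x \<partial>sphere_measure) = of_real \<eta> * c" by (simp add: c)
  qed
qed

theorem theorem4p1:
  fixes n :: real
  assumes "n > 0"
    and "sqrt n \<notin> \<int>"
    and "\<not> (\<exists>m\<in>\<int>. sqrt n = 1 / m)"
  shows "\<exists>\<eta>\<^sub>0>0. \<forall>\<eta>::real. 0 < \<eta> \<and> \<eta> < \<eta>\<^sub>0 \<longrightarrow>
    infinite {k::complex. k \<notin> \<real> \<and>
      interior_transmission_eigenvalue (ball (0::real^3) 1) sphere_measure (\<lambda>x. x) n \<eta> k}"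
proof (intro exI[of _ 1] conjI allI impI)
  fix \<eta> :: real
  have "sqrt n = 1 / (1 / sqrt n)" by simp
  then have "1 / sqrt n \<notin> \<int>" using assms(3) by metis
  then have "infinite {k::complex. Im k > 0 \<and>
    sin (of_real (sqrt n) * k) * cos k - of_real (sqrt n) * cos (of_real (sqrt n) * k) * sin k
      + of_real \<eta> / k * sin k * sin (of_real (sqrt n) * k) = 0}"
    using assms by (intro infinite_nonreal_zeros) auto
  then show "infinite {k::complex. k \<notin> \<real> \<and>
      interior_transmission_eigenvalue (ball (0::real^3) 1) sphere_measure (\<lambda>x. x) n \<eta> k}"
  proof (rule infinite_super[rotated], intro subsetI CollectI conjI)
    fix k :: complex
    assume k: "k \<in> {k. Im k > 0 \<and>
      sin (of_real (sqrt n) * k) * cos k - of_real (sqrt n) * cos (of_real (sqrt n) * k) * sin k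
        + of_real \<eta> / k * sin k * sin (of_real (sqrt n) * k) = 0}"
    then show "k \<notin> \<real>" by (auto simp: complex_is_Real_iff)
    show "interior_transmission_eigenvalue (ball (0::real^3) 1) sphere_measure (\<lambda>x. x) n \<eta> k"
      using k assms(1) by (intro nonreal_zero_is_transmission_eigenvalue) auto
  qed
qed simp

end
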